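(* For distributionally robust 2-stage facility location with scenario metric $\kappa_{sc}$ being either the discrete metric or the asymmetric metric $\kappa^{asym}_\infty$, in the $k$-bounded setting $\mathcal{A}=\{A\subseteq\mathcal{C}:|A|\le k\}$, there is a polynomial-time $(6,1)$-approximation algorithm for computing $g(x,y,A)$, for any $(x,y,A)\in X\times\mathbb{R}_{\ge0}\times\mathcal{A}$.
   Context: Facility location instance: facilities $\mathcal{F}$, clients $\mathcal{C}$, a metric $d$ on $\mathcal{F}\cup\mathcal{C}$, first- and second-stage opening costs $f_i,f^{II}_i$ for $i\in\mathcal{F}$. $X=\{0,1\}^{\mathcal{F}}$ (facilities opened in stage I). For $x\in[0,1]^{\mathcal{F}}$ and a scenario $A\subseteq\mathcal{C}$, $g(x,A)$ is the optimal value of the fractional second-stage LP $\min\{\sum_i f^{II}_i z_i+\sum_{j\in A}\sum_i d_{ij}w_{ij}: \sum_i w_{ij}\ge1\ \forall j\in A,\ w_{ij}\le x_i+z_i\ \forall i,j\in A,\ z,w\ge0\}$. The discrete metric is $\kappa_{sc}(A,A')=1$ if $A\ne A'$ and $0$ otherwise; $\kappa^{asym}_\infty(A,A')=\max_{j'\in A'}d(j',A)$ with $d(j',A)=\min_{j\in A}d_{j'j}$. $g(x,y,A)=\max_{A'\in\mathcal{A}}(g(x,A')-y\kappa_{sc}(A,A'))$. A $(\beta_1,\beta_2)$-approximation algorithm for $g(x,y,A)$ returns $\bar A\in\mathcal{A}$ with $g(x,\bar A)-y\kappa_{sc}(A,\bar A)\ge g(x,A')/\beta_1-\beta_2y\kappa_{sc}(A,A')$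 for all $A'\in\mathcal{A}$.
   Formalization: The price y, the metric d and the opening costs are taken to be nonnegative rationals rather than reals, since a polynomial-time algorithm in the bit model needs finitely encoded input; an arbitrary real y has no input length. *)

theory Defs
  imports
    "HOL-Analysis.Analysis"
    "HOL-Library.Log_Nat"
    "HOL-Computational_Algebra.Polynomial"
begin

section \<open>Polynomial time: structured programs for a RAM with logarithmic cost\<close>

text \<open>
  A program works on finitely many named unbounded integer arrays (indirect addressing included) and
  has the arithmetic of the usual RAM. Every operation is charged the bit lengths of its operands,
  of its result and of the addresses it uses, so that, as for every logarithmic-cost RAM, running
  time agrees with multitape Turing machine time up to a polynomial.
\<close>

type_synonym store = "nat \<Rightarrow> nat \<Rightarrow> int"

datatype aexp =
    Const int
  | Get nat aexp \<comment> \<open>array name, index; a negative index is read as \<open>0\<close>\<close>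
  | Add aexp aexp
  | Sub aexp aexp
  | Mul aexp aexp
  | Div aexp aexp

datatype com =
    Skip
  | Put nat aexp aexp \<comment> \<open>array name, index, value\<close>
  | Seq com com
  | IfPos aexp com com
  | WhilePos aexp com

definition bit_length :: "int \<Rightarrow> nat" where
  "bit_length n = Suc (floorlog 2 (nat \<bar>n\<bar>))"

fun aval :: "aexp \<Rightarrow> store \<Rightarrow> int" where
  "aval (Const n) s = n"
| "aval (Get a e) s = s a (nat (aval e s))"
| "aval (Add e1 e2) s = aval e1 s + aval e2 s"
| "aval (Sub e1 e2) s = aval e1 s - aval e2 s"
| "aval (Mul e1 e2) s = aval e1 s * aval e2 s"
| "aval (Div e1 e2) s = aval e1 s div aval e2 s"

fun acost :: "aexp \<Rightarrow> store \<Rightarrow> nat" where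
  "acost (Const n) s = bit_length n"
| "acost (Get a e) s = acost e s + bit_length (aval (Get a e) s)"
| "acost (Add e1 e2) s = acost e1 s + acost e2 s + bit_length (aval (Add e1 e2) s)"
| "acost (Sub e1 e2) s = acost e1 s + acost e2 s + bit_length (aval (Sub e1 e2) s)"
| "acost (Mul e1 e2) s = acost e1 s + acost e2 s + bit_length (aval (Mul e1 e2) s)"
| "acost (Div e1 e2) s = acost e1 s + acost e2 s + bit_length (aval (Div e1 e2) s)"

text \<open>\<open>exec c s t s'\<close>: started in \<open>s\<close>, program \<open>c\<close> halts in \<open>s'\<close> after time \<open>t\<close>.\<close>

inductive exec :: "com \<Rightarrow> store \<Rightarrow> nat \<Rightarrow> store \<Rightarrow> bool" where
  exec_Skip: "exec Skip s 1 s"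
| exec_Put: "exec (Put a e1 e2) s (1 + acost e1 s + acost e2 s)
    (s(a := (s a)(nat (aval e1 s) := aval e2 s)))"
| exec_Seq: "exec c1 s t1 s1 \<Longrightarrow> exec c2 s1 t2 s2 \<Longrightarrow> exec (Seq c1 c2) s (t1 + t2) s2"
| exec_IfPos: "0 < aval e s \<Longrightarrow> exec c1 s t s' \<Longrightarrow> exec (IfPos e c1 c2) s (1 + acost e s + t) s'"
| exec_IfNonpos: "aval e s \<le> 0 \<Longrightarrow> exec c2 s t s' \<Longrightarrow> exec (IfPos e c1 c2) s (1 + acost e s + t) s'"
| exec_WhileNonpos: "aval e s \<le> 0 \<Longrightarrow> exec (WhilePos e c) s (1 + acost e s) s"
| exec_WhilePos: "0 < aval e s \<Longrightarrow> exec c s t1 s1 \<Longrightarrow> exec (WhilePos e c) s1 t2 s2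
    \<Longrightarrow> exec (WhilePos e c) s (1 + acost e s + t1 + t2) s2"

inductive_cases exec_SkipE: "exec Skip s t s'"
inductive_cases exec_PutE: "exec (Put a e1 e2) s t s'"
inductive_cases exec_SeqE: "exec (Seq c1 c2) s t s'"
inductive_cases exec_IfE: "exec (IfPos e c1 c2) s t s'"
inductive_cases exec_WhileE: "exec (WhilePos e c) s t s'"

lemma exec_deterministic:
  "exec c s t s' \<Longrightarrow> exec c s u s'' \<Longrightarrow> u = t \<and> s'' = s'"
proof (induction arbitrary: u s'' rule: exec.induct)
  case exec_Skip
  then show ?case by (auto elim: exec_SkipE)
next
  case exec_Put
  then show ?case by (auto elim: exec_PutE)
next
  case (exec_Seq c1 s t1 s1 c2 t2 s2)
  from exec_Seq.prems obtain v1 r v2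
    where "exec c1 s v1 r" "exec c2 r v2 s''" "u = v1 + v2"
    by (rule exec_SeqE)
  with exec_Seq.IH show ?case by blast
next
  case (exec_IfPos e s c1 t s' c2)
  from exec_IfPos.prems exec_IfPos.hyps obtain v
    where "exec c1 s v s''" "u = 1 + acost e s + v"
    by (auto elim!: exec_IfE)
  with exec_IfPos.IH show ?case by blast
next
  case (exec_IfNonpos e s c2 t s' c1)
  from exec_IfNonpos.prems exec_IfNonpos.hyps obtain v
    where "exec c2 s v s''" "u = 1 + acost e s + v"
    by (auto elim!: exec_IfE)
  with exec_IfNonpos.IH show ?case by blast
next
  case (exec_WhileNonpos e s c)
  from exec_WhileNonpos.prems exec_WhileNonpos.hyps show ?case
    by (auto elim: exec_WhileE)
next
  case (exec_WhilePos e s c t1 s1 t2 s2)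
  from exec_WhilePos.prems exec_WhilePos.hyps(1) obtain v1 r v2
    where "exec c s v1 r" "exec (WhilePos e c) r v2 s''" "u = 1 + acost e s + v1 + v2"
    by (cases rule: exec.cases) auto
  with exec_WhilePos.IH show ?case by blast
qed

text \<open>
  The input word is stored in array \<open>0\<close>, all other cells start as \<open>0\<close>; the output is a set of
  numbers, given by its characteristic sequence in array \<open>1\<close>.
\<close>

definition input_store :: "int list \<Rightarrow> store" where
  "input_store xs = (\<lambda>a i. if a = 0 \<and> i < length xs then xs ! i else 0)"

definition output_set :: "store \<Rightarrow> nat set" where
  "output_set s = {j. s 1 j \<noteq> 0}"

definition input_size :: "int list \<Rightarrow> nat" where
  "input_size xs = (\<Sum>n\<leftarrow>xs. bit_length n)"

definition polytime_solvable :: "'i set \<Rightarrow> ('i \<Rightarrow> int list) \<Rightarrow> ('i \<Rightarrow> nat set \<Rightarrow> bool) \<Rightarrow> bool" where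
  "polytime_solvable Inputs enc correct \<longleftrightarrow>
     (\<exists>(c :: com) (p :: nat poly). \<forall>a\<in>Inputs. \<exists>t s.
        exec c (input_store (enc a)) t s \<and>
        t \<le> poly p (input_size (enc a)) \<and>
        correct a (output_set s))"


section \<open>Two-stage facility location\<close>

text \<open>
  The points of \<open>\<F> \<union> \<C>\<close> are numbered \<open>0, \<dots>, npoints - 1\<close>; a point may be both a facility and a
  client. Numerical data are rational, as they are part of the input of an algorithm.
\<close>

record fl_instance =
  npoints :: nat
  facilities :: "nat set"
  clients :: "nat set"
  fl_dist :: "nat \<Rightarrow> nat \<Rightarrow> rat"
  cost_I :: "nat \<Rightarrow> rat"
  cost_II :: "nat \<Rightarrow> rat"

text \<open>
  \<^const>\<open>Metric_space\<close> also asks for symmetry and nonnegativity outside the carrier. This is no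
  restriction, since the values of \<^const>\<open>fl_dist\<close> there are not used. A facility is required to
  exist because the second-stage program is infeasible otherwise.
\<close>

definition valid_instance :: "fl_instance \<Rightarrow> bool" where
  "valid_instance I \<longleftrightarrow>
     facilities I \<union> clients I = {..<npoints I} \<and>
     facilities I \<noteq> {} \<and>
     Metric_space (facilities I \<union> clients I) (\<lambda>u v. real_of_rat (fl_dist I u v)) \<and>
     (\<forall>i\<in>facilities I. 0 \<le> cost_I I i \<and> 0 \<le> cost_II I i)"

definition stage_I_decisions :: "fl_instance \<Rightarrow> (nat \<Rightarrow> real) set" where
  "stage_I_decisions I = facilities I \<rightarrow> {0, 1}"

definition second_stage_feasible ::
    "fl_instance \<Rightarrow> (nat \<Rightarrow> real) \<Rightarrow> nat set \<Rightarrow> (nat \<Rightarrow> real) \<Rightarrow> (nat \<Rightarrow> nat \<Rightarrow> real) \<Rightarrow> bool" where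
  "second_stage_feasible I x A z w \<longleftrightarrow>
     (\<forall>j\<in>A. (\<Sum>i\<in>facilities I. w i j) \<ge> 1) \<and>
     (\<forall>i\<in>facilities I. \<forall>j\<in>A. w i j \<le> x i + z i) \<and>
     (\<forall>i\<in>facilities I. z i \<ge> 0) \<and>
     (\<forall>i\<in>facilities I. \<forall>j\<in>A. w i j \<ge> 0)"

definition second_stage_cost ::
    "fl_instance \<Rightarrow> nat set \<Rightarrow> (nat \<Rightarrow> real) \<Rightarrow> (nat \<Rightarrow> nat \<Rightarrow> real) \<Rightarrow> real" where
  "second_stage_cost I A z w =
     (\<Sum>i\<in>facilities I. real_of_rat (cost_II I i) * z i) +
     (\<Sum>j\<in>A. \<Sum>i\<in>facilities I. real_of_rat (fl_dist I i j) * w i j)"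

definition second_stage_value :: "fl_instance \<Rightarrow> (nat \<Rightarrow> real) \<Rightarrow> nat set \<Rightarrow> real" where
  "second_stage_value I x A =
     Inf {second_stage_cost I A z w | z w. second_stage_feasible I x A z w}"

definition k_bounded_scenarios :: "fl_instance \<Rightarrow> nat \<Rightarrow> nat set set" where
  "k_bounded_scenarios I k = {A. A \<subseteq> clients I \<and> card A \<le> k}"

definition kappa_discrete :: "fl_instance \<Rightarrow> nat set \<Rightarrow> nat set \<Rightarrow> ennreal" where
  "kappa_discrete I A A' = (if A \<noteq> A' then 1 else 0)"

text \<open>
  The empty scenario is covered by the conventions of \<^typ>\<open>ennreal\<close>: \<open>d(j', {}) = \<infinity>\<close>, and the
  maximum over \<open>A' = {}\<close> is \<open>0\<close>.
\<close>

definition kappa_asym :: "fl_instance \<Rightarrow> nat set \<Rightarrow> nat set \<Rightarrow> ennreal" where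
  "kappa_asym I A A' = (SUP j'\<in>A'. INF j\<in>A. ennreal (real_of_rat (fl_dist I j' j)))"

text \<open>
  \<open>approx_scenario \<kappa> \<beta>\<^sub>1 \<beta>\<^sub>2 I k x y A B\<close>: the scenario \<open>B\<close> is an admissible answer of a
  \<open>(\<beta>\<^sub>1, \<beta>\<^sub>2)\<close>-approximation algorithm for \<open>g(x, y, A)\<close>. For \<open>y = 0\<close> the penalty vanishes even if
  the distance is infinite, as \<open>0 * \<infinity> = 0\<close> in \<^typ>\<open>ereal\<close>.
\<close>

definition approx_scenario ::
    "(fl_instance \<Rightarrow> nat set \<Rightarrow> nat set \<Rightarrow> ennreal) \<Rightarrow> real \<Rightarrow> real \<Rightarrow>
     fl_instance \<Rightarrow> nat \<Rightarrow> (nat \<Rightarrow> real) \<Rightarrow> real \<Rightarrow> nat set \<Rightarrow> nat set \<Rightarrow> bool" where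
  "approx_scenario \<kappa> \<beta>\<^sub>1 \<beta>\<^sub>2 I k x y A B \<longleftrightarrow>
     B \<in> k_bounded_scenarios I k \<and>
     (\<forall>A'\<in>k_bounded_scenarios I k.
        ereal (second_stage_value I x B) - ereal y * enn2ereal (\<kappa> I A B)
        \<ge> ereal (second_stage_value I x A' / \<beta>\<^sub>1) - ereal (\<beta>\<^sub>2 * y) * enn2ereal (\<kappa> I A A'))"

type_synonym fl_query = "fl_instance \<times> nat \<times> (nat \<Rightarrow> real) \<times> rat \<times> nat set"

definition fl_queries :: "fl_query set" where
  "fl_queries = {(I, k, x, y, A). valid_instance I \<and> x \<in> stage_I_decisions I \<and>
     0 \<le> y \<and> A \<in> k_bounded_scenarios I k}"

definition encode_rat :: "rat \<Rightarrow> int list" where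
  "encode_rat r = [fst (quotient_of r), snd (quotient_of r)]"

definition encode_query :: "fl_query \<Rightarrow> int list" where
  "encode_query = (\<lambda>(I, k, x, y, A).
     [int (npoints I), int k] @ encode_rat y @
     concat (map (\<lambda>v.
       [of_bool (v \<in> facilities I), of_bool (v \<in> clients I),
        of_bool (v \<in> facilities I \<and> x v = 1), of_bool (v \<in> A)] @
       encode_rat (if v \<in> facilities I then cost_I I v else 0) @
       encode_rat (if v \<in> facilities I then cost_II I v else 0)) [0..<npoints I]) @
     concat (map (\<lambda>u. concat (map (\<lambda>v. encode_rat (fl_dist I u v)) [0..<npoints I]))
       [0..<npoints I]))"

definition has_polytime_approximation ::
    "(fl_instance \<Rightarrow> nat set \<Rightarrow> nat set \<Rightarrow> ennreal) \<Rightarrow> real \<Rightarrow> real \<Rightarrow> bool" where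
  "has_polytime_approximation \<kappa> \<beta>\<^sub>1 \<beta>\<^sub>2 \<longleftrightarrow>
     polytime_solvable fl_queries encode_query
       (\<lambda>(I, k, x, y, A) B. approx_scenario \<kappa> \<beta>\<^sub>1 \<beta>\<^sub>2 I k x (real_of_rat y) A B)"

end

theory Submission
  imports Defs
begin

text \<open>
  Give facility \<open>i\<close> cost \<open>0\<close> if it is already open. For a set \<open>S\<close> of clients let \<open>t\<^sub>i(S)\<close> be the time at
  which \<open>\<Sum>j\<in>S. max 0 (t - d i j)\<close> reaches the cost of \<open>i\<close>, and let the share of \<open>j\<close> be
  \<open>\<alpha>\<^sub>j(S) = min\<^sub>i max t\<^sub>i(S) (d i j)\<close> (Pal and Tardos). The shares are dual feasible, they pay for a third
  of an integral solution, and they decrease when \<open>S\<close> grows, so their sum \<open>h(S)\<close> satisfies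
  \<open>h(S) \<le> g(S) \<le> 3 h(S)\<close>.

  Starting from \<open>B = {}\<close>, repeatedly add a client \<open>j\<close> for which \<open>\<alpha>\<^sub>j(B \<union> {j})\<close> is largest, and let \<open>a\<close> be
  the share of the client that would be added next. The shares of the added clients decrease, which
  makes the uniform dual solution \<open>a\<close> on \<open>B\<close> feasible; hence \<open>h(B) + \<bar>B\<bar> a \<le> 2 g(B)\<close>. On the other hand,
  \<open>g(A') \<le> 3 h(B \<union> A') \<le> 3 (h(B) + \<bar>B\<bar> a)\<close> for every admissible \<open>A'\<close>. So \<open>(h(B) + \<bar>B\<bar> a) / 2\<close> is at most
  \<open>g(B)\<close> and at least \<open>g(A') / 6\<close>.

  Both scenario metrics are handled by giving every client a level (\<open>0\<close> or \<open>1\<close>, respectively its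
  distance to \<open>A\<close>): the penalty of a scenario is governed by its largest level, so it suffices to run
  the greedy algorithm on the clients of level at most that of \<open>r\<close> for each point \<open>r\<close>.

  Values that loop programs compute in polynomial time are closed under arithmetic, case distinction
  and bounded sums, minima and maxima. After scaling by \<open>n!\<close> times all denominators every number that
  occurs is an integer, and the algorithm is built from these operations.
\<close>

section \<open>Loop programs\<close>

definition upd :: "store \<Rightarrow> nat \<Rightarrow> nat \<Rightarrow> int \<Rightarrow> store" where
  "upd s a i x = s(a := (s a)(i := x))"

lemma upd_same [simp]: "upd s a i x a = (s a)(i := x)"
  by (simp add: upd_def)

lemma upd_other [simp]: "b \<noteq> a \<Longrightarrow> upd s a i x b = s b"
  by (simp add: upd_def)

text \<open>The counter of \<open>LFor a p\<close> is kept in cell \<open>0\<close> of array \<open>a\<close> and runs up to the first input entry.\<close>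

datatype loop_prog =
    LPut nat aexp aexp
  | LSeq loop_prog loop_prog
  | LIf aexp loop_prog loop_prog
  | LFor nat loop_prog

fun run :: "loop_prog \<Rightarrow> store \<Rightarrow> store" where
  "run (LPut a e1 e2) s = upd s a (nat (aval e1 s)) (aval e2 s)"
| "run (LSeq p q) s = run q (run p s)"
| "run (LIf e p q) s = (if 0 < aval e s then run p s else run q s)"
| "run (LFor a p) s =
     ((\<lambda>s. upd (run p s) a 0 (run p s a 0 + 1)) ^^ nat (s 0 0)) (upd s a 0 0)"

fun writes :: "loop_prog \<Rightarrow> nat set" where
  "writes (LPut a e1 e2) = {a}"
| "writes (LSeq p q) = writes p \<union> writes q"
| "writes (LIf e p q) = writes p \<union> writes q"
| "writes (LFor a p) = insert a (writes p)"

lemma run_unwritten: "a \<notin> writes p \<Longrightarrow> run p s a = s a"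
proof (induction p arbitrary: s)
  case (LFor b p)
  have "((\<lambda>s. upd (run p s) b 0 (run p s b 0 + 1)) ^^ m) s' a = s' a" for m s'
    using LFor by (induction m) auto
  then show ?case using LFor.prems by simp
qed auto

lemma run_LFor_invariant:
  assumes "Inv 0 (upd s a 0 0)" "a \<noteq> 0" "a \<notin> writes p" "0 \<notin> writes p"
    and step: "\<And>i s'. i < nat (s 0 0) \<Longrightarrow> s' 0 = s 0 \<Longrightarrow> s' a 0 = int i \<Longrightarrow> Inv i s' \<Longrightarrow>
      Inv (Suc i) (upd (run p s') a 0 (int (Suc i)))"
  shows "Inv (nat (s 0 0)) (run (LFor a p) s)"
proof -
  let ?body = "\<lambda>s. upd (run p s) a 0 (run p s a 0 + 1)"
  define state where "state m = (?body ^^ m) (upd s a 0 0)" for m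
  have "state m 0 = s 0 \<and> state m a 0 = int m \<and> Inv m (state m)" if "m \<le> nat (s 0 0)" for m
    using that
  proof (induction m)
    case 0
    then show ?case using assms by (simp add: state_def)
  next
    case (Suc m)
    then have IH: "state m 0 = s 0" "state m a 0 = int m" "Inv m (state m)" by auto
    have "state (Suc m) = upd (run p (state m)) a 0 (int (Suc m))"
      using IH assms(3) by (simp add: state_def run_unwritten add.commute)
    then show ?case using IH Suc.prems step[of m "state m"] assms(2,4) by (simp add: run_unwritten)
  qed
  then show ?thesis by (simp add: state_def)
qed


section \<open>Loop programs run in polynomial time\<close>

abbreviation cell :: "nat \<Rightarrow> aexp" where
  "cell a \<equiv> Get a (Const 0)"

fun compile :: "loop_prog \<Rightarrow> com" where
  "compile (LPut a e1 e2) = Put a e1 e2"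
| "compile (LSeq p q) = Seq (compile p) (compile q)"
| "compile (LIf e p q) = IfPos e (compile p) (compile q)"
| "compile (LFor a p) = Seq (Put a (Const 0) (Const 0))
     (WhilePos (Sub (cell 0) (cell a))
       (Seq (compile p) (Put a (Const 0) (Add (cell a) (Const 1)))))"

text \<open>Multiplying only by input entries keeps the growth of bit lengths additive.\<close>

fun tame :: "aexp \<Rightarrow> bool" where
  "tame (Const n) \<longleftrightarrow> True"
| "tame (Get a e) \<longleftrightarrow> tame e"
| "tame (Add e1 e2) \<longleftrightarrow> tame e1 \<and> tame e2"
| "tame (Sub e1 e2) \<longleftrightarrow> tame e1 \<and> tame e2"
| "tame (Mul e1 e2) \<longleftrightarrow> tame e1 \<and> tame e2 \<and> (\<exists>e. e1 = Get 0 e)"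
| "tame (Div e1 e2) \<longleftrightarrow> tame e1 \<and> tame e2"

fun wf_prog :: "loop_prog \<Rightarrow> bool" where
  "wf_prog (LPut a e1 e2) \<longleftrightarrow> a \<noteq> 0 \<and> tame e1 \<and> tame e2"
| "wf_prog (LSeq p q) \<longleftrightarrow> wf_prog p \<and> wf_prog q"
| "wf_prog (LIf e p q) \<longleftrightarrow> tame e \<and> wf_prog p \<and> wf_prog q"
| "wf_prog (LFor a p) \<longleftrightarrow> a \<noteq> 0 \<and> a \<notin> writes p \<and> wf_prog p"

lemma wf_prog_writes: "wf_prog p \<Longrightarrow> 0 \<notin> writes p"
  by (induction p) auto

fun weight :: "aexp \<Rightarrow> nat" where
  "weight (Const n) = Suc (bit_length n)"
| "weight (Get a e) = Suc (weight e)"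
| "weight (Add e1 e2) = Suc (weight e1 + weight e2)"
| "weight (Sub e1 e2) = Suc (weight e1 + weight e2)"
| "weight (Mul e1 e2) = Suc (weight e1 + weight e2)"
| "weight (Div e1 e2) = Suc (weight e1 + weight e2)"

lemma weight_pos: "0 < weight e"
  by (cases e) auto

definition input_within :: "nat \<Rightarrow> store \<Rightarrow> bool" where
  "input_within N s \<longleftrightarrow> s 0 0 \<in> {0..int N} \<and> (\<forall>i. \<bar>s 0 i\<bar> \<le> 2 ^ N)"

definition bounded_store :: "nat \<Rightarrow> store \<Rightarrow> bool" where
  "bounded_store X s \<longleftrightarrow> (\<forall>a i. \<bar>s a i\<bar> \<le> 2 ^ X)"

lemma input_within_cong: "s 0 = s' 0 \<Longrightarrow> input_within N s \<longleftrightarrow> input_within N s'"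
  by (simp add: input_within_def)

lemma bounded_store_mono: "bounded_store X s \<Longrightarrow> X \<le> Y \<Longrightarrow> bounded_store Y s"
  unfolding bounded_store_def by (meson order_trans one_le_numeral power_increasing)

lemma abs_le_bit_length: "\<bar>n\<bar> \<le> 2 ^ bit_length n"
proof -
  have "nat \<bar>n\<bar> < 2 ^ floorlog 2 (nat \<bar>n\<bar>)"
  proof (cases "n = 0")
    case False
    then show ?thesis using floorlog_bounds[of "nat \<bar>n\<bar>" 2] by simp
  qed (simp add: floorlog_def)
  then have "\<bar>n\<bar> < 2 ^ floorlog 2 (nat \<bar>n\<bar>)"
    by (simp add: zless_nat_eq_int_zless nat_less_iff)
  then show ?thesis by (simp add: bit_length_def)
qed

lemma bit_length_le:
  assumes "\<bar>n\<bar> \<le> 2 ^ m"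
  shows "bit_length n \<le> m + 2"
proof -
  have "nat \<bar>n\<bar> \<le> 2 ^ m" using assms by (simp add: nat_le_iff)
  also have "\<dots> < (2::nat) ^ Suc m" by simp
  finally have "floorlog 2 (nat \<bar>n\<bar>) \<le> Suc m" by (intro floorlog_leI) auto
  then show ?thesis by (simp add: bit_length_def)
qed

lemma abs_add_le_power2:
  fixes x y :: int
  assumes "\<bar>x\<bar> \<le> 2 ^ k" "\<bar>y\<bar> \<le> 2 ^ l"
  shows "\<bar>x + y\<bar> \<le> 2 ^ Suc (max k l)"
proof -
  have "(2::int) ^ k \<le> 2 ^ max k l" "(2::int) ^ l \<le> 2 ^ max k l" by (simp_all add: power_increasing)
  then have "\<bar>x + y\<bar> \<le> 2 ^ max k l + 2 ^ max k l" using assms by linarith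
  then show ?thesis by simp
qed

lemma abs_div_le: "\<bar>x div y\<bar> \<le> \<bar>x\<bar>" for x y :: int
proof -
  have pos: "\<bar>a div b\<bar> \<le> \<bar>a\<bar>" if "0 < b" for a b :: int
  proof (cases "0 \<le> a")
    case True
    then show ?thesis using zdiv_mono2[of a 1 b] that by (simp add: pos_imp_zdiv_nonneg_iff)
  next
    case False
    then show ?thesis using zdiv_mono2_neg[of a 1 b] that div_neg_pos_less0[of a b] by simp
  qed
  consider "y = 0" | "0 < y" | "0 < - y" by linarith
  then show ?thesis using pos[of y x] pos[of "- y" "- x"] by cases simp_all
qed

lemma le_power2_mono: "x \<le> 2 ^ k \<Longrightarrow> k \<le> l \<Longrightarrow> x \<le> 2 ^ l" for x :: int
  by (erule order_trans) (simp add: power_increasing)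

lemma abs_aval_le:
  assumes "bounded_store X s" "input_within N s" "tame e"
  shows "\<bar>aval e s\<bar> \<le> 2 ^ (X + weight e * (N + 1))"
  using assms(3)
proof (induction e)
  case (Const n)
  have "\<bar>n\<bar> \<le> 2 ^ (X + weight (Const n) * (N + 1))"
    by (rule le_power2_mono[OF abs_le_bit_length]) simp
  then show ?case by simp
next
  case (Get a e)
  have "\<bar>aval (Get a e) s\<bar> \<le> 2 ^ X" using assms(1) by (simp add: bounded_store_def)
  then show ?case by (rule le_power2_mono) simp
next
  case (Add e1 e2)
  then have "\<bar>aval e1 s + aval e2 s\<bar>
      \<le> 2 ^ Suc (max (X + weight e1 * (N + 1)) (X + weight e2 * (N + 1)))"
    by (intro abs_add_le_power2) auto
  then show ?case unfolding aval.simps by (rule le_power2_mono) (auto simp: add_mult_distrib)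
next
  case (Sub e1 e2)
  then have "\<bar>aval e1 s + - aval e2 s\<bar>
      \<le> 2 ^ Suc (max (X + weight e1 * (N + 1)) (X + weight e2 * (N + 1)))"
    by (intro abs_add_le_power2) auto
  then have "\<bar>aval e1 s + - aval e2 s\<bar> \<le> 2 ^ (X + weight (Sub e1 e2) * (N + 1))"
    by (rule le_power2_mono) (auto simp: add_mult_distrib)
  then show ?case by simp
next
  case (Mul e1 e2)
  then obtain e where e: "e1 = Get 0 e" by auto
  have "\<bar>aval (Mul e1 e2) s\<bar> \<le> 2 ^ N * 2 ^ (X + weight e2 * (N + 1))"
    using Mul assms(2) unfolding e by (auto simp: abs_mult input_within_def intro!: mult_mono)
  also have "\<dots> = 2 ^ (N + (X + weight e2 * (N + 1)))" by (simp add: power_add)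
  finally show ?case by (rule le_power2_mono) (auto simp: add_mult_distrib)
next
  case (Div e1 e2)
  then have "\<bar>aval (Div e1 e2) s\<bar> \<le> 2 ^ (X + weight e1 * (N + 1))"
    using order_trans[OF abs_div_le] by simp
  then show ?case by (rule le_power2_mono) (auto simp: add_mult_distrib)
qed

definition expr_bound :: "nat \<Rightarrow> aexp \<Rightarrow> nat" where
  "expr_bound N e = weight e * (N + 3)"

lemma Suc_weight_le: "Suc (weight e) \<le> expr_bound N e"
  using weight_pos[of e] by (simp add: expr_bound_def algebra_simps)

lemma bit_length_aval_le:
  assumes "bounded_store X s" "input_within N s" "tame e"
  shows "bit_length (aval e s) \<le> X + expr_bound N e"
  using bit_length_le[OF abs_aval_le[OF assms]] weight_pos[of e]
  by (simp add: expr_bound_def algebra_simps)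

lemma acost_le:
  assumes "bounded_store X s" "input_within N s" "tame e" "expr_bound N e \<le> M"
  shows "acost e s \<le> weight e * (X + M)"
  using assms(3,4)
proof (induction e)
  case (Const n)
  have "bit_length n \<le> weight (Const n) * 1" by simp
  also have "\<dots> \<le> weight (Const n) * (X + M)"
    using Const.prems(2) by (intro mult_le_mono2) (simp add: expr_bound_def)
  finally show ?case by simp
next
  note [simp del] = aval.simps
  have result: "bit_length (aval e s) \<le> X + M" if "tame e" "expr_bound N e \<le> M" for e
    using bit_length_aval_le[OF assms(1,2) that(1)] that(2) by linarith
  have left: "expr_bound N e1 \<le> M" and right: "expr_bound N e2 \<le> M"
    if "Suc (weight e1 + weight e2) * (N + 3) \<le> M" for e1 e2
    using that by (auto simp: expr_bound_def algebra_simps)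
  {
    case (Get a e)
    then show ?case using result[OF Get.prems] by (simp add: expr_bound_def)
  next
    case (Add e1 e2)
    then show ?case using result[OF Add.prems] left[of e1 e2] right[of e1 e2]
      by (simp add: expr_bound_def add_mult_distrib)
  next
    case (Sub e1 e2)
    then show ?case using result[OF Sub.prems] left[of e1 e2] right[of e1 e2]
      by (simp add: expr_bound_def add_mult_distrib)
  next
    case (Mul e1 e2)
    then show ?case using result[OF Mul.prems] left[of e1 e2] right[of e1 e2]
      by (simp add: expr_bound_def add_mult_distrib)
  next
    case (Div e1 e2)
    then show ?case using result[OF Div.prems] left[of e1 e2] right[of e1 e2]
      by (simp add: expr_bound_def add_mult_distrib)
  }
qed

lemma test_cost_le:
  assumes "bounded_store X s" "input_within N s" "tame e"
  shows "1 + acost e s \<le> expr_bound N e * (X + expr_bound N e)"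
proof -
  have "1 + acost e s \<le> 1 * (X + expr_bound N e) + weight e * (X + expr_bound N e)"
    using Suc_weight_le[of e N] by (intro add_mono acost_le[OF assms]) auto
  also have "\<dots> = (1 + weight e) * (X + expr_bound N e)" by (simp add: add_mult_distrib)
  also have "\<dots> \<le> expr_bound N e * (X + expr_bound N e)"
    using Suc_weight_le[of e N] by (intro mult_le_mono1) simp
  finally show ?thesis .
qed

text \<open>A single number \<open>M\<close> bounds the growth of bit lengths and, times the final bit length, the
  running time; it is additive under sequential composition.\<close>

definition runs_within :: "nat \<Rightarrow> nat \<Rightarrow> com \<Rightarrow> store \<Rightarrow> store \<Rightarrow> bool" where
  "runs_within M X c s s' \<longleftrightarrow> (\<exists>t\<le>M * (X + M). exec c s t s') \<and> bounded_store (X + M) s'"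

lemma runs_within_mono:
  assumes "runs_within M X c s s'" "M \<le> M'"
  shows "runs_within M' X c s s'"
proof -
  have "M * (X + M) \<le> M' * (X + M')" using assms(2) by (intro mult_le_mono) auto
  moreover have "X + M \<le> X + M'" using assms(2) by simp
  ultimately show ?thesis
    using assms(1) unfolding runs_within_def by (meson bounded_store_mono order_trans)
qed

lemma runs_within_Put:
  assumes "bounded_store X s" "input_within N s" "tame e1" "tame e2"
  shows "runs_within (expr_bound N e1 + expr_bound N e2) X (Put a e1 e2) s
    (upd s a (nat (aval e1 s)) (aval e2 s))"
proof -
  let ?M = "expr_bound N e1 + expr_bound N e2"
  have "1 + acost e1 s + acost e2 s \<le> 1 * (X + ?M) + weight e1 * (X + ?M) + weight e2 * (X + ?M)"
    using Suc_weight_le[of e1 N] by (intro add_mono acost_le[OF assms(1,2)]) (auto simp: assms)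
  also have "\<dots> = (1 + weight e1 + weight e2) * (X + ?M)" by (simp add: algebra_simps)
  also have "\<dots> \<le> ?M * (X + ?M)"
    using Suc_weight_le[of e1 N] Suc_weight_le[of e2 N] by (intro mult_le_mono1) simp
  finally have time: "1 + acost e1 s + acost e2 s \<le> ?M * (X + ?M)" .
  have "\<bar>aval e2 s\<bar> \<le> 2 ^ (X + ?M)"
    by (rule order_trans[OF abs_aval_le[OF assms(1,2,4)] power_increasing])
      (simp_all add: expr_bound_def algebra_simps)
  moreover have "bounded_store (X + ?M) s" using assms(1) by (rule bounded_store_mono) simp
  ultimately show ?thesis
    using time exec_Put[of a e1 e2 s] unfolding runs_within_def bounded_store_def
    by (auto simp: upd_def)
qed

lemma runs_within_Seq:
  assumes "runs_within M1 X c1 s s1" "runs_within M2 (X + M1) c2 s1 s2"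
  shows "runs_within (M1 + M2) X (Seq c1 c2) s s2"
proof -
  obtain t1 where t1: "exec c1 s t1 s1" "t1 \<le> M1 * (X + M1)"
    using assms(1) by (auto simp: runs_within_def)
  obtain t2 where t2: "exec c2 s1 t2 s2" "t2 \<le> M2 * (X + M1 + M2)"
    using assms(2) by (auto simp: runs_within_def)
  have "t1 + t2 \<le> (M1 + M2) * (X + (M1 + M2))" using t1(2) t2(2) by (simp add: algebra_simps)
  then show ?thesis using assms(2) exec_Seq[OF t1(1) t2(1)]
    by (auto simp: runs_within_def add.assoc)
qed

lemma runs_within_IfPos:
  assumes "1 + acost e s \<le> K * (X + K)"
    and "runs_within M X (if 0 < aval e s then c1 else c2) s s'"
  shows "runs_within (K + M) X (IfPos e c1 c2) s s'"
proof -
  obtain t where t: "exec (if 0 < aval e s then c1 else c2) s t s'" "t \<le> M * (X + M)"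
    using assms(2) by (auto simp: runs_within_def)
  have "exec (IfPos e c1 c2) s (1 + acost e s + t) s'"
    using t(1) exec_IfPos[of e s c1 t s' c2] exec_IfNonpos[of e s c2 t s' c1]
    by (cases "0 < aval e s") auto
  moreover have "1 + acost e s + t \<le> (K + M) * (X + (K + M))"
    using assms(1) t(2) by (simp add: algebra_simps)
  moreover have "bounded_store (X + (K + M)) s'"
    using assms(2) by (auto simp: runs_within_def elim: bounded_store_mono)
  ultimately show ?thesis unfolding runs_within_def by blast
qed

lemma runs_within_While_exit:
  assumes "aval e s \<le> 0" "1 + acost e s \<le> K * (X + K)" "bounded_store X s"
  shows "runs_within K X (WhilePos e c) s s"
  using assms exec_WhileNonpos[OF assms(1), of c] unfolding runs_within_def
  by (meson bounded_store_mono le_add1)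

lemma runs_within_While_step:
  assumes "0 < aval e s" "1 + acost e s \<le> K * (X + K)"
    and "runs_within M1 X c s s1" "runs_within M2 (X + M1) (WhilePos e c) s1 s2"
  shows "runs_within (K + M1 + M2) X (WhilePos e c) s s2"
proof -
  obtain t1 where t1: "exec c s t1 s1" "t1 \<le> M1 * (X + M1)"
    using assms(3) by (auto simp: runs_within_def)
  obtain t2 where t2: "exec (WhilePos e c) s1 t2 s2" "t2 \<le> M2 * (X + M1 + M2)"
    using assms(4) by (auto simp: runs_within_def)
  have "1 + acost e s + t1 + t2 \<le> (K + M1 + M2) * (X + (K + M1 + M2))"
    using assms(2) t1(2) t2(2) by (simp add: algebra_simps)
  moreover have "bounded_store (X + (K + M1 + M2)) s2"
    using assms(4) by (auto simp: runs_within_def elim: bounded_store_mono)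
  ultimately show ?thesis
    using exec_WhilePos[OF assms(1) t1(1) t2(1)] unfolding runs_within_def by blast
qed

lemma runs_within_While:
  assumes test: "\<And>s X. bounded_store X s \<Longrightarrow> s 0 = z \<Longrightarrow> 1 + acost e s \<le> K * (X + K)"
    and body: "\<And>s X. bounded_store X s \<Longrightarrow> s 0 = z \<Longrightarrow> runs_within M X c s (f s)"
    and "\<And>s. f s 0 = s 0" and "\<And>s. s 0 = z \<Longrightarrow> aval e (f s) = aval e s - 1"
    and "bounded_store X s" "s 0 = z" "aval e s = int m"
  shows "runs_within (m * (K + M) + K) X (WhilePos e c) s ((f ^^ m) s)"
  using assms(5-)
proof (induction m arbitrary: s X)
  case 0
  then show ?case using runs_within_While_exit test by simp
next
  case (Suc m)
  have first: "runs_within M X c s (f s)" using Suc.prems body by blast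
  have "runs_within (m * (K + M) + K) (X + M) (WhilePos e c) (f s) ((f ^^ m) (f s))"
    using first Suc.prems assms(3,4) by (intro Suc.IH) (simp_all add: runs_within_def)
  from runs_within_While_step[OF _ test[OF Suc.prems(1,2)] first this]
  have "runs_within (K + M + (m * (K + M) + K)) X (WhilePos e c) s ((f ^^ m) (f s))"
    using Suc.prems(3) by simp
  then show ?case by (simp add: funpow_swap1 add.assoc)
qed

definition cost_bounded :: "nat poly \<Rightarrow> loop_prog \<Rightarrow> bool" where
  "cost_bounded b p \<longleftrightarrow> (\<forall>N X s. bounded_store X s \<longrightarrow> input_within N s \<longrightarrow>
     runs_within (poly b N) X (compile p) s (run p s))"

lemma cost_boundedD:
  "cost_bounded b p \<Longrightarrow> bounded_store X s \<Longrightarrow> input_within N s \<Longrightarrow>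
    runs_within (poly b N) X (compile p) s (run p s)"
  by (simp add: cost_bounded_def)

definition expr_bound_poly :: "aexp \<Rightarrow> nat poly" where
  "expr_bound_poly e = [:3 * weight e, weight e:]"

lemma poly_expr_bound_poly [simp]: "poly (expr_bound_poly e) N = expr_bound N e"
  by (simp add: expr_bound_poly_def expr_bound_def algebra_simps)

lemma cost_bounded_LPut:
  assumes "tame e1" "tame e2"
  shows "cost_bounded (expr_bound_poly e1 + expr_bound_poly e2) (LPut a e1 e2)"
  using assms by (auto simp: cost_bounded_def intro: runs_within_Put)

lemma cost_bounded_LSeq:
  assumes p: "cost_bounded b p" and q: "cost_bounded b' q" and "0 \<notin> writes p"
  shows "cost_bounded (b + b') (LSeq p q)"
  unfolding cost_bounded_def poly_add compile.simps run.simps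
proof (intro allI impI)
  fix N X s assume s: "bounded_store X s" "input_within N s"
  note first = cost_boundedD[OF p s]
  have "input_within N (run p s)"
    using s(2) assms(3) input_within_cong[of "run p s" s] by (simp add: run_unwritten)
  then have "runs_within (poly b' N) (X + poly b N) (compile q) (run p s) (run q (run p s))"
    using first by (intro cost_boundedD[OF q]) (simp_all add: runs_within_def)
  with first show "runs_within (poly b N + poly b' N) X
      (Seq (compile p) (compile q)) s (run q (run p s))"
    by (rule runs_within_Seq)
qed

lemma cost_bounded_LIf:
  assumes "tame e" and p: "cost_bounded b p" and q: "cost_bounded b' q"
  shows "cost_bounded (expr_bound_poly e + (b + b')) (LIf e p q)"
  unfolding cost_bounded_def
proof (intro allI impI)
  fix N X s assume s: "bounded_store X s" "input_within N s"
  have "runs_within (expr_bound N e + (poly b N + poly b' N)) X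
      (compile (LIf e p q)) s (run (LIf e p q) s)"
    using runs_within_mono[OF cost_boundedD[OF p s], of "poly b N + poly b' N"]
      runs_within_mono[OF cost_boundedD[OF q s], of "poly b N + poly b' N"]
    by (auto intro!: runs_within_IfPos test_cost_le s assms(1))
  then show "runs_within (poly (expr_bound_poly e + (b + b')) N) X
      (compile (LIf e p q)) s (run (LIf e p q) s)"
    by simp
qed

lemma runs_within_LFor:
  fixes a :: nat
  defines "test \<equiv> Sub (cell 0) (cell a)" and "inc \<equiv> Add (cell a) (Const 1)"
  assumes prog: "\<And>X s. bounded_store X s \<Longrightarrow> input_within N s \<Longrightarrow>
      runs_within M X (compile p) s (run p s)"
    and a: "a \<noteq> 0" "a \<notin> writes p" "0 \<notin> writes p"
    and bounded: "bounded_store X s" and input: "input_within N s"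
  defines "M' \<equiv> M + (expr_bound N (Const 0) + expr_bound N inc)"
  shows "runs_within (expr_bound N (Const 0) + expr_bound N (Const 0) +
      (N * (expr_bound N test + M') + expr_bound N test)) X
      (compile (LFor a p)) s (run (LFor a p) s)"
proof -
  let ?f = "\<lambda>s. upd (run p s) a 0 (run p s a 0 + 1)" and ?Z = "expr_bound N (Const 0)"
  let ?body = "Seq (compile p) (Put a (Const 0) inc)" and ?n = "nat (s 0 0)"
  have init: "runs_within (?Z + ?Z) X (Put a (Const 0) (Const 0)) s (upd s a 0 0)"
    using runs_within_Put[OF bounded input, of "Const 0" "Const 0"] by simp
  have input': "input_within N s'" if "s' 0 = s 0" for s'
    using that input input_within_cong by blast
  have body: "runs_within M' Y ?body s' (?f s')" if "bounded_store Y s'" "s' 0 = s 0" for Y s'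
    unfolding M'_def
  proof (rule runs_within_Seq)
    show first: "runs_within M Y (compile p) s' (run p s')"
      by (rule prog[OF that(1) input'[of s', OF that(2)]])
    have "input_within N (run p s')" using that(2) a by (intro input') (simp add: run_unwritten)
    then show "runs_within (?Z + expr_bound N inc) (Y + M) (Put a (Const 0) inc) (run p s') (?f s')"
      using first runs_within_Put[of _ "run p s'" N "Const 0" inc]
      by (simp add: runs_within_def inc_def)
  qed
  have n: "?n \<le> N" "0 \<le> s 0 0" using input by (auto simp: input_within_def)
  have "runs_within (?n * (expr_bound N test + M') + expr_bound N test) (X + (?Z + ?Z))
      (WhilePos test ?body) (upd s a 0 0) ((?f ^^ ?n) (upd s a 0 0))"
  proof (rule runs_within_While[where z = "s 0"])
    show "1 + acost test s' \<le> expr_bound N test * (Y + expr_bound N test)"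
      if "bounded_store Y s'" "s' 0 = s 0" for Y s'
      unfolding test_def by (rule test_cost_le[OF that(1) input'[of s', OF that(2)]]) simp
  qed (use init body a n(2) in \<open>simp_all add: runs_within_def run_unwritten test_def\<close>)
  from runs_within_mono[OF runs_within_Seq[OF init this]] n(1) show ?thesis
    by (simp add: test_def inc_def)
qed

lemma cost_bounded_LFor:
  fixes a :: nat
  defines "zero \<equiv> expr_bound_poly (Const 0)" and "test \<equiv> expr_bound_poly (Sub (cell 0) (cell a))"
    and "inc \<equiv> expr_bound_poly (Add (cell a) (Const 1))"
  assumes "cost_bounded b p" "a \<noteq> 0" "a \<notin> writes p" "0 \<notin> writes p"
  shows "cost_bounded (zero + zero + ([:0, 1:] * (test + (b + (zero + inc))) + test)) (LFor a p)"
  using runs_within_LFor[OF cost_boundedD[OF assms(4)] assms(5-)]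
  by (simp add: cost_bounded_def zero_def test_def inc_def)

theorem cost_bounded_wf_prog: "wf_prog p \<Longrightarrow> \<exists>b. cost_bounded b p"
proof (induction p)
  case (LPut a e1 e2)
  then show ?case by (simp, blast intro: cost_bounded_LPut)
next
  case (LSeq p q)
  then have "0 \<notin> writes p" by (simp add: wf_prog_writes)
  with LSeq show ?case by (simp, blast intro: cost_bounded_LSeq)
next
  case (LIf e p q)
  then show ?case by (simp, blast intro: cost_bounded_LIf)
next
  case (LFor a p)
  then have "0 \<notin> writes p" by (simp add: wf_prog_writes)
  with LFor show ?case by (simp, blast intro: cost_bounded_LFor)
qed

lemma length_le_input_size: "length xs \<le> input_size xs"
  by (induction xs) (auto simp: input_size_def bit_length_def)

lemma bit_length_le_input_size: "x \<in> set xs \<Longrightarrow> bit_length x \<le> input_size xs"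
  by (induction xs) (auto simp: input_size_def)

lemma bounded_input_store: "bounded_store (input_size xs) (input_store xs)"
  unfolding bounded_store_def
proof (intro allI)
  fix a i
  show "\<bar>input_store xs a i\<bar> \<le> 2 ^ input_size xs"
  proof (cases "a = 0 \<and> i < length xs")
    case True
    then have "bit_length (input_store xs a i) \<le> input_size xs"
      by (intro bit_length_le_input_size) (simp add: input_store_def)
    then show ?thesis
      using order_trans[OF abs_le_bit_length power_increasing] by (metis one_le_numeral)
  qed (auto simp: input_store_def)
qed

theorem polytime_solvable_loop_prog:
  assumes "wf_prog p"
    and counter: "\<And>q. q \<in> Q \<Longrightarrow> input_store (enc q) 0 0 \<in> {0..int (length (enc q))}"
    and correct: "\<And>q. q \<in> Q \<Longrightarrow> correct q (output_set (run p (input_store (enc q))))"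
  shows "polytime_solvable Q enc correct"
proof -
  obtain b where b: "cost_bounded b p" using cost_bounded_wf_prog[OF assms(1)] by blast
  have "\<exists>t s. exec (compile p) (input_store (enc q)) t s \<and>
      t \<le> poly (b * ([:0, 1:] + b)) (input_size (enc q)) \<and> correct q (output_set s)"
    if q: "q \<in> Q" for q
  proof -
    let ?s = "input_store (enc q)" and ?N = "input_size (enc q)"
    have "input_within ?N ?s"
      using counter[OF q] length_le_input_size[of "enc q"] bounded_input_store[of "enc q"]
      by (auto simp: input_within_def bounded_store_def)
    from cost_boundedD[OF b bounded_input_store this] obtain t
      where "exec (compile p) ?s t (run p ?s)" "t \<le> poly b ?N * (?N + poly b ?N)"
      by (auto simp: runs_within_def)
    then show ?thesis using correct[OF q] by (intro exI[of _ t] exI[of _ "run p ?s"]) simp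
  qed
  then show ?thesis unfolding polytime_solvable_def by blast
qed


section \<open>Computable functionals\<close>

definition stack :: "nat list \<Rightarrow> store \<Rightarrow> int list" where
  "stack ls s = map (\<lambda>l. s l 0) ls"

lemma stack_Nil [simp]: "stack [] s = []"
  and stack_Cons [simp]: "stack (l # ls) s = s l 0 # stack ls s"
  by (simp_all add: stack_def)

lemma stack_hd: "stack ls s \<noteq> [] \<Longrightarrow> hd (stack ls s) = s (hd ls) 0"
  by (cases ls) auto

lemma stack_tl: "tl (stack ls s) = stack (tl ls) s"
  by (cases ls) auto

lemma fold_sum_over:
  fixes h :: "nat \<Rightarrow> int"
  shows "fold (\<lambda>v x. if v \<in> S then h v + x else x) [0..<n] 0 = sum h (S \<inter> {..<n})"
  by (induction n) (auto simp: lessThan_Suc Int_insert_right)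

lemma fold_max_over:
  fixes h :: "nat \<Rightarrow> int"
  shows "fold (\<lambda>v x. if v \<in> S then max (h v) x else x) [0..<n] z
      = Max (insert z (h ` (S \<inter> {..<n})))"
proof (induction n)
  case (Suc n)
  have "insert z (h ` (S \<inter> {..<Suc n})) =
      (if n \<in> S then insert (h n) (insert z (h ` (S \<inter> {..<n}))) else insert z (h ` (S \<inter> {..<n})))"
    by (auto simp: lessThan_Suc)
  then show ?case using Suc by simp
qed simp

lemma fold_min_over:
  fixes h :: "nat \<Rightarrow> int"
  shows "fold (\<lambda>v x. if v \<in> S then min (h v) x else x) [0..<n] z
      = Min (insert z (h ` (S \<inter> {..<n})))"
proof (induction n)
  case (Suc n)
  have "insert z (h ` (S \<inter> {..<Suc n})) =
      (if n \<in> S then insert (h n) (insert z (h ` (S \<inter> {..<n}))) else insert z (h ` (S \<inter> {..<n})))"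
    by (auto simp: lessThan_Suc)
  then show ?case using Suc by simp
qed simp

lemma fold_prod:
  fixes h :: "nat \<Rightarrow> int"
  shows "fold (\<lambda>v x. h v * x) [0..<n] z = (\<Prod>v<n. h v) * z"
  by (induction n) (auto simp: algebra_simps)

text \<open>
  A value \<open>h p vs\<close> depends on an abstract state \<open>p\<close>, represented by the arrays below \<open>m\<close>, and on
  a stack \<open>vs\<close> of bound variables, each held in cell \<open>0\<close> of an array of its own; \<open>D\<close> collects the
  pairs \<open>(p, vs)\<close> for which the value matters.
\<close>

locale representation =
  fixes represents :: "'p \<Rightarrow> store \<Rightarrow> bool" and size :: "'p \<Rightarrow> nat" and m :: nat
  assumes represents_cong: "represents p s \<Longrightarrow> (\<And>a. a < m \<Longrightarrow> s' a = s a) \<Longrightarrow> represents p s'"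
    and represents_size: "represents p s \<Longrightarrow> s 0 0 = int (size p)"
    and m_pos: "0 < m"
begin

definition state :: "'p \<Rightarrow> bool" where
  "state p \<longleftrightarrow> (\<exists>s. represents p s)"

definition computes ::
    "loop_prog \<Rightarrow> nat list \<Rightarrow> nat \<Rightarrow> ('p \<times> int list) set \<Rightarrow> ('p \<Rightarrow> int list \<Rightarrow> int) \<Rightarrow> bool" where
  "computes q ls c D h \<longleftrightarrow> wf_prog q \<and> writes q \<subseteq> {c..} \<and>
     (\<forall>p s. represents p s \<longrightarrow> (p, stack ls s) \<in> D \<longrightarrow>
       run q s c 0 = h p (stack ls s))"

definition computable :: "('p \<times> int list) set \<Rightarrow> ('p \<Rightarrow> int list \<Rightarrow> int) \<Rightarrow> bool" where
  "computable D h \<longleftrightarrow> (\<forall>ls c. m \<le> c \<longrightarrow> set ls \<subseteq> {..<c} \<longrightarrow> (\<exists>q. computes q ls c D h))"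

definition decidable :: "('p \<times> int list) set \<Rightarrow> ('p \<Rightarrow> int list \<Rightarrow> bool) \<Rightarrow> bool" where
  "decidable D P \<longleftrightarrow> computable D (\<lambda>p vs. of_bool (P p vs))"

definition bind :: "('p \<times> int list) set \<Rightarrow> ('p \<Rightarrow> int list \<Rightarrow> int set) \<Rightarrow> ('p \<times> int list) set" where
  "bind D S = {(p, v # vs) | p v vs. (p, vs) \<in> D \<and> v \<in> S p vs}"

abbreviation each :: "('p \<times> int list) set \<Rightarrow> ('p \<Rightarrow> int list \<Rightarrow> nat set) \<Rightarrow> ('p \<times> int list) set" where
  "each D S \<equiv> bind D (\<lambda>p vs. int ` S p vs)"

abbreviation index :: "int list \<Rightarrow> nat" where
  "index vs \<equiv> nat (hd vs)"

lemma bind_iff: "(p, vs) \<in> bind D S \<longleftrightarrow> vs \<noteq> [] \<and> (p, tl vs) \<in> D \<and> hd vs \<in> S p (tl vs)"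
  by (cases vs) (auto simp: bind_def)

lemma each_iff: "(p, vs) \<in> each D S \<longleftrightarrow>
    vs \<noteq> [] \<and> (p, tl vs) \<in> D \<and> 0 \<le> hd vs \<and> index vs \<in> S p (tl vs)"
  by (force simp: bind_iff image_iff)

lemma computes_value:
  "computes q ls c D h \<Longrightarrow> represents p s \<Longrightarrow> stack ls s = vs \<Longrightarrow> (p, vs) \<in> D \<Longrightarrow>
    run q s c 0 = h p vs"
  by (auto simp: computes_def)

lemma represents_run:
  assumes "represents p s" "writes q \<subseteq> {c..}" "m \<le> c"
  shows "represents p (run q s)"
  using assms(1)
proof (rule represents_cong)
  show "run q s a = s a" if "a < m" for a using that assms(2,3) by (intro run_unwritten) auto
qed

lemma stack_cong: "(\<And>l. l \<in> set ls \<Longrightarrow> s' l = s l) \<Longrightarrow> stack ls s' = stack ls s"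
  by (simp add: stack_def)

lemma stack_run: "set ls \<subseteq> {..<c} \<Longrightarrow> writes q \<subseteq> {c..} \<Longrightarrow> stack ls (run q s) = stack ls s"
  by (intro stack_cong run_unwritten) (force dest: subsetD)

lemma represents_upd: "represents p s \<Longrightarrow> m \<le> a \<Longrightarrow> represents p (upd s a i x)"
  by (erule represents_cong) simp

lemma stack_upd: "a \<notin> set ls \<Longrightarrow> stack ls (upd s a i x) = stack ls s"
  by (rule stack_cong) (metis upd_other)

lemma computableE:
  assumes "computable D h" "m \<le> c" "set ls \<subseteq> {..<c}"
  obtains q where "computes q ls c D h"
  using assms unfolding computable_def by blast

lemma computes_cong:
  assumes "computes q ls c D' h'" "D \<subseteq> D'" "\<And>p vs. (p, vs) \<in> D \<Longrightarrow> state p \<Longrightarrow> h p vs = h' p vs"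
  shows "computes q ls c D h"
  unfolding computes_def
proof (intro conjI allI impI)
  fix p s assume s: "represents p s" "(p, stack ls s) \<in> D"
  then have "run q s c 0 = h' p (stack ls s)" using assms(1,2) by (auto simp: computes_def)
  moreover have "state p" using s(1) by (auto simp: state_def)
  ultimately show "run q s c 0 = h p (stack ls s)" using assms(3)[OF s(2)] by simp
qed (use assms(1) in \<open>simp_all add: computes_def\<close>)

lemma computable_cong:
  "computable D' h' \<Longrightarrow> D \<subseteq> D' \<Longrightarrow> (\<And>p vs. (p, vs) \<in> D \<Longrightarrow> state p \<Longrightarrow> h p vs = h' p vs) \<Longrightarrow>
    computable D h"
  unfolding computable_def using computes_cong by metis

lemma computable_subset: "computable D' h \<Longrightarrow> D \<subseteq> D' \<Longrightarrow> computable D h"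
  by (rule computable_cong) auto

lemma computable_const: "computable D (\<lambda>p vs. k)"
  unfolding computable_def
proof (intro allI impI)
  fix ls :: "nat list" and c :: nat assume "m \<le> c"
  then have "computes (LPut c (Const 0) (Const k)) ls c D (\<lambda>p vs. k)"
    using m_pos by (simp add: computes_def)
  then show "\<exists>q. computes q ls c D (\<lambda>p vs. k)" ..
qed

lemma computable_variable: "computable (bind D S) (\<lambda>p vs. hd vs)"
  unfolding computable_def
proof (intro allI impI)
  fix ls :: "nat list" and c :: nat assume "m \<le> c" "set ls \<subseteq> {..<c}"
  then show "\<exists>q. computes q ls c (bind D S) (\<lambda>p vs. hd vs)"
    unfolding computes_def using m_pos
    by (intro exI[of _ "LPut c (Const 0) (cell (hd ls))"]) (auto simp: bind_iff stack_hd)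
qed

lemma computable_index: "computable (each D S) (\<lambda>p vs. int (index vs))"
  by (rule computable_cong[OF computable_variable order_refl]) (simp add: each_iff)

lemma computable_shift:
  assumes "computable D h"
  shows "computable (bind D S) (\<lambda>p vs. h p (tl vs))"
  unfolding computable_def
proof (intro allI impI)
  fix ls :: "nat list" and c :: nat assume c: "m \<le> c" "set ls \<subseteq> {..<c}"
  then have "set (tl ls) \<subseteq> {..<c}" by (cases ls) auto
  then obtain q where "computes q (tl ls) c D h" by (rule computableE[OF assms c(1)])
  then have "computes q ls c (bind D S) (\<lambda>p vs. h p (tl vs))"
    by (auto simp: computes_def bind_iff stack_tl)
  then show "\<exists>q. computes q ls c (bind D S) (\<lambda>p vs. h p (tl vs))" ..
qed

lemma computable_shift_second:
  assumes "computable (bind D A) h"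
  shows "computable (bind (bind D S) (\<lambda>p vs. A p (tl vs))) (\<lambda>p vs. h p (hd vs # tl (tl vs)))"
  unfolding computable_def
proof (intro allI impI)
  fix ls :: "nat list" and c :: nat assume c: "m \<le> c" "set ls \<subseteq> {..<c}"
  show "\<exists>q. computes q ls c (bind (bind D S) (\<lambda>p vs. A p (tl vs)))
      (\<lambda>p vs. h p (hd vs # tl (tl vs)))"
  proof (cases "ls = []")
    case True
    then show ?thesis
      using computableE[OF computable_const[of "{}" 0] c] by (auto simp: computes_def bind_iff)
  next
    case False
    then have "set (hd ls # tl (tl ls)) \<subseteq> {..<c}" using c(2) by (cases ls; cases "tl ls") auto
    then obtain q where "computes q (hd ls # tl (tl ls)) c (bind D A) h"
      by (rule computableE[OF assms c(1)])
    then have "computes q ls c (bind (bind D S) (\<lambda>p vs. A p (tl vs)))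
        (\<lambda>p vs. h p (hd vs # tl (tl vs)))"
      using False by (auto simp: computes_def bind_iff stack_tl stack_hd)
    then show ?thesis ..
  qed
qed

lemma computable_pair:
  assumes f: "computable D f" and g: "computable D g" and c: "m \<le> c" "set ls \<subseteq> {..<c}"
  obtains q where "wf_prog q" "writes q \<subseteq> {c..}"
    "\<And>p s vs. represents p s \<Longrightarrow> stack ls s = vs \<Longrightarrow> (p, vs) \<in> D \<Longrightarrow>
      run q s c 0 = f p vs \<and> run q s (Suc c) 0 = g p vs"
proof -
  obtain qf where qf: "computes qf ls c D f" by (rule computableE[OF f c])
  obtain qg where qg: "computes qg ls (Suc c) D g"
    by (rule computableE[OF g, of "Suc c" ls]) (use c in auto)
  have wf: "wf_prog qf" "writes qf \<subseteq> {c..}" "wf_prog qg" "writes qg \<subseteq> {Suc c..}"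
    using qf qg by (auto simp: computes_def)
  have "run (LSeq qf qg) s c 0 = f p vs \<and> run (LSeq qf qg) s (Suc c) 0 = g p vs"
    if "represents p s" "stack ls s = vs" "(p, vs) \<in> D" for p s vs
  proof
    have "run qg (run qf s) c = run qf s c" using wf by (intro run_unwritten) auto
    then show "run (LSeq qf qg) s c 0 = f p vs" using computes_value[OF qf that] by simp
    show "run (LSeq qf qg) s (Suc c) 0 = g p vs"
      using computes_value[OF qg represents_run[OF that(1) wf(2) c(1)]]
        that stack_run[OF c(2) wf(2)]
      by simp
  qed
  then show thesis using that[of "LSeq qf qg"] wf by fastforce
qed

lemma computable_expr:
  assumes "computable D f" "computable D g"
    and E: "\<And>c. tame (E c)" "\<And>c p s vs. represents p s \<Longrightarrow> (p, vs) \<in> D \<Longrightarrow> s c 0 = f p vs \<Longrightarrow>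
      s (Suc c) 0 = g p vs \<Longrightarrow> aval (E c) s = h p vs"
  shows "computable D h"
  unfolding computable_def
proof (intro allI impI)
  fix ls :: "nat list" and c :: nat assume c: "m \<le> c" "set ls \<subseteq> {..<c}"
  obtain q where q: "wf_prog q" "writes q \<subseteq> {c..}"
    "\<And>p s vs. represents p s \<Longrightarrow> stack ls s = vs \<Longrightarrow> (p, vs) \<in> D \<Longrightarrow>
      run q s c 0 = f p vs \<and> run q s (Suc c) 0 = g p vs"
    using computable_pair[OF assms(1,2) c] by metis
  then have "computes (LSeq q (LPut c (Const 0) (E c))) ls c D h"
    using E c(1) m_pos represents_run[OF _ q(2) c(1)] by (auto simp: computes_def)
  then show "\<exists>q. computes q ls c D h" ..
qed

lemma computable_assign:
  assumes "computable D f" "computable D g" and c: "m \<le> c" "set ls \<subseteq> {..<c}" and a: "0 < a" "a < c"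
  obtains q where "wf_prog q" "writes q \<subseteq> insert a {c..}"
    "\<And>p s vs b. represents p s \<Longrightarrow> stack ls s = vs \<Longrightarrow> (p, vs) \<in> D \<Longrightarrow> b < c \<Longrightarrow>
      run q s b = upd s a (nat (f p vs)) (g p vs) b"
proof -
  obtain q where q: "wf_prog q" "writes q \<subseteq> {c..}"
    "\<And>p s vs. represents p s \<Longrightarrow> stack ls s = vs \<Longrightarrow> (p, vs) \<in> D \<Longrightarrow>
      run q s c 0 = f p vs \<and> run q s (Suc c) 0 = g p vs"
    using computable_pair[OF assms(1,2) c] by metis
  let ?q = "LSeq q (LPut a (cell c) (cell (Suc c)))"
  have "run q s b = s b" if "b < c" for s b using that q(2) by (intro run_unwritten) auto
  then have "run ?q s b = upd s a (nat (f p vs)) (g p vs) b"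
    if "represents p s" "stack ls s = vs" "(p, vs) \<in> D" "b < c" for p s vs b
    using q(3)[OF that(1-3)] that(4) a(2) by (cases "b = a") auto
  then show thesis using q(1,2) a(1) by (intro that[of ?q]) auto
qed

lemma computable_read:
  assumes "a < m" "computable D e"
    and "\<And>p s vs. represents p s \<Longrightarrow> (p, vs) \<in> D \<Longrightarrow> s a (nat (e p vs)) = h p vs"
  shows "computable D h"
  by (rule computable_expr[OF assms(2,2), of "\<lambda>c. Get a (cell c)"]) (use assms(3) in simp_all)

lemma computable_size: "computable D (\<lambda>p vs. int (size p))"
  by (rule computable_read[OF m_pos computable_const[where k = 0]]) (simp add: represents_size)

lemma computable_add:
  assumes "computable D f" "computable D g"
  shows "computable D (\<lambda>p vs. f p vs + g p vs)"
  by (rule computable_expr[OF assms, of "\<lambda>c. Add (cell c) (cell (Suc c))"]) simp_all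

lemma computable_diff:
  assumes "computable D f" "computable D g"
  shows "computable D (\<lambda>p vs. f p vs - g p vs)"
  by (rule computable_expr[OF assms, of "\<lambda>c. Sub (cell c) (cell (Suc c))"]) simp_all

lemma computable_div:
  assumes "computable D f" "computable D g"
  shows "computable D (\<lambda>p vs. f p vs div g p vs)"
  by (rule computable_expr[OF assms, of "\<lambda>c. Div (cell c) (cell (Suc c))"]) simp_all

lemma computable_mult_input:
  assumes "computable D e" "computable D g"
    and "\<And>p s vs. represents p s \<Longrightarrow> (p, vs) \<in> D \<Longrightarrow> s 0 (nat (e p vs)) = f p vs"
  shows "computable D (\<lambda>p vs. f p vs * g p vs)"
  by (rule computable_expr[OF assms(1,2), of "\<lambda>c. Mul (Get 0 (cell c)) (cell (Suc c))"])
    (use assms(3) in simp_all)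

lemma computable_mult_size: "computable D g \<Longrightarrow> computable D (\<lambda>p vs. int (size p) * g p vs)"
  by (rule computable_mult_input[OF computable_const[where k = 0]]) (simp_all add: represents_size)

lemma computable_mult_nat: "computable D g \<Longrightarrow> computable D (\<lambda>p vs. int k * g p vs)"
  by (induction k) (auto simp: distrib_right computable_const intro!: computable_add)

lemma computable_If_pos:
  assumes c: "computable D c" and f: "computable {(p, vs) \<in> D. 0 < c p vs} f"
    and g: "computable {(p, vs) \<in> D. \<not> 0 < c p vs} g"
  shows "computable D (\<lambda>p vs. if 0 < c p vs then f p vs else g p vs)"
  unfolding computable_def
proof (intro allI impI)
  fix ls :: "nat list" and r :: nat assume r: "m \<le> r" "set ls \<subseteq> {..<r}"
  obtain qc where qc: "computes qc ls r D c" by (rule computableE[OF c r])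
  obtain qf where qf: "computes qf ls r {(p, vs) \<in> D. 0 < c p vs} f" by (rule computableE[OF f r])
  obtain qg where qg: "computes qg ls r {(p, vs) \<in> D. \<not> 0 < c p vs} g" by (rule computableE[OF g r])
  have writes: "writes qc \<subseteq> {r..}" using qc by (simp add: computes_def)
  have "run (LSeq qc (LIf (cell r) qf qg)) s r 0 = (if 0 < c p vs then f p vs else g p vs)"
    if s: "represents p s" "stack ls s = vs" "(p, vs) \<in> D" for p s vs
    using computes_value[OF qf represents_run[OF s(1) writes r(1)]]
      computes_value[OF qg represents_run[OF s(1) writes r(1)]]
      computes_value[OF qc s] stack_run[OF r(2) writes] s by simp
  then have "computes (LSeq qc (LIf (cell r) qf qg)) ls r D
      (\<lambda>p vs. if 0 < c p vs then f p vs else g p vs)"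
    using qc qf qg by (auto simp: computes_def)
  then show "\<exists>q. computes q ls r D (\<lambda>p vs. if 0 < c p vs then f p vs else g p vs)" ..
qed

text \<open>In the body the variable bound last is the accumulator, the one below it is the index.\<close>

lemma run_fold_loop:
  assumes q: "computes q (c # Suc c # ls) (Suc (Suc c))
      (bind (each D (\<lambda>p _. {..<size p})) (\<lambda>_ _. UNIV))
      (\<lambda>p vs. g p (tl (tl vs)) (index (tl vs)) (hd vs))" (is "computes q _ _ ?E _")
    and c: "m \<le> c" "set ls \<subseteq> {..<c}" and s: "represents p s" "stack ls s = vs" "(p, vs) \<in> D"
  shows "run (LFor (Suc c) (LSeq q (LPut c (Const 0) (cell (Suc (Suc c)))))) s c 0 =
    fold (g p vs) [0..<size p] (s c 0)" (is "run (LFor _ ?body) s c 0 = _")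
proof -
  have wf: "wf_prog q" "writes q \<subseteq> {Suc (Suc c)..}" using q by (auto simp: computes_def)
  have ls: "set ls \<subseteq> {..<Suc (Suc c)}" and fresh: "c \<notin> set ls" "Suc c \<notin> set ls" using c(2) by auto
  have size: "nat (s 0 0) = size p" using represents_size[OF s(1)] by simp
  define Inv where "Inv i t \<longleftrightarrow> represents p t \<and> stack ls t = vs \<and>
    t c 0 = fold (g p vs) [0..<i] (s c 0)" for i and t :: store
  have "Inv (nat (s 0 0)) (run (LFor (Suc c) ?body) s)"
  proof (rule run_LFor_invariant)
    show "Inv 0 (upd s (Suc c) 0 0)"
      using s c(1) fresh by (simp add: Inv_def represents_upd stack_upd)
    fix i t assume i: "i < nat (s 0 0)" and t: "t (Suc c) 0 = int i" "Inv i t"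
    have "(p, stack (c # Suc c # ls) t) \<in> ?E"
      using t i s(3) size by (simp add: Inv_def bind_def)
    with t have "run q t (Suc (Suc c)) 0 = g p vs i (t c 0)"
      by (subst computes_value[OF q _ refl]) (auto simp: Inv_def)
    moreover have "represents p (run q t)" "stack ls (run q t) = vs"
      using t(2) represents_run[OF _ wf(2)] stack_run[OF ls wf(2)] c(1) by (auto simp: Inv_def)
    ultimately show "Inv (Suc i) (upd (run ?body t) (Suc c) 0 (int (Suc i)))"
      using t(2) c(1) fresh by (simp add: Inv_def represents_upd stack_upd)
  qed (use wf c(1) m_pos in auto)
  then show ?thesis by (simp only: Inv_def size)
qed

lemma computable_fold:
  assumes z: "computable D z"
    and g: "computable (bind (each D (\<lambda>p _. {..<size p})) (\<lambda>_ _. UNIV))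
      (\<lambda>p vs. g p (tl (tl vs)) (index (tl vs)) (hd vs))" (is "computable ?E ?g")
  shows "computable D (\<lambda>p vs. fold (g p vs) [0..<size p] (z p vs))"
  unfolding computable_def
proof (intro allI impI)
  fix ls :: "nat list" and c :: nat assume c: "m \<le> c" "set ls \<subseteq> {..<c}"
  obtain qz where qz: "computes qz ls c D z" by (rule computableE[OF z c])
  obtain qg where qg: "computes qg (c # Suc c # ls) (Suc (Suc c)) ?E ?g"
    by (rule computableE[OF g, of "Suc (Suc c)" "c # Suc c # ls"]) (use c in auto)
  have wf: "wf_prog qz" "writes qz \<subseteq> {c..}" "wf_prog qg" "writes qg \<subseteq> {Suc (Suc c)..}"
    using qz qg by (auto simp: computes_def)
  let ?q = "LSeq qz (LFor (Suc c) (LSeq qg (LPut c (Const 0) (cell (Suc (Suc c))))))"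
  have "run ?q s c 0 = fold (g p vs) [0..<size p] (z p vs)"
    if s: "represents p s" "stack ls s = vs" "(p, vs) \<in> D" for p s vs
    using run_fold_loop[OF qg c represents_run[OF s(1) wf(2) c(1)] _ s(3)]
      stack_run[OF c(2) wf(2)] computes_value[OF qz s] s(2) by simp
  moreover have "wf_prog ?q" "writes ?q \<subseteq> {c..}" using wf c(1) m_pos by auto
  ultimately have "computes ?q ls c D (\<lambda>p vs. fold (g p vs) [0..<size p] (z p vs))"
    by (simp add: computes_def)
  then show "\<exists>q. computes q ls c D (\<lambda>p vs. fold (g p vs) [0..<size p] (z p vs))" ..
qed

lemma decidable_cong:
  "decidable D' P' \<Longrightarrow> D \<subseteq> D' \<Longrightarrow> (\<And>p vs. (p, vs) \<in> D \<Longrightarrow> state p \<Longrightarrow> P p vs \<longleftrightarrow> P' p vs) \<Longrightarrow>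
    decidable D P"
  unfolding decidable_def by (erule computable_cong) auto

lemma decidable_subset: "decidable D' P \<Longrightarrow> D \<subseteq> D' \<Longrightarrow> decidable D P"
  by (rule decidable_cong) auto

lemma decidable_shift: "decidable D P \<Longrightarrow> decidable (bind D S) (\<lambda>p vs. P p (tl vs))"
  unfolding decidable_def by (rule computable_shift)

lemma computable_If:
  assumes P: "decidable D P"
    and "computable {(p, vs) \<in> D. P p vs} f" "computable {(p, vs) \<in> D. \<not> P p vs} g"
  shows "computable D (\<lambda>p vs. if P p vs then f p vs else g p vs)"
  using computable_If_pos[OF P[unfolded decidable_def], of f g] assms(2,3) by simp

lemma decidable_If_pos:
  assumes "computable D f"
  shows "decidable D (\<lambda>p vs. 0 < f p vs)"
  using computable_If_pos[OF assms computable_const[of _ 1] computable_const[of _ 0]]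
  by (simp add: decidable_def of_bool_def)

lemma decidable_le:
  assumes "computable D f" "computable D g"
  shows "decidable D (\<lambda>p vs. f p vs \<le> g p vs)"
  using decidable_If_pos[OF computable_add[OF computable_diff[OF assms(2,1)]
    computable_const[of _ 1]]]
  by (rule decidable_cong) auto

lemma decidable_conj:
  assumes "decidable D P" "decidable {(p, vs) \<in> D. P p vs} Q"
  shows "decidable D (\<lambda>p vs. P p vs \<and> Q p vs)"
  using computable_If[OF assms(1) assms(2)[unfolded decidable_def] computable_const[of _ 0]]
  unfolding decidable_def by (rule computable_cong) auto

lemma decidable_not:
  assumes "decidable D P"
  shows "decidable D (\<lambda>p vs. \<not> P p vs)"
  using computable_diff[OF computable_const[of _ 1] assms[unfolded decidable_def]]
  unfolding decidable_def by (rule computable_cong) auto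

lemma decidable_disj:
  assumes "decidable D P" "decidable D Q"
  shows "decidable D (\<lambda>p vs. P p vs \<or> Q p vs)"
proof -
  have "decidable D (\<lambda>p vs. \<not> (\<not> P p vs \<and> \<not> Q p vs))"
    by (intro decidable_not decidable_conj assms decidable_subset[OF decidable_not[OF assms(2)]])
      auto
  then show ?thesis by simp
qed

lemma decidable_eq:
  assumes "computable D f" "computable D g"
  shows "decidable D (\<lambda>p vs. f p vs = g p vs)"
proof -
  have "decidable D (\<lambda>p vs. f p vs \<le> g p vs \<and> g p vs \<le> f p vs)"
    by (rule decidable_conj[OF decidable_le[OF assms]
      decidable_subset[OF decidable_le[OF assms(2,1)]]]) auto
  then show ?thesis by (rule decidable_cong) auto
qed

definition decidable_set :: "('p \<times> int list) set \<Rightarrow> ('p \<Rightarrow> int list \<Rightarrow> nat set) \<Rightarrow> bool" where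
  "decidable_set D S \<longleftrightarrow> (\<forall>p vs. (p, vs) \<in> D \<longrightarrow> state p \<longrightarrow> S p vs \<subseteq> {..<size p}) \<and>
     decidable (each D (\<lambda>p _. {..<size p})) (\<lambda>p vs. index vs \<in> S p (tl vs))"

lemma decidable_set_bounded: "decidable_set D S \<Longrightarrow> (p, vs) \<in> D \<Longrightarrow> state p \<Longrightarrow> S p vs \<subseteq> {..<size p}"
  by (simp add: decidable_set_def)

lemma decidable_set_finite: "decidable_set D S \<Longrightarrow> (p, vs) \<in> D \<Longrightarrow> state p \<Longrightarrow> finite (S p vs)"
  by (rule finite_subset[OF decidable_set_bounded]) simp_all

lemma decidable_member:
  "decidable_set D S \<Longrightarrow> decidable (each D (\<lambda>p _. {..<size p})) (\<lambda>p vs. index vs \<in> S p (tl vs))"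
  by (simp add: decidable_set_def)

lemma decidable_setI:
  assumes "\<And>p vs. (p, vs) \<in> D \<Longrightarrow> state p \<Longrightarrow> S p vs \<subseteq> {..<size p}"
    and "decidable (each D (\<lambda>p _. {..<size p})) (\<lambda>p vs. index vs \<in> S p (tl vs))"
  shows "decidable_set D S"
  using assms by (simp add: decidable_set_def)

lemma decidable_set_shift:
  assumes "decidable_set D S"
  shows "decidable_set (bind D T) (\<lambda>p vs. S p (tl vs))"
proof (rule decidable_setI)
  show "S p (tl vs) \<subseteq> {..<size p}" if "(p, vs) \<in> bind D T" "state p" for p vs
    using that decidable_set_bounded[OF assms] by (simp add: bind_iff)
  show "decidable (each (bind D T) (\<lambda>p _. {..<size p})) (\<lambda>p vs. index vs \<in> S p (tl (tl vs)))"
    using computable_shift_second[OF decidable_member[OF assms, unfolded decidable_def], of T]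
    by (simp add: decidable_def)
qed

lemma decidable_set_size: "decidable_set D (\<lambda>p vs. {..<size p})"
proof (rule decidable_setI)
  show "decidable (each D (\<lambda>p _. {..<size p})) (\<lambda>p vs. index vs \<in> {..<size p})"
    unfolding decidable_def
    by (rule computable_cong[OF computable_const[of _ 1] order_refl]) (simp add: each_iff)
qed simp

definition computable_point :: "('p \<times> int list) set \<Rightarrow> ('p \<Rightarrow> int list \<Rightarrow> nat) \<Rightarrow> bool" where
  "computable_point D v \<longleftrightarrow> computable D (\<lambda>p vs. int (v p vs)) \<and>
     (\<forall>p vs. (p, vs) \<in> D \<longrightarrow> state p \<longrightarrow> v p vs < size p)"

lemma computable_pointD: "computable_point D v \<Longrightarrow> computable D (\<lambda>p vs. int (v p vs))"
  and computable_point_less: "computable_point D v \<Longrightarrow> (p, vs) \<in> D \<Longrightarrow> state p \<Longrightarrow> v p vs < size p"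
  by (simp_all add: computable_point_def)

lemma computable_point_subset: "computable_point D' v \<Longrightarrow> D \<subseteq> D' \<Longrightarrow> computable_point D v"
  unfolding computable_point_def using computable_subset by blast

lemma computable_point_shift: "computable_point D v \<Longrightarrow>
    computable_point (bind D S) (\<lambda>p vs. v p (tl vs))"
  unfolding computable_point_def by (auto intro: computable_shift simp: bind_iff)

lemma computable_point_index: "decidable_set D S \<Longrightarrow> computable_point (each D S) (\<lambda>p vs. index vs)"
  using decidable_set_bounded[of D S] computable_index
  by (fastforce simp: computable_point_def each_iff)

lemma decidable_set_insert:
  assumes S: "decidable_set D S" and j: "computable_point D j"
  shows "decidable_set D (\<lambda>p vs. insert (j p vs) (S p vs))"
proof (rule decidable_setI)
  show "insert (j p vs) (S p vs) \<subseteq> {..<size p}" if "(p, vs) \<in> D" "state p" for p vs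
    using decidable_set_bounded[OF S that] computable_point_less[OF j that] by simp
  have "decidable (each D (\<lambda>p _. {..<size p}))
      (\<lambda>p vs. int (index vs) = int (j p (tl vs)) \<or> index vs \<in> S p (tl vs))"
    by (intro decidable_disj decidable_eq decidable_member[OF S]
      computable_index computable_shift[OF computable_pointD[OF j]])
  then show "decidable (each D (\<lambda>p _. {..<size p}))
      (\<lambda>p vs. index vs \<in> insert (j p (tl vs)) (S p (tl vs)))"
    by (rule decidable_cong) (auto simp: each_iff)
qed

lemma decidable_set_filter:
  assumes S: "decidable_set D S" and P: "decidable (each D S) (\<lambda>p vs. P p (tl vs) (index vs))"
  shows "decidable_set D (\<lambda>p vs. {v \<in> S p vs. P p vs v})"
proof (rule decidable_setI)
  show "{v \<in> S p vs. P p vs v} \<subseteq> {..<size p}" if "(p, vs) \<in> D" "state p" for p vs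
    using decidable_set_bounded[OF S that] by blast
  have "decidable (each D (\<lambda>p _. {..<size p}))
      (\<lambda>p vs. index vs \<in> S p (tl vs) \<and> P p (tl vs) (index vs))"
    by (intro decidable_conj decidable_member[OF S] decidable_subset[OF P]) (auto simp: each_iff)
  then show "decidable (each D (\<lambda>p _. {..<size p}))
      (\<lambda>p vs. index vs \<in> {v \<in> S p (tl vs). P p (tl vs) v})"
    by simp
qed

lemma decidable_set_diff:
  assumes A: "decidable_set D A" and B: "decidable_set D B"
  shows "decidable_set D (\<lambda>p vs. A p vs - B p vs)"
proof (rule decidable_setI)
  show "A p vs - B p vs \<subseteq> {..<size p}" if "(p, vs) \<in> D" "state p" for p vs
    using decidable_set_bounded[OF A that] by blast
  have "decidable (each D (\<lambda>p _. {..<size p}))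
      (\<lambda>p vs. index vs \<in> A p (tl vs) \<and> index vs \<notin> B p (tl vs))"
    by (intro decidable_conj decidable_member[OF A]
      decidable_subset[OF decidable_not[OF decidable_member[OF B]]]) auto
  then show "decidable (each D (\<lambda>p _. {..<size p})) (\<lambda>p vs. index vs \<in> A p (tl vs) - B p (tl vs))"
    by simp
qed

lemma decidable_set_cong:
  assumes S': "decidable_set D S'" and eq: "\<And>p vs. (p, vs) \<in> D \<Longrightarrow> state p \<Longrightarrow> S p vs = S' p vs"
  shows "decidable_set D S"
proof (rule decidable_setI)
  show "S p vs \<subseteq> {..<size p}" if "(p, vs) \<in> D" "state p" for p vs
    using decidable_set_bounded[OF S' that] eq[OF that] by simp
  show "decidable (each D (\<lambda>p _. {..<size p})) (\<lambda>p vs. index vs \<in> S p (tl vs))"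
    by (rule decidable_cong[OF decidable_member[OF S'] order_refl]) (simp add: each_iff eq)
qed

lemma computable_fold_over:
  assumes S: "decidable_set D S" and z: "computable D z"
    and g: "computable (bind (each D S) (\<lambda>_ _. UNIV))
        (\<lambda>p vs. g p (tl (tl vs)) (index (tl vs)) (hd vs))"
  shows "computable D (\<lambda>p vs.
      fold (\<lambda>v x. if v \<in> S p vs then g p vs v x else x) [0..<size p] (z p vs))"
proof (rule computable_fold[OF z], rule computable_If)
  let ?E = "bind (each D (\<lambda>p _. {..<size p})) (\<lambda>_ _. UNIV)"
  show "decidable ?E (\<lambda>p vs. index (tl vs) \<in> S p (tl (tl vs)))"
    by (intro decidable_shift decidable_member[OF S])
  show "computable {(p, vs) \<in> ?E. index (tl vs) \<in> S p (tl (tl vs))}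
      (\<lambda>p vs. g p (tl (tl vs)) (index (tl vs)) (hd vs))"
    by (rule computable_subset[OF g]) (auto simp: each_iff bind_iff[of _ _ "each _ _"])
  show "computable {(p, vs) \<in> ?E. index (tl vs) \<notin> S p (tl (tl vs))} (\<lambda>p vs. hd vs)"
    by (rule computable_subset[OF computable_variable]) auto
qed

lemma computable_sum:
  assumes S: "decidable_set D S" and h: "computable (each D S) (\<lambda>p vs. h p (tl vs) (index vs))"
  shows "computable D (\<lambda>p vs. \<Sum>v\<in>S p vs. h p vs v)"
proof -
  have "computable D (\<lambda>p vs. fold (\<lambda>v x. if v \<in> S p vs then h p vs v + x else x) [0..<size p] 0)"
    by (intro computable_fold_over S computable_const
      computable_add computable_variable computable_shift[OF h])
  then show ?thesis
    by (rule computable_cong) (use S in \<open>auto simp: fold_sum_over decidable_set_def Int_absorb2\<close>)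
qed

lemma computable_card:
  assumes "decidable_set D S"
  shows "computable D (\<lambda>p vs. int (card (S p vs)))"
  using computable_sum[OF assms computable_const[where k = 1]] by simp

lemma decidable_ball:
  assumes S: "decidable_set D S" and P: "decidable (each D S) (\<lambda>p vs. P p (tl vs) (index vs))"
  shows "decidable D (\<lambda>p vs. \<forall>v\<in>S p vs. P p vs v)"
proof -
  have "decidable D (\<lambda>p vs. int (card {v \<in> S p vs. \<not> P p vs v}) \<le> 0)"
    by (intro decidable_le computable_card decidable_set_filter S decidable_not P computable_const)
  then show ?thesis
    by (rule decidable_cong) (use decidable_set_finite[OF S] in auto)
qed

lemma computable_max:
  assumes "computable D f" "computable D g"
  shows "computable D (\<lambda>p vs. max (f p vs) (g p vs))"
  unfolding max_def
  by (intro computable_If decidable_le assms;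
    rule computable_subset[OF assms(1)] computable_subset[OF assms(2)]; auto)

lemma computable_min:
  assumes "computable D f" "computable D g"
  shows "computable D (\<lambda>p vs. min (f p vs) (g p vs))"
  unfolding min_def
  by (intro computable_If decidable_le assms;
    rule computable_subset[OF assms(1)] computable_subset[OF assms(2)]; auto)

lemma computable_Max_insert:
  assumes S: "decidable_set D S" and z: "computable D z"
    and h: "computable (each D S) (\<lambda>p vs. h p (tl vs) (index vs))"
  shows "computable D (\<lambda>p vs. Max (insert (z p vs) (h p vs ` S p vs)))"
proof -
  have "computable D (\<lambda>p vs.
      fold (\<lambda>v x. if v \<in> S p vs then max (h p vs v) x else x) [0..<size p] (z p vs))"
    by (intro computable_fold_over S z computable_max computable_variable computable_shift[OF h])
  then show ?thesis
    by (rule computable_cong) (use S in \<open>auto simp: fold_max_over decidable_set_def Int_absorb2\<close>)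
qed

lemma computable_Min_insert:
  assumes S: "decidable_set D S" and z: "computable D z"
    and h: "computable (each D S) (\<lambda>p vs. h p (tl vs) (index vs))"
  shows "computable D (\<lambda>p vs. Min (insert (z p vs) (h p vs ` S p vs)))"
proof -
  have "computable D (\<lambda>p vs.
      fold (\<lambda>v x. if v \<in> S p vs then min (h p vs v) x else x) [0..<size p] (z p vs))"
    by (intro computable_fold_over S z computable_min computable_variable computable_shift[OF h])
  then show ?thesis
    by (rule computable_cong) (use S in \<open>auto simp: fold_min_over decidable_set_def Int_absorb2\<close>)
qed

lemma computable_Min:
  assumes S: "decidable_set D S" and h: "computable (each D S) (\<lambda>p vs. h p (tl vs) (index vs))"
    and nonempty: "\<And>p vs. (p, vs) \<in> D \<Longrightarrow> state p \<Longrightarrow> S p vs \<noteq> {}"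
  shows "computable D (\<lambda>p vs. Min (h p vs ` S p vs))"
proof -
  let ?upper = "\<lambda>p vs. Max (insert 0 (h p vs ` S p vs))"
  have "computable D (\<lambda>p vs. Min (insert (?upper p vs) (h p vs ` S p vs)))"
    by (intro computable_Min_insert computable_Max_insert S h computable_const)
  then show ?thesis
  proof (rule computable_cong[OF _ order_refl])
    fix p vs assume pvs: "(p, vs) \<in> D" "state p"
    have "finite (h p vs ` S p vs)" "h p vs ` S p vs \<noteq> {}"
      using decidable_set_finite[OF S pvs] nonempty[OF pvs] by auto
    moreover from this have "Min (h p vs ` S p vs) \<le> ?upper p vs"
      by (meson Max_ge Min_in finite_insert insertI2)
    ultimately show "Min (h p vs ` S p vs) = Min (insert (?upper p vs) (h p vs ` S p vs))" by simp
  qed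
qed

lemma computable_prod:
  assumes "computable D z"
    and "computable (bind (each D (\<lambda>p _. {..<size p})) (\<lambda>_ _. UNIV))
      (\<lambda>p vs. f p (tl (tl vs)) (index (tl vs)) * hd vs)"
  shows "computable D (\<lambda>p vs. (\<Prod>v<size p. f p vs v) * z p vs)"
  using computable_fold[OF assms] by (simp only: fold_prod)

lemma computable_fact: "computable D (\<lambda>p vs. fact (size p))"
proof -
  have "computable D (\<lambda>p vs. (\<Prod>v<size p. int (Suc v)) * 1)"
  proof (rule computable_prod[OF computable_const])
    let ?E = "bind (each D (\<lambda>p _. {..<size p})) (\<lambda>_ _. UNIV)"
    have "decidable_set ?E (\<lambda>p vs. {u \<in> {..<size p}. u \<le> index (tl vs)})"
    proof (intro decidable_set_filter decidable_set_size)
      have "decidable (each ?E (\<lambda>p _. {..<size p}))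
          (\<lambda>p vs. int (index vs) \<le> int (index (tl (tl vs))))"
        by (intro decidable_le computable_index computable_shift)
      then show "decidable (each ?E (\<lambda>p _. {..<size p})) (\<lambda>p vs. index vs \<le> index (tl (tl vs)))"
        unfolding of_nat_le_iff .
    qed
    from computable_sum[OF this, of "\<lambda>p vs v. hd vs", OF computable_shift[OF computable_variable]]
    show "computable ?E (\<lambda>p vs. int (Suc (index (tl vs))) * hd vs)"
    proof (rule computable_cong[OF _ order_refl])
      fix p vs assume "(p, vs) \<in> ?E"
      then have "{u. u \<in> {..<size p} \<and> u \<le> index (tl vs)} = {..index (tl vs)}"
        by (auto simp: bind_iff)
      then show "int (Suc (index (tl vs))) * hd vs
          = (\<Sum>u | u \<in> {..<size p} \<and> u \<le> index (tl vs). hd vs)"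
        by simp
    qed
  qed
  then show ?thesis by (rule computable_cong) (simp_all add: fact_prod_Suc atLeast0LessThan)
qed

end


section \<open>Cost shares for metric facility location\<close>

locale facility_location = Metric_space M d for M :: "'a set" and d +
  fixes F :: "'a set" and f :: "'a \<Rightarrow> real"
  assumes finite_F: "finite F" and F_nonempty: "F \<noteq> {}" and F_subset: "F \<subseteq> M"
    and f_nonneg: "i \<in> F \<Longrightarrow> 0 \<le> f i"
begin

definition paid :: "'a set \<Rightarrow> 'a \<Rightarrow> real \<Rightarrow> real" where
  "paid S i t = (\<Sum>j\<in>S. max 0 (t - d i j))"

definition closest :: "'a set \<Rightarrow> 'a \<Rightarrow> 'a \<Rightarrow> 'a set" where
  "closest S i l = {j \<in> S. d i j \<le> d i l}"

text \<open>At time \<open>ratio S i l\<close> the clients in \<open>closest S i l\<close> alone would have offered \<open>f i\<close>; the facility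
  is paid for at the smallest of these times (see \<open>le_open_time_iff\<close>).\<close>

definition ratio :: "'a set \<Rightarrow> 'a \<Rightarrow> 'a \<Rightarrow> real" where
  "ratio S i l = (f i + (\<Sum>j\<in>closest S i l. d i j)) / card (closest S i l)"

definition open_time :: "'a set \<Rightarrow> 'a \<Rightarrow> real" where
  "open_time S i = Min (ratio S i ` S)"

definition share :: "'a set \<Rightarrow> 'a \<Rightarrow> real" where
  "share S j = Min ((\<lambda>i. max (open_time S i) (d i j)) ` F)"

definition dual_feasible :: "'a set \<Rightarrow> ('a \<Rightarrow> real) \<Rightarrow> bool" where
  "dual_feasible S v \<longleftrightarrow> (\<forall>j\<in>S. 0 \<le> v j) \<and> (\<forall>i\<in>F. (\<Sum>j\<in>S. max 0 (v j - d i j)) \<le> f i)"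

lemma card_closest_pos: "finite S \<Longrightarrow> l \<in> S \<Longrightarrow> 0 < card (closest S i l)"
  by (auto simp: closest_def card_gt_0_iff)

lemma paid_ge_subset:
  fixes t :: real
  assumes "finite S" "T \<subseteq> S"
  shows "card T * t - (\<Sum>j\<in>T. d i j) \<le> paid S i t"
proof -
  have "card T * t - (\<Sum>j\<in>T. d i j) = (\<Sum>j\<in>T. t - d i j)"
    by (simp add: sum_subtractf)
  also have "\<dots> \<le> (\<Sum>j\<in>T. max 0 (t - d i j))" by (intro sum_mono) auto
  also have "\<dots> \<le> paid S i t" unfolding paid_def using assms by (intro sum_mono2) auto
  finally show ?thesis .
qed

lemma paid_mono: "finite S' \<Longrightarrow> S \<subseteq> S' \<Longrightarrow> paid S i t \<le> paid S' i t"
  unfolding paid_def by (intro sum_mono2) auto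

lemma paid_mono_time: "t \<le> t' \<Longrightarrow> paid S i t \<le> paid S i t'"
  unfolding paid_def by (intro sum_mono) auto

lemma paid_eq_closest:
  fixes t :: real
  assumes "finite S" "j \<in> S" "d i j \<le> t"
  obtains l where "l \<in> S" "paid S i t = card (closest S i l) * t - (\<Sum>j\<in>closest S i l. d i j)"
proof -
  define T where "T = {j \<in> S. d i j \<le> t}"
  have T: "finite T" "T \<noteq> {}" using assms by (auto simp: T_def)
  then have "Max (d i ` T) \<in> d i ` T" by (intro Max_in) auto
  then obtain l where "l \<in> T" "d i l = Max (d i ` T)" by auto
  then have l: "l \<in> T" "\<And>j. j \<in> T \<Longrightarrow> d i j \<le> d i l" using T(1) by simp_all
  have "paid S i t = (\<Sum>j\<in>T. max 0 (t - d i j))"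
    unfolding paid_def using assms(1) by (intro sum.mono_neutral_right) (auto simp: T_def)
  also have "\<dots> = (\<Sum>j\<in>T. t - d i j)" by (intro sum.cong) (auto simp: T_def)
  also have "\<dots> = card T * t - (\<Sum>j\<in>T. d i j)" by (simp add: sum_subtractf)
  also have "T = closest S i l" using l by (auto simp: closest_def T_def)
  finally show thesis using that[of l] l(1) by (simp add: T_def)
qed

lemma le_ratio_iff:
  fixes t :: real
  assumes "finite S" "l \<in> S"
  shows "t \<le> ratio S i l \<longleftrightarrow> card (closest S i l) * t - (\<Sum>j\<in>closest S i l. d i j) \<le> f i"
  using card_closest_pos[OF assms, of i] by (simp add: ratio_def pos_le_divide_eq algebra_simps)

lemma le_open_time_iff:
  assumes "finite S" "S \<noteq> {}" "i \<in> F"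
  shows "t \<le> open_time S i \<longleftrightarrow> paid S i t \<le> f i"
proof -
  have "t \<le> open_time S i \<longleftrightarrow> (\<forall>l\<in>S. t \<le> ratio S i l)" using assms by (simp add: open_time_def)
  also have "\<dots> \<longleftrightarrow> paid S i t \<le> f i"
  proof
    assume le: "\<forall>l\<in>S. t \<le> ratio S i l"
    show "paid S i t \<le> f i"
    proof (cases "\<exists>j\<in>S. d i j \<le> t")
      case True
      then obtain l where "l \<in> S"
        "paid S i t = card (closest S i l) * t - (\<Sum>j\<in>closest S i l. d i j)"
        using paid_eq_closest[OF assms(1)] by blast
      then show ?thesis using le le_ratio_iff[OF assms(1)] by simp
    next
      case False
      then have "paid S i t = 0" unfolding paid_def by (intro sum.neutral) auto
      then show ?thesis using f_nonneg[OF assms(3)] by simp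
    qed
  next
    assume le: "paid S i t \<le> f i"
    show "\<forall>l\<in>S. t \<le> ratio S i l"
    proof
      fix l assume "l \<in> S"
      have "card (closest S i l) * t - (\<Sum>j\<in>closest S i l. d i j) \<le> paid S i t"
        by (rule paid_ge_subset[OF assms(1)]) (auto simp: closest_def)
      then show "t \<le> ratio S i l" using le le_ratio_iff[OF assms(1) \<open>l \<in> S\<close>] by simp
    qed
  qed
  finally show ?thesis .
qed

lemma paid_open_time:
  assumes "finite S" "S \<noteq> {}" "i \<in> F"
  shows "paid S i (open_time S i) = f i"
proof (rule antisym)
  show "paid S i (open_time S i) \<le> f i" using le_open_time_iff[OF assms] by blast
  have "open_time S i \<in> ratio S i ` S" unfolding open_time_def using assms by (intro Min_in) auto
  then obtain l where l: "l \<in> S" "open_time S i = ratio S i l" by auto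
  have "f i = card (closest S i l) * open_time S i - (\<Sum>j\<in>closest S i l. d i j)"
    using card_closest_pos[OF assms(1) l(1), of i] by (simp add: l(2) ratio_def)
  also have "\<dots> \<le> paid S i (open_time S i)"
    by (rule paid_ge_subset[OF assms(1)]) (auto simp: closest_def)
  finally show "f i \<le> paid S i (open_time S i)" .
qed

lemma open_time_nonneg: "finite S \<Longrightarrow> S \<noteq> {} \<Longrightarrow> i \<in> F \<Longrightarrow> 0 \<le> open_time S i"
  by (simp add: le_open_time_iff paid_def max_absorb1 f_nonneg)

lemma open_time_antimono:
  assumes "finite S'" "S \<noteq> {}" "S \<subseteq> S'" "i \<in> F"
  shows "open_time S' i \<le> open_time S i"
proof -
  have S: "finite S" "S' \<noteq> {}" using assms finite_subset by auto
  have "paid S i (open_time S' i) \<le> paid S' i (open_time S' i)" by (rule paid_mono[OF assms(1,3)])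
  also have "\<dots> = f i" by (rule paid_open_time[OF assms(1) S(2) assms(4)])
  finally show ?thesis using le_open_time_iff[OF S(1) assms(2,4)] by blast
qed

lemma share_le: "i \<in> F \<Longrightarrow> share S j \<le> max (open_time S i) (d i j)"
  unfolding share_def using finite_F by (intro Min_le) auto

lemma share_attained: "\<exists>i\<in>F. share S j = max (open_time S i) (d i j)"
proof -
  have "share S j \<in> (\<lambda>i. max (open_time S i) (d i j)) ` F"
    unfolding share_def using F_nonempty finite_F by (intro Min_in) auto
  then show ?thesis by auto
qed

lemma share_nonneg: "0 \<le> share S j"
  using share_attained[of S j] nonneg by (metis max.coboundedI2)

lemma share_antimono:
  assumes "finite S'" "S \<noteq> {}" "S \<subseteq> S'"
  shows "share S' j \<le> share S j"
proof -
  obtain i where i: "i \<in> F" "share S j = max (open_time S i) (d i j)" using share_attained by blast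
  have "share S' j \<le> max (open_time S' i) (d i j)" by (rule share_le[OF i(1)])
  also have "\<dots> \<le> share S j" unfolding i(2) using open_time_antimono[OF assms i(1)] by auto
  finally show ?thesis .
qed

lemma share_dual_feasible:
  assumes "finite S"
  shows "dual_feasible S (share S)"
  unfolding dual_feasible_def
proof (intro conjI ballI share_nonneg)
  fix i assume i: "i \<in> F"
  show "(\<Sum>j\<in>S. max 0 (share S j - d i j)) \<le> f i"
  proof (cases "S = {}")
    case False
    have "max 0 (share S j - d i j) \<le> max 0 (open_time S i - d i j)" for j
      using share_le[OF i, of S j] by auto
    then have "(\<Sum>j\<in>S. max 0 (share S j - d i j)) \<le> paid S i (open_time S i)"
      unfolding paid_def by (intro sum_mono)
    then show ?thesis using paid_open_time[OF assms False i] by simp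
  qed (use f_nonneg[OF i] in simp)
qed

subsection \<open>Shares pay for a third of an integral solution\<close>

text \<open>Pal and Tardos open a maximal family of facilities whose balls of radius \<open>t i\<close> are disjoint.\<close>

lemma separated_facilities:
  fixes t :: "'a \<Rightarrow> real"
  assumes "finite G" "G \<subseteq> F" "\<And>i. i \<in> G \<Longrightarrow> 0 \<le> t i"
  shows "\<exists>H\<subseteq>G. (\<forall>i\<in>H. \<forall>i'\<in>H. i \<noteq> i' \<longrightarrow> 2 * max (t i) (t i') < d i i') \<and>
    (\<forall>i\<in>G. \<exists>i'\<in>H. d i i' \<le> 2 * t i \<and> t i' \<le> t i)"
  using assms
proof (induction G rule: finite_ranking_induct[where f = t])
  case empty
  then show ?case by auto
next
  case (insert i G)
  obtain H where H: "H \<subseteq> G" "\<forall>i\<in>H. \<forall>i'\<in>H. i \<noteq> i' \<longrightarrow> 2 * max (t i) (t i') < d i i'"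
    "\<forall>i\<in>G. \<exists>i'\<in>H. d i i' \<le> 2 * t i \<and> t i' \<le> t i"
    using insert.IH insert.prems by auto
  have le: "t k \<le> t i" if "k \<in> G" for k using insert.hyps(2) that by auto
  show ?case
  proof (cases "\<exists>i'\<in>H. d i i' \<le> 2 * t i")
    case True
    then obtain i' where "i' \<in> H" "d i i' \<le> 2 * t i" by blast
    moreover from this have "t i' \<le> t i" using H(1) le by auto
    ultimately have "\<forall>k\<in>insert i G. \<exists>i'\<in>H. d k i' \<le> 2 * t k \<and> t i' \<le> t k" using H(3) by auto
    moreover have "H \<subseteq> insert i G" using H(1) by auto
    ultimately show ?thesis using H(2) by auto
  next
    case False
    have far: "2 * max (t k) (t i) < d k i" "2 * max (t i) (t k) < d i k" if "k \<in> H" for k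
    proof -
      have "t k \<le> t i" using that H(1) by (intro le) auto
      moreover have "2 * t i < d i k" using False that by (auto simp: not_le)
      ultimately show "2 * max (t k) (t i) < d k i" "2 * max (t i) (t k) < d i k"
        using commute[of i k] by simp_all
    qed
    have "i \<in> M" "0 \<le> t i" using insert.prems F_subset by auto
    then have "d i i \<le> 2 * t i" by simp
    then have "\<forall>k\<in>insert i G. \<exists>i'\<in>insert i H. d k i' \<le> 2 * t k \<and> t i' \<le> t k" using H(3) by auto
    moreover have "\<forall>k\<in>insert i H. \<forall>k'\<in>insert i H. k \<noteq> k' \<longrightarrow> 2 * max (t k) (t k') < d k k'"
      using H(2) far by auto
    moreover have "insert i H \<subseteq> insert i G" using H(1) by auto
    ultimately show ?thesis by metis
  qed
qed

lemma payments_of_near_facility: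
  fixes t :: "'a \<Rightarrow> real"
  assumes "finite H" "H \<subseteq> F" "j \<in> M" "i \<in> H" "d i j < t i"
    and separated: "\<And>k. k \<in> H \<Longrightarrow> k \<noteq> i \<Longrightarrow> 2 * max (t i) (t k) < d i k"
  shows "(\<Sum>k\<in>H. max 0 (t k - d k j)) = t i - d i j"
proof -
  have "max 0 (t k - d k j) = 0" if k: "k \<in> H" "k \<noteq> i" for k
  proof -
    have "d i k \<le> d i j + d k j" using triangle'[of i j k] assms(2-4) k(1) F_subset by blast
    with separated[OF k] assms(5) show ?thesis by (auto simp: max_def split: if_splits)
  qed
  then have "(\<Sum>k\<in>H. max 0 (t k - d k j)) = (\<Sum>k\<in>{i}. max 0 (t k - d k j))"
    using assms(1,4) by (intro sum.mono_neutral_right) auto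
  then show ?thesis using assms(5) by simp
qed

lemma connection_and_payments_le:
  fixes t :: "'a \<Rightarrow> real"
  assumes "finite H" "H \<subseteq> F" "j \<in> M"
    and k: "k \<in> F" "k' \<in> H" "d k k' \<le> 2 * t k" "t k' \<le> t k" "0 \<le> t k"
    and separated: "\<And>i i'. i \<in> H \<Longrightarrow> i' \<in> H \<Longrightarrow> i \<noteq> i' \<Longrightarrow> 2 * max (t i) (t i') < d i i'"
  shows "\<exists>i\<in>H. d i j + (\<Sum>l\<in>H. max 0 (t l - d l j)) \<le> 3 * max (t k) (d k j)"
proof -
  have M: "k \<in> M" "k' \<in> M" using assms F_subset by auto
  have near: "d k' j \<le> 3 * max (t k) (d k j)"
    using triangle[OF M(2,1) assms(3)] commute[of k k'] k(3) by (auto simp: max_def)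
  show ?thesis
  proof (cases "\<exists>i\<in>H. d i j < t i")
    case False
    then have "(\<Sum>l\<in>H. max 0 (t l - d l j)) = 0" by (intro sum.neutral) auto
    then show ?thesis using near k(2) by auto
  next
    case True
    then obtain i where i: "i \<in> H" "d i j < t i" by blast
    have "t i \<le> 3 * max (t k) (d k j)"
    proof (cases "i = k'")
      case True
      then show ?thesis using k(4,5) by (auto simp: max_def)
    next
      case False
      have "d i k' \<le> d i j + d k' j" using triangle' i(1) assms(2,3) M(2) F_subset by blast
      with separated[OF i(1) k(2) False] i(2) near show ?thesis
        by (auto simp: max_def split: if_splits)
    qed
    moreover have "(\<Sum>l\<in>H. max 0 (t l - d l j)) = t i - d i j"
      using assms(1-3) i separated by (intro payments_of_near_facility) auto
    ultimately show ?thesis using i(1) by (intro bexI[of _ i]) auto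
  qed
qed

lemma integral_solution_le_shares:
  assumes "finite S" "S \<noteq> {}" "S \<subseteq> M"
  obtains H \<sigma> where "H \<subseteq> F" "\<And>j. j \<in> S \<Longrightarrow> \<sigma> j \<in> H"
    "(\<Sum>i\<in>H. f i) + (\<Sum>j\<in>S. d (\<sigma> j) j) \<le> 3 * (\<Sum>j\<in>S. share S j)"
proof -
  let ?t = "open_time S"
  have t: "0 \<le> ?t i" if "i \<in> F" for i by (rule open_time_nonneg[OF assms(1,2) that])
  obtain H where H: "H \<subseteq> F"
    and separated: "\<And>i i'. i \<in> H \<Longrightarrow> i' \<in> H \<Longrightarrow> i \<noteq> i' \<Longrightarrow> 2 * max (?t i) (?t i') < d i i'"
    and covered: "\<And>i. i \<in> F \<Longrightarrow> \<exists>i'\<in>H. d i i' \<le> 2 * ?t i \<and> ?t i' \<le> ?t i"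
    using separated_facilities[of F ?t] t finite_F by auto
  have finite_H: "finite H" by (rule finite_subset[OF H finite_F])
  have "\<exists>i\<in>H. d i j + (\<Sum>l\<in>H. max 0 (?t l - d l j)) \<le> 3 * share S j" if j: "j \<in> S" for j
  proof -
    obtain k where k: "k \<in> F" "share S j = max (?t k) (d k j)" using share_attained by blast
    obtain k' where "k' \<in> H" "d k k' \<le> 2 * ?t k" "?t k' \<le> ?t k" using covered[OF k(1)] by blast
    then show ?thesis unfolding k(2)
      using connection_and_payments_le[OF finite_H H _ k(1) _ _ _ t[OF k(1)] separated] j assms(3)
      by blast
  qed
  then obtain \<sigma> where \<sigma>: "\<And>j. j \<in> S \<Longrightarrow> \<sigma> j \<in> H"
    "\<And>j. j \<in> S \<Longrightarrow> d (\<sigma> j) j + (\<Sum>l\<in>H. max 0 (?t l - d l j)) \<le> 3 * share S j"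
    by metis
  have "(\<Sum>i\<in>H. f i) = (\<Sum>i\<in>H. \<Sum>j\<in>S. max 0 (?t i - d i j))"
    using paid_open_time[OF assms(1,2)] H by (intro sum.cong) (auto simp: paid_def)
  also have "\<dots> = (\<Sum>j\<in>S. \<Sum>i\<in>H. max 0 (?t i - d i j))" by (rule sum.swap)
  finally have "(\<Sum>i\<in>H. f i) + (\<Sum>j\<in>S. d (\<sigma> j) j) = (\<Sum>j\<in>S. d (\<sigma> j) j + (\<Sum>i\<in>H. max 0 (?t i - d i j)))"
    by (simp add: sum.distrib)
  also have "\<dots> \<le> (\<Sum>j\<in>S. 3 * share S j)" by (intro sum_mono \<sigma>(2))
  finally show thesis using that[OF H \<sigma>(1)] by (simp add: sum_distrib_left)
qed

subsection \<open>Greedy sets of clients\<close>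

inductive greedy :: "'a set \<Rightarrow> 'a set \<Rightarrow> bool" for C where
  empty: "greedy C {}"
| insert: "greedy C B \<Longrightarrow> j \<in> C - B \<Longrightarrow>
    (\<And>l. l \<in> C - B \<Longrightarrow> share (insert l B) l \<le> share (insert j B) j) \<Longrightarrow> greedy C (insert j B)"

definition next_share :: "'a set \<Rightarrow> 'a set \<Rightarrow> real" where
  "next_share C B = Max (insert 0 ((\<lambda>j. share (insert j B) j) ` (C - B)))"

definition estimate :: "'a set \<Rightarrow> 'a set \<Rightarrow> real" where
  "estimate C B = (\<Sum>j\<in>B. share B j) + card B * next_share C B"

lemma greedy_subset: "greedy C B \<Longrightarrow> B \<subseteq> C"
  by (induction rule: greedy.induct) auto

lemma share_le_next_share: "finite C \<Longrightarrow> j \<in> C - B \<Longrightarrow> share (insert j B) j \<le> next_share C B"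
  unfolding next_share_def by (intro Max_ge) auto

lemma next_share_nonneg: "finite C \<Longrightarrow> 0 \<le> next_share C B"
  unfolding next_share_def by (intro Max_ge) auto

text \<open>The shares of the chosen clients decrease, hence the next share is affordable on the whole of
  \<open>B\<close>.\<close>

lemma paid_next_client_le:
  assumes "greedy C B" "finite C" "j \<in> C - B" "i \<in> F"
  shows "paid B i (share (insert j B) j) \<le> f i"
  using assms(1,3)
proof (induction arbitrary: j rule: greedy.induct)
  case empty
  then show ?case using f_nonneg[OF assms(4)] by (simp add: paid_def)
next
  case (insert B l)
  let ?B = "insert l B" and ?a = "share (insert l B) l"
  have fin: "finite B" using greedy_subset[OF insert.hyps(1)] assms(2) by (rule finite_subset)
  have "share (insert j ?B) j \<le> share (insert j B) j" using fin by (intro share_antimono) auto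
  also have "\<dots> \<le> ?a" using insert.prems by (intro insert.hyps) auto
  finally have "paid ?B i (share (insert j ?B) j) \<le> paid ?B i ?a" by (rule paid_mono_time)
  also have "\<dots> \<le> f i"
  proof (cases "?a \<le> d i l")
    case True
    then have "paid ?B i ?a = paid B i ?a"
      using fin insert.hyps(2) by (simp add: paid_def max_absorb1)
    then show ?thesis using insert.IH[OF insert.hyps(2)] by simp
  next
    case False
    then have "?a \<le> open_time ?B i" using share_le[OF assms(4), of ?B l]
      by (auto simp: max_def split: if_splits)
    then show ?thesis using le_open_time_iff[of ?B i] fin assms(4) by simp
  qed
  finally show ?case .
qed

lemma next_share_dual_feasible:
  assumes "greedy C B" "finite C"
  shows "dual_feasible B (\<lambda>_. next_share C B)"
proof -
  have "next_share C B \<in> insert 0 ((\<lambda>j. share (insert j B) j) ` (C - B))"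
    unfolding next_share_def using assms(2) by (intro Max_in) auto
  then consider "next_share C B = 0" | j where "j \<in> C - B" "next_share C B = share (insert j B) j"
    by auto
  then have "paid B i (next_share C B) \<le> f i" if "i \<in> F" for i
  proof cases
    case 1
    then show ?thesis using f_nonneg[OF that] by (simp add: paid_def max_absorb1)
  next
    case 2
    then show ?thesis using paid_next_client_le[OF assms _ that] by simp
  qed
  then show ?thesis using next_share_nonneg[OF assms(2)] by (simp add: dual_feasible_def paid_def)
qed

lemma sum_share_union_le:
  assumes "finite C" "B \<subseteq> C" "A \<subseteq> C" "card (A - B) \<le> card B"
  shows "(\<Sum>j\<in>B \<union> A. share (B \<union> A) j) \<le> estimate C B"
proof -
  let ?S = "B \<union> A"
  have fin: "finite A" "finite B" using assms finite_subset by auto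
  have "(\<Sum>j\<in>?S. share ?S j) = (\<Sum>j\<in>B. share ?S j) + (\<Sum>j\<in>A - B. share ?S j)"
    using fin by (subst sum.union_disjoint[symmetric]) (auto simp: Un_Diff_cancel)
  also have "(\<Sum>j\<in>B. share ?S j) \<le> (\<Sum>j\<in>B. share B j)"
    using fin by (intro sum_mono share_antimono) auto
  also have "(\<Sum>j\<in>A - B. share ?S j) \<le> (\<Sum>j\<in>A - B. next_share C B)"
  proof (rule sum_mono)
    fix j assume j: "j \<in> A - B"
    have "share ?S j \<le> share (insert j B) j" using j fin by (intro share_antimono) auto
    also have "\<dots> \<le> next_share C B" using j assms(1,3) by (intro share_le_next_share) auto
    finally show "share ?S j \<le> next_share C B" .
  qed
  also have "(\<Sum>j\<in>A - B. next_share C B) \<le> card B * next_share C B"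
    using assms(4) next_share_nonneg[OF assms(1), of B] by (simp add: mult_right_mono)
  finally show ?thesis by (simp add: estimate_def)
qed

end


section \<open>The fractional second stage\<close>

definition distance :: "fl_instance \<Rightarrow> nat \<Rightarrow> nat \<Rightarrow> real" where
  "distance I u v = real_of_rat (fl_dist I u v)"

definition residual_cost :: "fl_instance \<Rightarrow> (nat \<Rightarrow> real) \<Rightarrow> nat \<Rightarrow> real" where
  "residual_cost I x i = (if x i = 1 then 0 else real_of_rat (cost_II I i))"

locale second_stage =
  fixes I :: fl_instance and x :: "nat \<Rightarrow> real"
  assumes valid: "valid_instance I" and decision: "x \<in> stage_I_decisions I"
begin

abbreviation "g \<equiv> second_stage_value I x"
abbreviation "feasible \<equiv> second_stage_feasible I x"

lemma points_eq: "facilities I \<union> clients I = {..<npoints I}"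
  using valid by (simp add: valid_instance_def)

lemma finite_facilities: "finite (facilities I)" and finite_clients: "finite (clients I)"
  using points_eq by (metis finite_Un finite_lessThan)+

lemma facility_less: "i \<in> facilities I \<Longrightarrow> i < npoints I"
  and client_less: "j \<in> clients I \<Longrightarrow> j < npoints I"
  using points_eq by blast+

lemma cost_II_nonneg: "i \<in> facilities I \<Longrightarrow> 0 \<le> real_of_rat (cost_II I i)"
  using valid by (simp add: valid_instance_def)

lemma x_cases: "i \<in> facilities I \<Longrightarrow> x i = 0 \<or> x i = 1"
  using decision by (auto simp: stage_I_decisions_def)

end

sublocale second_stage \<subseteq>
  facility_location "facilities I \<union> clients I" "distance I" "facilities I" "residual_cost I x"
proof -
  have "Metric_space (facilities I \<union> clients I) (distance I)"
    using valid unfolding valid_instance_def distance_def[abs_def] by blast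
  then show "facility_location (facilities I \<union> clients I)
      (distance I) (facilities I) (residual_cost I x)"
    using valid cost_II_nonneg finite_facilities
    by (auto simp: facility_location_def facility_location_axioms_def
      residual_cost_def valid_instance_def)
qed

context second_stage
begin

lemma second_stage_cost_nonneg:
  assumes "feasible A z w"
  shows "0 \<le> second_stage_cost I A z w"
proof -
  have "0 \<le> real_of_rat (fl_dist I i j)" for i j using nonneg[of i j] by (simp add: distance_def)
  then show ?thesis
    using assms cost_II_nonneg unfolding second_stage_cost_def second_stage_feasible_def
    by (intro add_nonneg_nonneg sum_nonneg mult_nonneg_nonneg) auto
qed

lemma g_le_cost: "feasible A z w \<Longrightarrow> g A \<le> second_stage_cost I A z w"
  unfolding second_stage_value_def using second_stage_cost_nonneg
  by (intro cInf_lower) (auto intro!: bdd_belowI[of _ 0])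

lemma feasible_exists: "feasible A (\<lambda>_. 1) (\<lambda>_ _. 1)"
proof -
  have "1 \<le> card (facilities I)"
    using F_nonempty finite_facilities by (simp add: Suc_le_eq card_gt_0_iff)
  then show ?thesis using x_cases by (force simp: second_stage_feasible_def)
qed

lemma facility_payment_le:
  assumes "finite A" and dual: "dual_feasible A v"
    and feas: "feasible A z w" and i: "i \<in> facilities I"
  shows "(\<Sum>j\<in>A. w i j * max 0 (v j - distance I i j)) \<le> real_of_rat (cost_II I i) * z i"
proof -
  have z: "0 \<le> z i" using feas i by (auto simp: second_stage_feasible_def)
  have paid: "(\<Sum>j\<in>A. max 0 (v j - distance I i j)) \<le> residual_cost I x i"
    using dual i by (simp add: dual_feasible_def)
  show ?thesis
  proof (cases "x i = 1")
    case True
    then have "(\<Sum>j\<in>A. max 0 (v j - distance I i j)) = 0"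
      using paid by (intro antisym sum_nonneg) (auto simp: residual_cost_def)
    then have "\<forall>j\<in>A. max 0 (v j - distance I i j) = 0"
      using assms(1) by (subst (asm) sum_nonneg_eq_0_iff) auto
    then show ?thesis using cost_II_nonneg[OF i] z by simp
  next
    case False
    then have "x i = 0" using x_cases[OF i] by simp
    then have "(\<Sum>j\<in>A. w i j * max 0 (v j - distance I i j))
        \<le> (\<Sum>j\<in>A. z i * max 0 (v j - distance I i j))"
      using feas i by (intro sum_mono mult_right_mono) (force simp: second_stage_feasible_def)+
    also have "\<dots> \<le> z i * residual_cost I x i"
      using paid z by (simp add: sum_distrib_left[symmetric] mult_left_mono)
    finally show ?thesis using False by (simp add: residual_cost_def mult.commute)
  qed
qed

lemma sum_dual_le_cost:
  assumes "finite A" and dual: "dual_feasible A v" and feas: "feasible A z w"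
  shows "(\<Sum>j\<in>A. v j) \<le> second_stage_cost I A z w"
proof -
  let ?F = "facilities I" and ?d = "distance I"
  have "(\<Sum>j\<in>A. v j) \<le> (\<Sum>j\<in>A. v j * (\<Sum>i\<in>?F. w i j))"
    using feas dual
    by (intro sum_mono) (auto simp: second_stage_feasible_def
      dual_feasible_def mult_le_cancel_left1)
  also have "\<dots> = (\<Sum>j\<in>A. \<Sum>i\<in>?F. v j * w i j)" by (simp add: sum_distrib_left)
  also have "\<dots> \<le> (\<Sum>j\<in>A. \<Sum>i\<in>?F. w i j * max 0 (v j - ?d i j) + ?d i j * w i j)"
  proof (intro sum_mono)
    fix j i assume "j \<in> A" "i \<in> ?F"
    then have "w i j * (v j - ?d i j) \<le> w i j * max 0 (v j - ?d i j)"
      using feas by (intro mult_left_mono) (auto simp: second_stage_feasible_def)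
    then show "v j * w i j \<le> w i j * max 0 (v j - ?d i j) + ?d i j * w i j"
      by (simp add: algebra_simps)
  qed
  also have "\<dots> = (\<Sum>i\<in>?F. \<Sum>j\<in>A. w i j * max 0 (v j - ?d i j)) + (\<Sum>j\<in>A. \<Sum>i\<in>?F. ?d i j * w i j)"
    by (simp add: sum.distrib sum.swap[of _ A])
  also have "\<dots> \<le> (\<Sum>i\<in>?F. real_of_rat (cost_II I i) * z i) + (\<Sum>j\<in>A. \<Sum>i\<in>?F. ?d i j * w i j)"
    by (intro add_right_mono sum_mono facility_payment_le assms)
  also have "\<dots> = second_stage_cost I A z w" by (simp add: second_stage_cost_def distance_def)
  finally show ?thesis .
qed

lemma weak_duality:
  assumes "finite A" "dual_feasible A v"
  shows "(\<Sum>j\<in>A. v j) \<le> g A"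
  unfolding second_stage_value_def
  using feasible_exists sum_dual_le_cost[OF assms] by (intro cInf_greatest) blast+

lemma g_le_integral_solution:
  assumes "H \<subseteq> facilities I" "\<And>j. j \<in> A \<Longrightarrow> \<sigma> j \<in> H"
  shows "g A \<le> (\<Sum>i\<in>H. residual_cost I x i) + (\<Sum>j\<in>A. distance I (\<sigma> j) j)"
proof -
  let ?F = "facilities I"
  define z where "z = (\<lambda>i. if i \<in> H \<and> x i \<noteq> 1 then 1 else 0 :: real)"
  define w where "w = (\<lambda>i j. if i = \<sigma> j then 1 else 0 :: real)"
  have \<sigma>F: "\<sigma> j \<in> ?F" if "j \<in> A" for j using assms that by blast
  have "feasible A z w"
    unfolding second_stage_feasible_def
  proof (intro conjI ballI)
    fix j assume j: "j \<in> A"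
    then show "1 \<le> (\<Sum>i\<in>?F. w i j)" using \<sigma>F finite_facilities by (simp add: w_def)
    show "w i j \<le> x i + z i" if "i \<in> ?F" for i
      using assms(2)[OF j] x_cases[OF that] by (auto simp: w_def z_def)
  qed (auto simp: z_def w_def)
  then have "g A \<le> second_stage_cost I A z w" by (rule g_le_cost)
  also have "(\<Sum>i\<in>?F. real_of_rat (cost_II I i) * z i) = (\<Sum>i\<in>H. residual_cost I x i)"
    using assms(1) finite_facilities
    by (intro sum.mono_neutral_cong_right) (auto simp: z_def residual_cost_def)
  then have "second_stage_cost I A z w
      = (\<Sum>i\<in>H. residual_cost I x i) + (\<Sum>j\<in>A. \<Sum>i\<in>?F. distance I i j * w i j)"
    by (simp add: second_stage_cost_def distance_def)
  also have "(\<Sum>j\<in>A. \<Sum>i\<in>?F. distance I i j * w i j) = (\<Sum>j\<in>A. distance I (\<sigma> j) j)"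
    using \<sigma>F finite_facilities
    by (intro sum.cong) (auto simp: w_def if_distrib[of "(*) _"] cong: if_cong)
  finally show ?thesis .
qed

lemma g_le_sum_share:
  assumes "S \<subseteq> clients I" "A \<subseteq> S" "S \<noteq> {}"
  shows "g A \<le> 3 * (\<Sum>j\<in>S. share S j)"
proof -
  have fin: "finite S" using assms(1) finite_clients by (rule finite_subset)
  obtain H \<sigma> where H: "H \<subseteq> facilities I" "\<And>j. j \<in> S \<Longrightarrow> \<sigma> j \<in> H"
    "(\<Sum>i\<in>H. residual_cost I x i) + (\<Sum>j\<in>S. distance I (\<sigma> j) j) \<le> 3 * (\<Sum>j\<in>S. share S j)"
    using integral_solution_le_shares[OF fin assms(3)] assms(1) by blast
  have "g A \<le> (\<Sum>i\<in>H. residual_cost I x i) + (\<Sum>j\<in>A. distance I (\<sigma> j) j)"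
    using H(1,2) assms(2) by (intro g_le_integral_solution) auto
  also have "(\<Sum>j\<in>A. distance I (\<sigma> j) j) \<le> (\<Sum>j\<in>S. distance I (\<sigma> j) j)"
    using fin assms(2) by (intro sum_mono2) auto
  finally show ?thesis using H(3) by simp
qed

lemma sum_share_le_g: "finite A \<Longrightarrow> (\<Sum>j\<in>A. share A j) \<le> g A"
  by (intro weak_duality share_dual_feasible)

lemma finite_scenario: "B \<in> k_bounded_scenarios I k \<Longrightarrow> finite B"
  using finite_clients finite_subset by (auto simp: k_bounded_scenarios_def)

lemma g_nonneg: "finite A \<Longrightarrow> 0 \<le> g A"
  by (rule order_trans[OF sum_nonneg sum_share_le_g]) (rule share_nonneg)

lemma g_empty: "g {} = 0"
proof (rule antisym)
  have "feasible {} (\<lambda>_. 0) (\<lambda>_ _. 0)" by (simp add: second_stage_feasible_def)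
  from g_le_cost[OF this] show "g {} \<le> 0" by (simp add: second_stage_cost_def)
qed (simp add: g_nonneg)

lemma estimate_le:
  assumes "greedy C B" "finite C"
  shows "estimate C B \<le> 2 * g B"
proof -
  have "finite B" using greedy_subset[OF assms(1)] assms(2) by (rule finite_subset)
  then show ?thesis
    using sum_share_le_g[of B] weak_duality[OF _ next_share_dual_feasible[OF assms]]
    by (simp add: estimate_def)
qed

lemma le_estimate:
  assumes "C \<subseteq> clients I" "B \<subseteq> C" "A \<subseteq> C" "card (A - B) \<le> card B"
  shows "g A \<le> 3 * estimate C B"
proof (cases "A \<union> B = {}")
  case True
  then show ?thesis by (simp add: g_empty estimate_def)
next
  case False
  have "g A \<le> 3 * (\<Sum>j\<in>B \<union> A. share (B \<union> A) j)" using assms False by (intro g_le_sum_share) auto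
  also have "(\<Sum>j\<in>B \<union> A. share (B \<union> A) j) \<le> estimate C B"
    using assms finite_subset[OF assms(1) finite_clients] by (intro sum_share_union_le)
  finally show ?thesis by simp
qed

end


section \<open>Choosing a scenario\<close>

text \<open>The default \<open>n\<close> is taken when \<open>S\<close> is empty.\<close>

definition argmax_below :: "nat \<Rightarrow> nat set \<Rightarrow> (nat \<Rightarrow> real) \<Rightarrow> nat" where
  "argmax_below n S h = Min (insert n {v \<in> S. \<forall>u\<in>S. h u \<le> h v})"

lemma argmax_below_cong:
  "S = S' \<Longrightarrow> (\<And>v. v \<in> S' \<Longrightarrow> h v = h' v) \<Longrightarrow> argmax_below n S h = argmax_below n S' h'"
  unfolding argmax_below_def by (intro arg_cong[where f = "\<lambda>T. Min (insert n T)"]) auto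

lemma argmax_below_le: "finite S \<Longrightarrow> argmax_below n S h \<le> n"
  unfolding argmax_below_def by (intro Min_le) auto

lemma argmax_below_empty [simp]: "argmax_below n {} h = n"
  by (simp add: argmax_below_def)

lemma
  assumes "S \<subseteq> {..<n}" "S \<noteq> {}"
  shows argmax_below_in: "argmax_below n S h \<in> S"
    and le_argmax_below: "u \<in> S \<Longrightarrow> h u \<le> h (argmax_below n S h)"
proof -
  let ?T = "{v \<in> S. \<forall>u\<in>S. h u \<le> h v}"
  have fin: "finite S" using assms(1) by (rule finite_subset) simp
  then have "Max (h ` S) \<in> h ` S" using assms(2) by (intro Max_in) auto
  then obtain v where v: "v \<in> S" "h v = Max (h ` S)" by auto
  then have "v \<in> ?T" using fin by simp
  then have T: "?T \<noteq> {}" by blast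
  have "Min ?T < n" using Min_in[OF _ T] fin assms(1) by auto
  then have "argmax_below n S h = Min ?T" using T fin by (simp add: argmax_below_def)
  moreover have "Min ?T \<in> ?T" using fin T by (intro Min_in) auto
  ultimately show "argmax_below n S h \<in> S" "u \<in> S \<Longrightarrow> h u \<le> h (argmax_below n S h)" by auto
qed

definition level_set :: "nat set \<Rightarrow> (nat \<Rightarrow> real) \<Rightarrow> nat \<Rightarrow> nat set" where
  "level_set L lv r = {v \<in> L. lv v \<le> lv r}"

context second_stage
begin

definition next_client :: "nat \<Rightarrow> nat set \<Rightarrow> nat set \<Rightarrow> nat" where
  "next_client k C B = argmax_below (npoints I) {j \<in> C. j \<notin> B \<and> card B < k}
      (\<lambda>j. share (insert j B) j)"

definition grow :: "nat \<Rightarrow> nat set \<Rightarrow> nat set \<Rightarrow> nat set" where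
  "grow k C B = insert (next_client k C B) B \<inter> {..<npoints I}"

definition greedy_set :: "nat \<Rightarrow> nat set \<Rightarrow> nat set" where
  "greedy_set k C = (grow k C ^^ npoints I) {}"

definition surplus :: "real \<Rightarrow> nat set \<Rightarrow> (nat \<Rightarrow> real) \<Rightarrow> (nat \<Rightarrow> nat set) \<Rightarrow> nat \<Rightarrow> real" where
  "surplus y L lv Bs r = estimate (level_set L lv r) (Bs r) - 2 * (y * lv r)"

definition best_level :: "real \<Rightarrow> nat set \<Rightarrow> (nat \<Rightarrow> real) \<Rightarrow> (nat \<Rightarrow> nat set) \<Rightarrow> nat" where
  "best_level y L lv Bs =
     argmax_below (npoints I) {r \<in> {..<npoints I}. 0 < surplus y L lv Bs r} (surplus y L lv Bs)"

definition answer :: "real \<Rightarrow> nat set \<Rightarrow> nat set \<Rightarrow> (nat \<Rightarrow> real) \<Rightarrow> (nat \<Rightarrow> nat set) \<Rightarrow> nat set" where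
  "answer y A L lv Bs =
     (if best_level y L lv Bs < npoints I then Bs (best_level y L lv Bs) else A)"

lemma answer_cong:
  assumes "\<And>r. r < npoints I \<Longrightarrow> Bs r = Bs' r"
  shows "answer y A L lv Bs = answer y A L lv Bs'"
proof -
  have "surplus y L lv Bs r = surplus y L lv Bs' r" if "r < npoints I" for r
    using assms[OF that] by (simp add: surplus_def)
  then have "best_level y L lv Bs = best_level y L lv Bs'"
    unfolding best_level_def by (intro argmax_below_cong) auto
  then show ?thesis using assms by (simp add: answer_def)
qed

lemma next_client_le: "finite C \<Longrightarrow> next_client k C B \<le> npoints I"
  unfolding next_client_def by (intro argmax_below_le) simp

lemma grow_step:
  assumes "greedy C B" "C \<subseteq> {..<npoints I}" "card B = min t (min k (card C))"
  shows "greedy C (grow k C B) \<and> card (grow k C B) = min (Suc t) (min k (card C))"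
proof -
  have B: "B \<subseteq> C" by (rule greedy_subset[OF assms(1)])
  have "finite C" using assms(2) by (rule finite_subset) simp
  then have fin: "finite C" "finite B" using B finite_subset by auto
  let ?S = "{j \<in> C. j \<notin> B \<and> card B < k}"
  show ?thesis
  proof (cases "?S = {}")
    case True
    then have "next_client k C B = npoints I" by (simp only: next_client_def argmax_below_empty)
    then have "grow k C B = B" using B assms(2) by (auto simp: grow_def)
    moreover have "card B = min k (card C)"
    proof (cases "card B < k")
      case True
      then have "B = C" using \<open>?S = {}\<close> B by auto
      then show ?thesis using True by simp
    qed (use assms(3) in auto)
    ultimately show ?thesis using assms(1,3) by simp
  next
    case False
    let ?j = "next_client k C B"
    have S: "?S \<subseteq> {..<npoints I}" using assms(2) by auto
    note j = argmax_below_in[OF S False, of "\<lambda>j. share (insert j B) j", folded next_client_def]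
      le_argmax_below[OF S False, of _ "\<lambda>j. share (insert j B) j", folded next_client_def]
    have grow: "grow k C B = insert ?j B" using j(1) B assms(2) by (auto simp: grow_def)
    have "greedy C (insert ?j B)" using j by (intro greedy.insert assms(1)) auto
    moreover have "card B < card C" using j(1) B fin by (intro psubset_card_mono) auto
    ultimately show ?thesis using j(1) fin assms(3) by (auto simp: grow min_def split: if_splits)
  qed
qed

lemma
  assumes "C \<subseteq> {..<npoints I}"
  shows greedy_greedy_set: "greedy C (greedy_set k C)"
    and card_greedy_set: "card (greedy_set k C) = min k (card C)"
proof -
  have "greedy C ((grow k C ^^ t) {}) \<and> card ((grow k C ^^ t) {}) = min t (min k (card C))" for t
  proof (induction t)
    case 0
    then show ?case by (simp add: greedy.empty)
  next
    case (Suc t)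
    then show ?case using grow_step[OF _ assms] by simp
  qed
  moreover have "card C \<le> npoints I" using card_mono[OF _ assms] by simp
  ultimately show "greedy C (greedy_set k C)" "card (greedy_set k C) = min k (card C)"
    by (simp_all add: greedy_set_def min_def)
qed

end


section \<open>Scenario metrics given by levels\<close>

definition penalty ::
    "(fl_instance \<Rightarrow> nat set \<Rightarrow> nat set \<Rightarrow> ennreal) \<Rightarrow> fl_instance \<Rightarrow> real \<Rightarrow> nat set \<Rightarrow> nat set \<Rightarrow> ereal"
      where
  "penalty \<kappa> I y A B = ereal y * enn2ereal (\<kappa> I A B)"

locale leveled_query = second_stage +
  fixes k :: nat and y :: real and A :: "nat set"
    and \<kappa> :: "fl_instance \<Rightarrow> nat set \<Rightarrow> nat set \<Rightarrow> ennreal" and L :: "nat set" and lv :: "nat \<Rightarrow> real"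
  assumes y_nonneg: "0 \<le> y" and scenario: "A \<in> k_bounded_scenarios I k"
    and L_clients: "L \<subseteq> clients I"
    and penalty_le: "\<And>r B. r < npoints I \<Longrightarrow> B \<subseteq> level_set L lv r \<Longrightarrow>
      card B = min k (card (level_set L lv r)) \<Longrightarrow> penalty \<kappa> I y A B \<le> ereal (y * lv r)"
    and le_penalty: "\<And>A'. A' \<in> k_bounded_scenarios I k \<Longrightarrow> penalty \<kappa> I y A A' \<noteq> \<infinity> \<Longrightarrow>
      A' \<subseteq> L \<and> (\<forall>v\<in>A'. ereal (y * lv v) \<le> penalty \<kappa> I y A A')"
    and penalty_self: "penalty \<kappa> I y A A = 0"
begin

abbreviation "C \<equiv> level_set L lv"
abbreviation "Bs r \<equiv> greedy_set k (C r)"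
abbreviation "gain \<equiv> surplus y L lv Bs"

lemma level_set_clients: "C r \<subseteq> clients I"
  using L_clients by (auto simp: level_set_def)

lemma greedy_Bs: "greedy (C r) (Bs r)" and card_Bs: "card (Bs r) = min k (card (C r))"
  using greedy_greedy_set[of "C r"] card_greedy_set[of "C r"] level_set_clients client_less
  by blast+

lemma Bs_scenario: "Bs r \<in> k_bounded_scenarios I k"
  using greedy_subset[OF greedy_Bs[of r]] level_set_clients[of r] card_Bs[of r]
  by (auto simp: k_bounded_scenarios_def)

lemma gain_le:
  assumes "r < npoints I"
  shows "ereal (gain r / 2) \<le> ereal (g (Bs r)) - penalty \<kappa> I y A (Bs r)"
proof -
  have "estimate (C r) (Bs r) \<le> 2 * g (Bs r)"
    using greedy_Bs level_set_clients finite_clients finite_subset by (intro estimate_le) blast+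
  then have "ereal (gain r / 2) \<le> ereal (g (Bs r)) - ereal (y * lv r)" by (simp add: surplus_def)
  also have "\<dots> \<le> ereal (g (Bs r)) - penalty \<kappa> I y A (Bs r)"
    using penalty_le[OF assms greedy_subset[OF greedy_Bs] card_Bs] by (intro ereal_minus_mono) auto
  finally show ?thesis .
qed

lemma le_gain:
  assumes "A' \<subseteq> C r" "card A' \<le> k"
  shows "g A' / 6 - y * lv r \<le> gain r / 2"
proof -
  have fin: "finite (C r)" using level_set_clients finite_clients by (rule finite_subset)
  have B: "Bs r \<subseteq> C r" by (rule greedy_subset[OF greedy_Bs])
  have "card (A' - Bs r) \<le> card (Bs r)"
  proof (cases "k \<le> card (C r)")
    case True
    then show ?thesis
      using card_mono[OF finite_subset[OF assms(1) fin], of "A' - Bs r"] assms(2) card_Bs[of r]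
      by force
  next
    case False
    then have "Bs r = C r" using B card_Bs[of r] by (intro card_subset_eq[OF fin]) auto
    then have "A' - Bs r = {}" using assms(1) by auto
    then show ?thesis by (simp only: card.empty)
  qed
  from le_estimate[OF level_set_clients B assms(1) this] show ?thesis by (simp add: surplus_def)
qed

lemma approx_value_le:
  assumes A': "A' \<in> k_bounded_scenarios I k"
    and V: "0 \<le> V" "\<And>r. r < npoints I \<Longrightarrow> gain r / 2 \<le> V"
  shows "ereal (g A' / 6) - penalty \<kappa> I y A A' \<le> ereal V"
proof -
  consider "A' = {}" | "penalty \<kappa> I y A A' = \<infinity>" | "A' \<noteq> {}" "penalty \<kappa> I y A A' \<noteq> \<infinity>" by blast
  then show ?thesis
  proof cases
    case 1
    have "0 \<le> penalty \<kappa> I y A A'" using y_nonneg by (simp add: penalty_def)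
    then show ?thesis using 1 V(1)
      by (cases "penalty \<kappa> I y A A'") (simp_all add: g_empty zero_ereal_def)
  next
    case 2
    then show ?thesis by simp
  next
    case 3
    note levels = le_penalty[OF A' 3(2)]
    have fin: "finite A'" by (rule finite_scenario[OF A'])
    then have "Max (lv ` A') \<in> lv ` A'" using 3(1) by (intro Max_in) auto
    then obtain r where r: "r \<in> A'" "lv r = Max (lv ` A')" by auto
    then have "A' \<subseteq> C r" using levels fin by (auto simp: level_set_def)
    moreover have "r < npoints I" using r(1) A' client_less by (auto simp: k_bounded_scenarios_def)
    ultimately have "g A' / 6 - y * lv r \<le> V"
      using le_gain[of A' r] V(2)[of r] A' by (auto simp: k_bounded_scenarios_def)
    then have "ereal (g A' / 6) - ereal (y * lv r) \<le> ereal V" by simp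
    moreover have "ereal (g A' / 6) - penalty \<kappa> I y A A' \<le> ereal (g A' / 6) - ereal (y * lv r)"
      using levels r(1) by (intro ereal_minus_mono) auto
    ultimately show ?thesis by (rule order_trans[rotated])
  qed
qed

lemma answer_value:
  obtains V where "0 \<le> V" "\<And>r. r < npoints I \<Longrightarrow> gain r / 2 \<le> V"
    "ereal V \<le> ereal (g (answer y A L lv Bs)) - penalty \<kappa> I y A (answer y A L lv Bs)"
proof -
  let ?S = "{r \<in> {..<npoints I}. 0 < gain r}" and ?b = "best_level y L lv Bs"
  show thesis
  proof (cases "?S = {}")
    case True
    then have "?b = npoints I" by (simp only: best_level_def argmax_below_empty)
    then have answer: "answer y A L lv Bs = A" by (simp add: answer_def)
    show thesis
      using True that[of 0] g_nonneg[OF finite_scenario[OF scenario]]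
      unfolding answer penalty_self by force
  next
    case False
    have b: "?b \<in> ?S" "\<And>r. r \<in> ?S \<Longrightarrow> gain r \<le> gain ?b"
      unfolding best_level_def by (rule argmax_below_in le_argmax_below; use False in auto)+
    then have answer: "answer y A L lv Bs = Bs ?b" by (simp add: answer_def)
    show thesis
    proof (rule that[of "gain ?b / 2"])
      show "gain r / 2 \<le> gain ?b / 2" if "r < npoints I" for r
        using b(1) b(2)[of r] that by (cases "0 < gain r") auto
    qed (use b(1) gain_le answer in auto)
  qed
qed

theorem answer_approx: "approx_scenario \<kappa> 6 1 I k x y A (answer y A L lv Bs)"
proof -
  obtain V where V: "0 \<le> V" "\<And>r. r < npoints I \<Longrightarrow> gain r / 2 \<le> V"
    "ereal V \<le> ereal (g (answer y A L lv Bs)) - penalty \<kappa> I y A (answer y A L lv Bs)"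
    by (rule answer_value) blast
  have "answer y A L lv Bs \<in> k_bounded_scenarios I k"
    using Bs_scenario scenario by (simp add: answer_def)
  moreover have "ereal (g A' / 6) - penalty \<kappa> I y A A'
      \<le> ereal (g (answer y A L lv Bs)) - penalty \<kappa> I y A (answer y A L lv Bs)"
    if "A' \<in> k_bounded_scenarios I k" for A'
    using approx_value_le[OF that V(1,2)] V(3) by (rule order_trans)
  ultimately show ?thesis unfolding approx_scenario_def mult_1 penalty_def by blast
qed

end


section \<open>The two scenario metrics\<close>

definition discrete_level :: "nat set \<Rightarrow> nat \<Rightarrow> real" where
  "discrete_level A v = of_bool (v \<notin> A)"

text \<open>If \<open>A\<close> is empty and the price \<open>y\<close> is positive, then only the empty scenario has a finite penalty.\<close>

definition asym_clients :: "fl_instance \<Rightarrow> real \<Rightarrow> nat set \<Rightarrow> nat set" where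
  "asym_clients I y A = (if A = {} \<and> 0 < y then {} else clients I)"

definition asym_level :: "fl_instance \<Rightarrow> nat set \<Rightarrow> nat \<Rightarrow> real" where
  "asym_level I A v = (if A = {} then 0 else Min (distance I v ` A))"

lemma penalty_discrete: "penalty kappa_discrete I y A B = (if A = B then 0 else ereal y)"
  by (simp add: penalty_def kappa_discrete_def zero_ennreal.rep_eq one_ennreal.rep_eq)

lemma penalty_mono:
  "0 \<le> y \<Longrightarrow> \<kappa> I A B \<le> u \<Longrightarrow> penalty \<kappa> I y A B \<le> ereal y * enn2ereal u"
  "0 \<le> y \<Longrightarrow> u \<le> \<kappa> I A B \<Longrightarrow> ereal y * enn2ereal u \<le> penalty \<kappa> I y A B"
  unfolding penalty_def by (auto intro!: ereal_mult_left_mono simp: less_eq_ennreal.rep_eq)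

context second_stage
begin

lemma leveled_query_discrete:
  assumes y: "0 \<le> y" and A: "A \<in> k_bounded_scenarios I k"
  shows "leveled_query I x k y A kappa_discrete (clients I) (discrete_level A)"
proof unfold_locales
  fix r B
  let ?C = "level_set (clients I) (discrete_level A) r"
  assume B: "B \<subseteq> ?C" "card B = min k (card ?C)"
  show "penalty kappa_discrete I y A B \<le> ereal (y * discrete_level A r)"
  proof (cases "r \<in> A")
    case True
    then have "?C = A" using A
      by (auto simp: level_set_def discrete_level_def k_bounded_scenarios_def)
    then have "B = A"
      using B A finite_scenario[OF A] by (intro card_subset_eq) (auto simp: k_bounded_scenarios_def)
    then show ?thesis using y by (simp add: penalty_discrete discrete_level_def)
  qed (use y in \<open>simp add: penalty_discrete discrete_level_def\<close>)
next
  fix A' assume A': "A' \<in> k_bounded_scenarios I k"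
  have "ereal (y * discrete_level A v) \<le> penalty kappa_discrete I y A A'" if "v \<in> A'" for v
    using that y by (auto simp: penalty_discrete discrete_level_def zero_ereal_def)
  then show "A' \<subseteq> clients I \<and>
      (\<forall>v\<in>A'. ereal (y * discrete_level A v) \<le> penalty kappa_discrete I y A A')"
    using A' by (simp add: k_bounded_scenarios_def)
qed (use assms in \<open>simp_all add: penalty_discrete\<close>)

lemma asym_level_nonneg: "finite A \<Longrightarrow> 0 \<le> asym_level I A v"
  by (simp add: asym_level_def)

lemma INF_distance:
  assumes "finite A" "A \<noteq> {}"
  shows "(INF j\<in>A. ennreal (real_of_rat (fl_dist I v j))) = ennreal (asym_level I A v)"
proof -
  have "(INF j\<in>A. ennreal (distance I v j)) = Min ((\<lambda>j. ennreal (distance I v j)) ` A)"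
    using assms by (simp add: Min_Inf)
  also have "\<dots> = Min (ennreal ` distance I v ` A)" by (simp add: image_image)
  also have "\<dots> = ennreal (Min (distance I v ` A))"
    using assms by (intro mono_Min_commute[symmetric]) (auto intro!: monoI ennreal_leI)
  finally show ?thesis using assms by (simp add: asym_level_def distance_def)
qed

lemma penalty_asym_level:
  assumes "finite A" "A \<noteq> {}" "0 \<le> y"
  shows "(\<And>v. v \<in> B \<Longrightarrow> asym_level I A v \<le> asym_level I A r) \<Longrightarrow>
      penalty kappa_asym I y A B \<le> ereal (y * asym_level I A r)"
    and "r \<in> B \<Longrightarrow> ereal (y * asym_level I A r) \<le> penalty kappa_asym I y A B"
proof -
  have scaled: "ereal y * enn2ereal (ennreal (asym_level I A r)) = ereal (y * asym_level I A r)"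
    using asym_level_nonneg[OF assms(1)] by (simp add: enn2ereal_ennreal)
  have kappa: "kappa_asym I A B = (SUP v\<in>B. ennreal (asym_level I A v))"
    unfolding kappa_asym_def INF_distance[OF assms(1,2)] ..
  show "penalty kappa_asym I y A B \<le> ereal (y * asym_level I A r)"
    if "\<And>v. v \<in> B \<Longrightarrow> asym_level I A v \<le> asym_level I A r"
    unfolding scaled[symmetric] using that
    by (intro penalty_mono(1)[OF assms(3)]) (auto simp: kappa intro!: SUP_least ennreal_leI)
  show "ereal (y * asym_level I A r) \<le> penalty kappa_asym I y A B" if "r \<in> B"
    unfolding scaled[symmetric] using that
    by (intro penalty_mono(2)[OF assms(3)]) (auto simp: kappa intro: SUP_upper)
qed

lemma penalty_asym_empty:
  assumes "0 \<le> y"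
  shows "penalty kappa_asym I y {} B = (if B = {} \<or> y = 0 then 0 else \<infinity>)"
proof (cases "B = {}")
  case True
  then show ?thesis by (simp add: penalty_def kappa_asym_def bot_ennreal zero_ennreal.rep_eq)
next
  case False
  then have "kappa_asym I {} B = \<infinity>" by (simp add: kappa_asym_def)
  then show ?thesis using False assms by (auto simp: penalty_def simp flip: zero_ereal_def)
qed

lemma penalty_asym_self:
  assumes "A \<subseteq> facilities I \<union> clients I"
  shows "penalty kappa_asym I y A A = 0"
proof -
  have "(INF j\<in>A. ennreal (real_of_rat (fl_dist I v j))) \<le> 0" if v: "v \<in> A" for v
  proof -
    have "real_of_rat (fl_dist I v v) = 0"
      using mdist_zero[of v] v assms by (auto simp: distance_def)
    then show ?thesis using INF_lower[OF v, of "\<lambda>j. ennreal (real_of_rat (fl_dist I v j))"] by simp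
  qed
  then have "kappa_asym I A A \<le> 0" unfolding kappa_asym_def by (rule SUP_least)
  then show ?thesis by (simp add: penalty_def zero_ennreal.rep_eq)
qed

lemma leveled_query_asym:
  assumes y: "0 \<le> y" and A: "A \<in> k_bounded_scenarios I k"
  shows "leveled_query I x k y A kappa_asym (asym_clients I y A) (asym_level I A)"
proof unfold_locales
  fix r B
  assume B: "B \<subseteq> level_set (asym_clients I y A) (asym_level I A) r"
  show "penalty kappa_asym I y A B \<le> ereal (y * asym_level I A r)"
  proof (cases "A = {}")
    case True
    then have "B = {} \<or> y = 0" using B y
      by (auto simp: level_set_def asym_clients_def split: if_splits)
    then show ?thesis using True
      by (auto simp: penalty_asym_empty[OF y] asym_level_def zero_ereal_def)
  next
    case False
    then show ?thesis using B
      by (intro penalty_asym_level finite_scenario[OF A] y) (auto simp: level_set_def)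
  qed
next
  fix A' assume A': "A' \<in> k_bounded_scenarios I k" "penalty kappa_asym I y A A' \<noteq> \<infinity>"
  show "A' \<subseteq> asym_clients I y A \<and>
      (\<forall>v\<in>A'. ereal (y * asym_level I A v) \<le> penalty kappa_asym I y A A')"
  proof (cases "A = {}")
    case True
    then have "A' = {} \<or> y = 0" using A'(2)
      by (auto simp: penalty_asym_empty[OF y] split: if_splits)
    then show ?thesis using True A'(1)
      by (auto simp: penalty_asym_empty[OF y] asym_clients_def
        asym_level_def k_bounded_scenarios_def zero_ereal_def)
  next
    case False
    then show ?thesis using A'(1) penalty_asym_level(2)[OF finite_scenario[OF A] _ y]
      by (auto simp: asym_clients_def k_bounded_scenarios_def)
  qed
next
  show "penalty kappa_asym I y A A = 0"
    using A by (intro penalty_asym_self) (auto simp: k_bounded_scenarios_def)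
qed (use assms in \<open>auto simp: asym_clients_def split: if_splits\<close>)

end


section \<open>The input word of a query\<close>

fun inst :: "fl_query \<Rightarrow> fl_instance" where "inst (I, k, x, y, A) = I"
fun capacity :: "fl_query \<Rightarrow> nat" where "capacity (I, k, x, y, A) = k"
fun opened :: "fl_query \<Rightarrow> nat \<Rightarrow> real" where "opened (I, k, x, y, A) = x"
fun price :: "fl_query \<Rightarrow> rat" where "price (I, k, x, y, A) = y"
fun current :: "fl_query \<Rightarrow> nat set" where "current (I, k, x, y, A) = A"

abbreviation "size_of q \<equiv> npoints (inst q)"
abbreviation "facs q \<equiv> facilities (inst q)"
abbreviation "dist_of q \<equiv> distance (inst q)"
abbreviation "cost_of q \<equiv> residual_cost (inst q) (opened q)"

definition input :: "fl_query \<Rightarrow> nat \<Rightarrow> int" where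
  "input q = input_store (encode_query q) 0"

definition record_addr :: "nat \<Rightarrow> nat \<Rightarrow> nat" where
  "record_addr c v = 4 + c + 8 * v"

definition pair_addr :: "nat \<Rightarrow> nat \<Rightarrow> nat \<Rightarrow> nat \<Rightarrow> nat" where
  "pair_addr n c u v = 4 + c + 8 * n + 2 * (n * u + v)"

lemma length_concat_map:
  assumes "\<And>x. x \<in> set xs \<Longrightarrow> length (h x) = w"
  shows "length (concat (map h xs)) = w * length xs"
  using assms by (induction xs) auto

lemma nth_concat_map:
  assumes "\<And>x. x \<in> set xs \<Longrightarrow> length (h x) = w" "v < length xs" "i < w"
  shows "concat (map h xs) ! (w * v + i) = h (xs ! v) ! i"
  using assms
proof (induction xs arbitrary: v)
  case (Cons x xs)
  then show ?case by (cases v) (simp_all add: nth_append add.assoc)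
qed simp

definition point_code :: "fl_query \<Rightarrow> nat \<Rightarrow> int list" where
  "point_code q v = [of_bool (v \<in> facs q), of_bool (v \<in> clients (inst q)),
     of_bool (v \<in> facs q \<and> opened q v = 1), of_bool (v \<in> current q)] @
     encode_rat (if v \<in> facs q then cost_I (inst q) v else 0) @
     encode_rat (if v \<in> facs q then cost_II (inst q) v else 0)"

definition row_code :: "fl_query \<Rightarrow> nat \<Rightarrow> int list" where
  "row_code q u = concat (map (\<lambda>v. encode_rat (fl_dist (inst q) u v)) [0..<size_of q])"

lemma encode_query_eq: "encode_query q =
    [int (size_of q), int (capacity q), fst (quotient_of (price q)), snd (quotient_of (price q))] @
    concat (map (point_code q) [0..<size_of q]) @ concat (map (row_code q) [0..<size_of q])"
proof -
  obtain I k x y A where q: "q = (I, k, x, y, A)" by (cases q)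
  show ?thesis
    by (simp add: q encode_query_def point_code_def[abs_def]
      row_code_def[abs_def] encode_rat_def[of y] cong: if_cong)
qed

lemma length_point_code: "length (point_code q v) = 8"
  and length_row_code: "length (row_code q u) = 2 * size_of q"
  by (simp_all add: point_code_def row_code_def encode_rat_def length_concat_map[where w = 2])

lemma length_codes: "length (concat (map (point_code q) [0..<n])) = 8 * n"
  using length_concat_map[of "[0..<n]" "point_code q" 8] length_point_code by simp

lemma size_le_length_encode_query: "size_of q \<le> length (encode_query q)"
  by (simp add: encode_query_eq length_codes del: length_concat)

lemma input_header: "input q 0 = int (size_of q)" "input q 1 = int (capacity q)"
    "input q 2 = fst (quotient_of (price q))" "input q 3 = snd (quotient_of (price q))"
  by (simp_all add: input_def input_store_def encode_query_eq)

lemma input_point_code: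
  assumes "v < size_of q" "c < 8"
  shows "input q (record_addr c v) = point_code q v ! c"
proof -
  have "8 * v + c < 8 * size_of q" using assms by linarith
  then have "input q (4 + (8 * v + c)) = concat (map (point_code q) [0..<size_of q]) ! (8 * v + c)"
    by (simp add: input_def input_store_def encode_query_eq
      nth_append length_codes del: length_concat)
  also have "\<dots> = point_code q v ! c"
    using nth_concat_map[of "[0..<size_of q]" "point_code q" 8 v c] assms length_point_code by simp
  finally show ?thesis by (simp add: record_addr_def ac_simps)
qed

lemma input_record:
  assumes "v < size_of q"
  shows "input q (record_addr 0 v) = of_bool (v \<in> facs q)"
    "input q (record_addr 1 v) = of_bool (v \<in> clients (inst q))"
    "input q (record_addr 2 v) = of_bool (v \<in> facs q \<and> opened q v = 1)"
    "input q (record_addr 3 v) = of_bool (v \<in> current q)"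
    "input q (record_addr 6 v) = fst (quotient_of (if v \<in> facs q then cost_II (inst q) v else 0))"
    "input q (record_addr 7 v) = snd (quotient_of (if v \<in> facs q then cost_II (inst q) v else 0))"
  using input_point_code[OF assms] by (simp_all add: point_code_def encode_rat_def)

lemma input_pair_code:
  assumes "u < size_of q" "v < size_of q" "c < 2"
  shows "input q (pair_addr (size_of q) c u v) = encode_rat (fl_dist (inst q) u v) ! c"
proof -
  let ?n = "size_of q"
  have "2 * v + c < 2 * ?n" using assms by linarith
  moreover have "2 * ?n * u + 2 * ?n \<le> 2 * ?n * ?n"
    using mult_le_mono2[of "Suc u" ?n "2 * ?n"] assms(1) by simp
  ultimately have "input q (4 + (8 * ?n + (2 * ?n * u + (2 * v + c))))
      = concat (map (row_code q) [0..<?n]) ! (2 * ?n * u + (2 * v + c))"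
    using length_concat_map[of "[0..<?n]" "row_code q" "2 * ?n"] length_row_code
    by (simp add: input_def input_store_def encode_query_eq
      nth_append length_codes del: length_concat)
  also have "\<dots> = row_code q u ! (2 * v + c)"
    using nth_concat_map[of "[0..<?n]" "row_code q" "2 * ?n" u "2 * v + c"] length_row_code
      assms(1) \<open>2 * v + c < 2 * ?n\<close> by simp
  also have "\<dots> = encode_rat (fl_dist (inst q) u v) ! c"
    using nth_concat_map[of "[0..<?n]" "\<lambda>v. encode_rat (fl_dist (inst q) u v)" 2 v c] assms(2,3)
    by (simp add: row_code_def encode_rat_def)
  finally show ?thesis by (simp add: pair_addr_def algebra_simps)
qed

lemma input_distance:
  assumes "u < size_of q" "v < size_of q"
  shows "input q (pair_addr (size_of q) 0 u v) = fst (quotient_of (fl_dist (inst q) u v))"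
    "input q (pair_addr (size_of q) 1 u v) = snd (quotient_of (fl_dist (inst q) u v))"
  using input_pair_code[OF assms] by (simp_all add: encode_rat_def)


section \<open>Scaling to integers\<close>

definition common_denominator :: "fl_query \<Rightarrow> int" where
  "common_denominator q = (\<Prod>v<size_of q. input q (record_addr 7 v)) *
     (\<Prod>u<size_of q. \<Prod>v<size_of q. input q (pair_addr (size_of q) 1 u v))"

text \<open>The factor \<open>fact n\<close> makes averages over at most \<open>n\<close> clients integral, the factor \<open>input q 3\<close>, the
  denominator of the price, makes multiples of the price integral.\<close>

definition common_scale :: "fl_query \<Rightarrow> int" where
  "common_scale q = fact (size_of q) * input q 3 * common_denominator q"

definition clears_denominator :: "fl_query \<Rightarrow> real \<Rightarrow> bool" where
  "clears_denominator q r \<longleftrightarrow> of_int (common_denominator q) * r \<in> \<int>"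

lemma common_denominator_pos: "0 < common_denominator q"
proof -
  have "0 < input q (record_addr 7 v)" if "v < size_of q" for v
    unfolding input_record(6)[OF that] by (rule quotient_of_denom_pos')
  moreover have "0 < input q (pair_addr (size_of q) 1 u v)"
    if "u < size_of q" "v < size_of q" for u v
    unfolding input_distance(2)[OF that] by (rule quotient_of_denom_pos')
  ultimately show ?thesis
    unfolding common_denominator_def by (intro mult_pos_pos prod_pos ballI) simp_all
qed

lemma common_scale_pos: "0 < common_scale q"
  using common_denominator_pos[of q] quotient_of_denom_pos'[of "price q"]
  by (simp add: common_scale_def input_header)

lemma input_dvd_common_denominator:
  "v < size_of q \<Longrightarrow> input q (record_addr 7 v) dvd common_denominator q"
  "u < size_of q \<Longrightarrow> v < size_of q \<Longrightarrow> input q (pair_addr (size_of q) 1 u v) dvd common_denominator q"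
proof -
  show "input q (record_addr 7 v) dvd common_denominator q" if "v < size_of q"
    unfolding common_denominator_def using that by (intro dvd_mult2 dvd_prodI) auto
  assume uv: "u < size_of q" "v < size_of q"
  have "input q (pair_addr (size_of q) 1 u v)
      dvd (\<Prod>v<size_of q. input q (pair_addr (size_of q) 1 u v))"
    using uv by (intro dvd_prodI) auto
  also have "\<dots> dvd (\<Prod>u<size_of q. \<Prod>v<size_of q. input q (pair_addr (size_of q) 1 u v))"
    using uv by (intro dvd_prodI
      [where f = "\<lambda>u. \<Prod>v<size_of q. input q (pair_addr (size_of q) 1 u v)"]) auto
  finally show "input q (pair_addr (size_of q) 1 u v) dvd common_denominator q"
    unfolding common_denominator_def by (rule dvd_mult)
qed

lemma clears_denominator_add: "clears_denominator q a \<Longrightarrow>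
    clears_denominator q b \<Longrightarrow> clears_denominator q (a + b)"
  by (simp add: clears_denominator_def distrib_left)

lemma clears_denominator_sum: "(\<And>v. v \<in> S \<Longrightarrow> clears_denominator q (h v)) \<Longrightarrow>
    clears_denominator q (\<Sum>v\<in>S. h v)"
  by (simp add: clears_denominator_def sum_distrib_left Ints_sum)

lemma clears_denominator_of_bool: "clears_denominator q (of_bool P)"
  by (simp add: clears_denominator_def)

lemma of_rat_quotient_of: "real_of_rat r = fst (quotient_of r) / snd (quotient_of r)"
  using quotient_of_div[of r] by (metis of_rat_divide of_rat_of_int_eq prod.collapse)

lemma clears_denominator_of_rat:
  assumes "snd (quotient_of r) dvd common_denominator q"
  shows "clears_denominator q (real_of_rat r)"
proof -
  have "of_int (common_denominator q) * real_of_rat r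
      = of_int (fst (quotient_of r) * (common_denominator q div snd (quotient_of r)))"
    using assms by (simp add: of_rat_quotient_of real_of_int_div)
  then show ?thesis unfolding clears_denominator_def by (metis Ints_of_int)
qed

lemma clears_denominator_distance: "u < size_of q \<Longrightarrow>
    v < size_of q \<Longrightarrow> clears_denominator q (dist_of q u v)"
  using input_dvd_common_denominator(2)[of u q v] input_distance(2)[of u q v]
  by (simp add: distance_def clears_denominator_of_rat)

lemma clears_denominator_residual_cost:
  assumes "i < size_of q" "i \<in> facs q"
  shows "clears_denominator q (cost_of q i)"
  using clears_denominator_of_rat[of "cost_II (inst q) i" q]
    input_dvd_common_denominator(1)[OF assms(1)]
    clears_denominator_of_bool[of q False] assms
  by (simp add: residual_cost_def input_record)

lemma scaled_div_eq:
  assumes "k dvd fact (size_of q) * input q 3" "0 < k"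
    "clears_denominator q r" "of_int z = of_int (common_scale q) * r"
  shows "of_int (z div k) = of_int (common_scale q) * (r / of_int k)"
proof -
  obtain m where m: "of_int (common_denominator q) * r = of_int m"
    using assms(3) unfolding clears_denominator_def by (rule Ints_cases)
  have "of_int z = (of_int (fact (size_of q) * input q 3 * m) :: real)"
    using m assms(4) by (simp add: common_scale_def mult.assoc)
  then have "z = fact (size_of q) * input q 3 * m" by (simp only: of_int_eq_iff)
  then have "k dvd z" using assms(1) by simp
  then show ?thesis using assms(2,4) by (simp add: real_of_int_div)
qed


section \<open>Computable functionals of a query and its chosen sets\<close>

text \<open>Array \<open>2\<close> holds a row for each level \<open>r\<close>. Rows have length \<open>n + 1\<close>; column \<open>n\<close> absorbs the
  assignments made when no client is left to be chosen.\<close>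

definition chosen_addr :: "nat \<Rightarrow> nat \<Rightarrow> nat \<Rightarrow> nat" where
  "chosen_addr n r v = n * r + r + v"

definition represents :: "fl_query \<times> (nat \<Rightarrow> nat set) \<Rightarrow> store \<Rightarrow> bool" where
  "represents p s \<longleftrightarrow> fst p \<in> fl_queries \<and> s 0 = input (fst p) \<and>
     (\<forall>r<size_of (fst p). snd p r \<subseteq> {..<size_of (fst p)} \<and>
       (\<forall>v<size_of (fst p). s 2 (chosen_addr (size_of (fst p)) r v) = of_bool (v \<in> snd p r)))"

interpretation representation represents "\<lambda>p. size_of (fst p)" 3
proof
  show "represents p s'" if "represents p s" "\<And>a. a < 3 \<Longrightarrow> s' a = s a" for p s s'
    using that by (simp add: represents_def)
  show "s 0 0 = int (size_of (fst p))" if "represents p s" for p s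
    using that by (simp add: represents_def input_header)
qed simp

lemma stateI: "represents p s \<Longrightarrow> state p"
  unfolding state_def by blast

lemma state_query: "state p \<Longrightarrow> fst p \<in> fl_queries"
  unfolding state_def represents_def by blast

lemma state_chosen: "state p \<Longrightarrow> r < size_of (fst p) \<Longrightarrow> snd p r \<subseteq> {..<size_of (fst p)}"
  unfolding state_def represents_def by blast

lemma second_stage_query: "q \<in> fl_queries \<Longrightarrow> second_stage (inst q) (opened q)"
  by (cases q) (simp add: fl_queries_def second_stage_def)

lemma current_scenario: "q \<in> fl_queries \<Longrightarrow> current q \<in> k_bounded_scenarios (inst q) (capacity q)"
  by (cases q) (simp add: fl_queries_def)

lemma client_less_size: "q \<in> fl_queries \<Longrightarrow> v \<in> clients (inst q) \<Longrightarrow> v < size_of q"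
  and facility_less_size: "q \<in> fl_queries \<Longrightarrow> v \<in> facs q \<Longrightarrow> v < size_of q"
  using second_stage.client_less second_stage.facility_less second_stage_query by blast+

lemma current_less_size: "q \<in> fl_queries \<Longrightarrow> v \<in> current q \<Longrightarrow> v < size_of q"
  using current_scenario client_less_size unfolding k_bounded_scenarios_def by blast

lemma computable_input:
  assumes "computable D (\<lambda>p vs. int (e p vs))"
    and "\<And>p vs. (p, vs) \<in> D \<Longrightarrow> state p \<Longrightarrow> input (fst p) (e p vs) = h p vs"
  shows "computable D h"
proof (rule computable_read[OF _ assms(1), of 0])
  fix p s vs assume s: "represents p s" "(p, vs) \<in> D"
  show "s 0 (nat (int (e p vs))) = h p vs"
    using assms(2)[OF s(2) stateI[OF s(1)]] s(1) by (simp add: represents_def)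
qed simp

lemma computable_input_mult:
  assumes "computable D (\<lambda>p vs. int (e p vs))" "computable D h"
  shows "computable D (\<lambda>p vs. input (fst p) (e p vs) * h p vs)"
  by (rule computable_mult_input[OF assms]) (auto simp: represents_def)

lemma computable_record_addr:
  assumes "computable D (\<lambda>p vs. int (v p vs))"
  shows "computable D (\<lambda>p vs. int (record_addr c (v p vs)))"
  using computable_add[OF computable_const[where k = "int (4 + c)"]
    computable_mult_nat[OF assms, where k = 8]]
  by (simp add: record_addr_def)

lemma computable_size_mult_add:
  assumes "computable D (\<lambda>p vs. int (u p vs))" "computable D (\<lambda>p vs. int (v p vs))"
  shows "computable D (\<lambda>p vs. int (size_of (fst p) * u p vs + v p vs))"
  using computable_add[OF computable_mult_size[OF assms(1)] assms(2)] by simp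

lemma computable_pair_addr:
  assumes "computable D (\<lambda>p vs. int (u p vs))" "computable D (\<lambda>p vs. int (v p vs))"
  shows "computable D (\<lambda>p vs. int (pair_addr (size_of (fst p)) c (u p vs) (v p vs)))"
  using computable_add[OF computable_add[OF computable_const[where k = "int (4 + c)"]
      computable_mult_nat[OF computable_size, where k = 8]]
      computable_mult_nat[OF computable_size_mult_add[OF assms], where k = 2]]
  by (simp add: pair_addr_def)

lemma computable_chosen_addr:
  assumes "computable D (\<lambda>p vs. int (r p vs))" "computable D (\<lambda>p vs. int (v p vs))"
  shows "computable D (\<lambda>p vs. int (chosen_addr (size_of (fst p)) (r p vs) (v p vs)))"
  using computable_add[OF computable_size_mult_add[OF assms(1,1)] assms(2)]
  by (simp add: chosen_addr_def)

lemma decidable_record: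
  assumes v: "computable_point D v"
    and "\<And>q u. u < size_of q \<Longrightarrow> input q (record_addr c u) = of_bool (P q u)"
  shows "decidable D (\<lambda>p vs. P (fst p) (v p vs))"
  unfolding decidable_def
  by (rule computable_input[OF computable_record_addr[OF computable_pointD[OF v]]])
    (rule assms(2)[OF computable_point_less[OF v]])

lemma decidable_opened: "computable_point D v \<Longrightarrow>
    decidable D (\<lambda>p vs. v p vs \<in> facs (fst p) \<and> opened (fst p) (v p vs) = 1)"
  by (erule decidable_record, erule input_record(3))

lemma decidable_current:
  "computable_point D v \<Longrightarrow> decidable D (\<lambda>p vs. v p vs \<in> current (fst p))"
  by (erule decidable_record, erule input_record(4))

lemma decidable_set_record:
  assumes "\<And>q u. u < size_of q \<Longrightarrow> input q (record_addr c u) = of_bool (u \<in> S q)"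
    and "\<And>q u. q \<in> fl_queries \<Longrightarrow> u \<in> S q \<Longrightarrow> u < size_of q"
  shows "decidable_set D (\<lambda>p vs. S (fst p))"
proof (rule decidable_setI)
  show "S (fst p) \<subseteq> {..<size_of (fst p)}" if "state p" for p
    using assms(2)[OF state_query[OF that]] by auto
  show "decidable (each D (\<lambda>p _. {..<size_of (fst p)})) (\<lambda>p vs. index vs \<in> S (fst p))"
    by (rule decidable_record[OF computable_point_index[OF decidable_set_size] assms(1)])
qed

lemma decidable_set_facilities: "decidable_set D (\<lambda>p vs. facs (fst p))"
  by (rule decidable_set_record[OF input_record(1) facility_less_size])

lemma decidable_set_current: "decidable_set D (\<lambda>p vs. current (fst p))"
  by (rule decidable_set_record[OF input_record(4) current_less_size])

lemma decidable_chosen: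
  assumes r: "computable_point D r" and v: "computable_point D v"
  shows "decidable D (\<lambda>p vs. v p vs \<in> snd p (r p vs))"
  unfolding decidable_def
proof (rule computable_read[OF _
  computable_chosen_addr[OF computable_pointD[OF r] computable_pointD[OF v]], of 2])
  fix p s vs assume s: "represents p s" "(p, vs) \<in> D"
  show "s 2 (nat (int (chosen_addr (size_of (fst p)) (r p vs) (v p vs))))
      = of_bool (v p vs \<in> snd p (r p vs))"
    using computable_point_less[OF r s(2) stateI[OF s(1)]]
      computable_point_less[OF v s(2) stateI[OF s(1)]] s(1)
    by (simp add: represents_def)
qed simp

lemma decidable_set_chosen:
  assumes r: "computable_point D r"
  shows "decidable_set D (\<lambda>p vs. snd p (r p vs))"
proof (rule decidable_setI)
  show "snd p (r p vs) \<subseteq> {..<size_of (fst p)}" if "(p, vs) \<in> D" "state p" for p vs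
    using state_chosen[OF that(2) computable_point_less[OF r that]] .
  show "decidable (each D (\<lambda>p _. {..<size_of (fst p)})) (\<lambda>p vs. index vs \<in> snd p (r p (tl vs)))"
    by (intro decidable_chosen computable_point_shift[OF r]
      computable_point_index decidable_set_size)
qed

lemma computable_common_scale: "computable D (\<lambda>p vs. common_scale (fst p))"
proof -
  let ?E = "\<lambda>D. bind (each D (\<lambda>p _. {..<size_of (fst p)})) (\<lambda>_ _. UNIV)"
  have index: "computable (?E D) (\<lambda>p vs. int (index (tl vs)))" for D
    by (intro computable_shift computable_index)
  have variable: "computable (?E D) (\<lambda>p vs. hd vs)" for D by (rule computable_variable)
  have "computable D (\<lambda>p vs. input (fst p) 3 * fact (size_of (fst p)))"
    by (intro computable_input_mult computable_const computable_fact)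
  then have records: "computable D (\<lambda>p vs. (\<Prod>v<size_of (fst p). input (fst p) (record_addr 7 v)) *
      (input (fst p) 3 * fact (size_of (fst p))))"
    by (rule computable_prod) (intro computable_input_mult computable_record_addr index variable)
  have row: "computable (?E D) (\<lambda>p vs.
      (\<Prod>v<size_of (fst p). input (fst p)
          (pair_addr (size_of (fst p)) 1 (index (tl vs)) v)) * hd vs)"
    by (intro computable_prod computable_input_mult
      computable_pair_addr index variable computable_shift)
  have "computable D (\<lambda>p vs.
      (\<Prod>u<size_of (fst p). \<Prod>v<size_of (fst p). input (fst p) (pair_addr (size_of (fst p)) 1 u v)) *
      ((\<Prod>v<size_of (fst p). input (fst p) (record_addr 7 v)) *
          (input (fst p) 3 * fact (size_of (fst p)))))"
    by (rule computable_prod[OF records row])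
  then show ?thesis
    by (rule computable_cong) (simp_all add: common_scale_def common_denominator_def mult_ac)
qed

definition numerator :: "fl_query \<Rightarrow> real \<Rightarrow> int" where
  "numerator q r = \<lfloor>of_int (common_scale q) * r\<rfloor>"

definition scaled ::
    "((fl_query \<times> (nat \<Rightarrow> nat set)) \<times> int list) set
        \<Rightarrow> (fl_query \<times> (nat \<Rightarrow> nat set) \<Rightarrow> int list \<Rightarrow> real) \<Rightarrow> bool" where
  "scaled D r \<longleftrightarrow> computable D (\<lambda>p vs. numerator (fst p) (r p vs)) \<and>
     (\<forall>p vs. (p, vs) \<in> D \<longrightarrow> state p \<longrightarrow> of_int (common_scale (fst p)) * r p vs \<in> \<int>)"

lemma scaledI:
  assumes z: "computable D z"
    and eq: "\<And>p vs. (p, vs) \<in> D \<Longrightarrow> state p \<Longrightarrow>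
        of_int (z p vs) = of_int (common_scale (fst p)) * r p vs"
  shows "scaled D r"
  unfolding scaled_def
proof (intro conjI allI impI)
  show "computable D (\<lambda>p vs. numerator (fst p) (r p vs))"
    by (rule computable_cong[OF z order_refl]) (simp add: numerator_def flip: eq)
  show "of_int (common_scale (fst p)) * r p vs \<in> \<int>" if "(p, vs) \<in> D" "state p" for p vs
    by (simp flip: eq[OF that])
qed

lemma computable_numerator: "scaled D r \<Longrightarrow> computable D (\<lambda>p vs. numerator (fst p) (r p vs))"
  by (simp add: scaled_def)

lemma of_int_numerator:
  assumes "scaled D r" "(p, vs) \<in> D" "state p"
  shows "of_int (numerator (fst p) (r p vs)) = of_int (common_scale (fst p)) * r p vs"
proof -
  have "of_int (common_scale (fst p)) * r p vs \<in> \<int>" using assms unfolding scaled_def by blast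
  then show ?thesis unfolding numerator_def by (elim Ints_cases) simp
qed

lemma scaled_subset: "scaled D' r \<Longrightarrow> D \<subseteq> D' \<Longrightarrow> scaled D r"
  unfolding scaled_def using computable_subset by blast

lemma scaled_cong:
  assumes r': "scaled D' r'" and "D \<subseteq> D'" "\<And>p vs. (p, vs) \<in> D \<Longrightarrow> state p \<Longrightarrow> r p vs = r' p vs"
  shows "scaled D r"
  by (rule scaledI[OF computable_numerator[OF scaled_subset[OF r' assms(2)]]])
    (simp add: of_int_numerator[OF scaled_subset[OF r' assms(2)]] assms(3))

lemma scaled_shift: "scaled D r \<Longrightarrow> scaled (bind D S) (\<lambda>p vs. r p (tl vs))"
  using computable_shift[of D "\<lambda>p vs. numerator (fst p) (r p vs)" S]
  by (simp add: scaled_def bind_iff)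

lemma scaled_shift_second:
  "scaled (bind D A) r \<Longrightarrow>
    scaled (bind (bind D S) (\<lambda>p vs. A p (tl vs))) (\<lambda>p vs. r p (hd vs # tl (tl vs)))"
  using computable_shift_second[of D A "\<lambda>p vs. numerator (fst p) (r p vs)" S]
  by (simp add: scaled_def bind_iff)

lemma scaled_zero: "scaled D (\<lambda>p vs. 0)"
  by (rule scaledI[OF computable_const[where k = 0]]) simp

lemma scaled_one: "scaled D (\<lambda>p vs. 1)"
  by (rule scaledI[OF computable_common_scale]) simp

lemma scaled_add:
  assumes "scaled D r" "scaled D r'"
  shows "scaled D (\<lambda>p vs. r p vs + r' p vs)"
  by (rule scaledI[OF computable_add[OF assms[THEN computable_numerator]]])
    (simp add: assms[THEN of_int_numerator] distrib_left)

lemma scaled_diff: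
  assumes "scaled D r" "scaled D r'"
  shows "scaled D (\<lambda>p vs. r p vs - r' p vs)"
  by (rule scaledI[OF computable_diff[OF assms[THEN computable_numerator]]])
    (simp add: assms[THEN of_int_numerator] right_diff_distrib)

lemma decidable_scaled_le:
  assumes "scaled D r" "scaled D r'"
  shows "decidable D (\<lambda>p vs. r p vs \<le> r' p vs)"
proof (rule decidable_cong[OF decidable_le[OF assms[THEN computable_numerator]] order_refl])
  fix p vs assume "(p, vs) \<in> D" "state p"
  then have "numerator (fst p) (r p vs) \<le> numerator (fst p) (r' p vs) \<longleftrightarrow>
      of_int (common_scale (fst p)) * r p vs \<le> of_int (common_scale (fst p)) * r' p vs"
    by (simp flip: assms[THEN of_int_numerator])
  then show "r p vs \<le> r' p vs \<longleftrightarrow> numerator (fst p) (r p vs) \<le> numerator (fst p) (r' p vs)"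
    using common_scale_pos[of "fst p"] by simp
qed

lemma scaled_If:
  assumes "decidable D P" "scaled {(p, vs) \<in> D. P p vs} r" "scaled {(p, vs) \<in> D. \<not> P p vs} r'"
  shows "scaled D (\<lambda>p vs. if P p vs then r p vs else r' p vs)"
  by (rule scaledI[OF computable_If[OF assms(1) assms(2,3)[THEN computable_numerator]]])
    (simp add: assms(2,3)[THEN of_int_numerator])

lemma scaled_max:
  assumes "scaled D r" "scaled D r'"
  shows "scaled D (\<lambda>p vs. max (r p vs) (r' p vs))"
  unfolding max_def
  by (intro scaled_If decidable_scaled_le assms;
    rule scaled_subset[OF assms(1)] scaled_subset[OF assms(2)]; auto)

lemma scaled_of_bool: "decidable D P \<Longrightarrow> scaled D (\<lambda>p vs. of_bool (P p vs))"
  unfolding of_bool_def by (intro scaled_If scaled_zero scaled_one)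

lemma of_int_numerator_each:
  assumes "scaled (each D S) (\<lambda>p vs. r p (tl vs) (index vs))" "(p, vs) \<in> D" "v \<in> S p vs" "state p"
  shows "of_int (numerator (fst p) (r p vs v)) = of_int (common_scale (fst p)) * r p vs v"
  using of_int_numerator[OF assms(1), of p "int v # vs"] assms(2-) by (simp add: each_iff)

lemma scaled_sum:
  assumes S: "decidable_set D S" and r: "scaled (each D S) (\<lambda>p vs. r p (tl vs) (index vs))"
  shows "scaled D (\<lambda>p vs. \<Sum>v\<in>S p vs. r p vs v)"
  by (rule scaledI[OF computable_sum[OF S computable_numerator[OF r]]])
    (simp add: of_int_numerator_each[OF r] sum_distrib_left)

lemma of_int_Max_image:
  assumes "finite S" "S \<noteq> {}" "\<And>v. v \<in> S \<Longrightarrow> of_int (z v) = c * r v" "0 < (c :: real)"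
  shows "of_int (Max (z ` S)) = c * Max (r ` S)"
proof -
  have "of_int (Max (z ` S)) = Max ((\<lambda>v. of_int (z v) :: real) ` S)"
    using assms(1,2) by (simp add: mono_Max_commute monoI image_image)
  also have "(\<lambda>v. of_int (z v) :: real) ` S = (*) c ` r ` S"
    using assms(3) by (auto simp: image_image)
  also have "Max \<dots> = c * Max (r ` S)"
    using assms by (intro mono_Max_commute[symmetric]) (auto intro!: monoI)
  finally show ?thesis .
qed

lemma of_int_Min_image:
  assumes "finite S" "S \<noteq> {}" "\<And>v. v \<in> S \<Longrightarrow> of_int (z v) = c * r v" "0 < (c :: real)"
  shows "of_int (Min (z ` S)) = c * Min (r ` S)"
proof -
  have "of_int (Min (z ` S)) = Min ((\<lambda>v. of_int (z v) :: real) ` S)"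
    using assms(1,2) by (simp add: mono_Min_commute monoI image_image)
  also have "(\<lambda>v. of_int (z v) :: real) ` S = (*) c ` r ` S"
    using assms(3) by (auto simp: image_image)
  also have "Min \<dots> = c * Min (r ` S)"
    using assms by (intro mono_Min_commute[symmetric]) (auto intro!: monoI)
  finally show ?thesis .
qed

lemma scaled_Min:
  assumes S: "decidable_set D S" and r: "scaled (each D S) (\<lambda>p vs. r p (tl vs) (index vs))"
    and nonempty: "\<And>p vs. (p, vs) \<in> D \<Longrightarrow> state p \<Longrightarrow> S p vs \<noteq> {}"
  shows "scaled D (\<lambda>p vs. Min (r p vs ` S p vs))"
  by (rule scaledI[OF computable_Min[OF S computable_numerator[OF r] nonempty]])
    (simp_all add: of_int_Min_image of_int_numerator_each[OF r]
      nonempty decidable_set_finite[OF S] common_scale_pos)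

lemma scaled_Max_insert_0:
  assumes S: "decidable_set D S" and r: "scaled (each D S) (\<lambda>p vs. r p (tl vs) (index vs))"
  shows "scaled D (\<lambda>p vs. Max (insert 0 (r p vs ` S p vs)))"
proof (rule scaledI[OF computable_Max_insert[OF S computable_const[where k = 0]
  computable_numerator[OF r]]])
  fix p vs assume pvs: "(p, vs) \<in> D" "state p"
  let ?with_0 = "\<lambda>h. case_option 0 h ` insert None (Some ` S p vs)"
  have "of_int (Max (?with_0 (\<lambda>v. numerator (fst p) (r p vs v))))
      = of_int (common_scale (fst p)) * Max (?with_0 (r p vs))"
    using decidable_set_finite[OF S pvs]
      of_int_numerator_each[OF r pvs(1) _ pvs(2)] common_scale_pos[of "fst p"]
    by (intro of_int_Max_image) auto
  then show "of_int (Max (insert 0 ((\<lambda>v. numerator (fst p) (r p vs v)) ` S p vs))) =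
      of_int (common_scale (fst p)) * Max (insert 0 (r p vs ` S p vs))"
    by (simp add: image_image)
qed

lemma scaled_divide:
  assumes r: "scaled D r" and k: "computable D k"
    and "\<And>p vs. (p, vs) \<in> D \<Longrightarrow> state p \<Longrightarrow> 0 < k p vs \<and>
        k p vs dvd fact (size_of (fst p)) * input (fst p) 3"
    and "\<And>p vs. (p, vs) \<in> D \<Longrightarrow> state p \<Longrightarrow> clears_denominator (fst p) (r p vs)"
  shows "scaled D (\<lambda>p vs. r p vs / of_int (k p vs))"
proof (rule scaledI[OF computable_div[OF computable_numerator[OF r] k]])
  fix p vs assume pvs: "(p, vs) \<in> D" "state p"
  show "of_int (numerator (fst p) (r p vs) div k p vs)
      = of_int (common_scale (fst p)) * (r p vs / of_int (k p vs))"
    using assms(3,4)[OF pvs] of_int_numerator[OF r pvs] by (intro scaled_div_eq) simp_all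
qed

lemma scaled_mult_price:
  assumes "scaled D r" "\<And>p vs. (p, vs) \<in> D \<Longrightarrow> state p \<Longrightarrow> clears_denominator (fst p) (r p vs)"
  shows "scaled D (\<lambda>p vs. real_of_rat (price (fst p)) * r p vs)"
proof -
  have denominator: "computable D (\<lambda>p vs. input (fst p) 3)"
    by (rule computable_input[of _ "\<lambda>p vs. 3"]) (simp_all add: computable_const)
  have "scaled D (\<lambda>p vs. r p vs / of_int (input (fst p) 3))"
    using assms(2) quotient_of_denom_pos'
    by (intro scaled_divide assms(1) denominator) (auto simp: input_header)
  note quotient = this
  have "computable D (\<lambda>p vs. input (fst p) 2 *
      numerator (fst p) (r p vs / of_int (input (fst p) 3)))"
    by (intro computable_input_mult computable_const computable_numerator[OF quotient])
  then show ?thesis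
    by (rule scaledI) (simp add: of_int_numerator[OF quotient, unfolded input_header]
      of_rat_quotient_of input_header)
qed

lemma scaled_input_fraction:
  assumes "computable D (\<lambda>p vs. int (a p vs))" "computable D (\<lambda>p vs. int (b p vs))"
    and "\<And>p vs. (p, vs) \<in> D \<Longrightarrow> state p \<Longrightarrow> input (fst p) (a p vs) = fst (quotient_of (r p vs)) \<and>
      input (fst p) (b p vs) = snd (quotient_of (r p vs)) \<and>
      snd (quotient_of (r p vs)) dvd common_denominator (fst p)"
  shows "scaled D (\<lambda>p vs. real_of_rat (r p vs))"
proof -
  have "computable D (\<lambda>p vs. input (fst p) (b p vs))" by (rule computable_input[OF assms(2)]) simp
  then have "computable D
      (\<lambda>p vs. input (fst p) (a p vs) * (common_scale (fst p) div input (fst p) (b p vs)))"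
    by (intro computable_input_mult computable_div computable_common_scale assms(1))
  then show ?thesis
  proof (rule scaledI)
    fix p vs assume pvs: "(p, vs) \<in> D" "state p"
    then have "snd (quotient_of (r p vs)) dvd common_scale (fst p)"
      using assms(3) by (simp add: common_scale_def)
    then show "of_int (input (fst p) (a p vs) * (common_scale (fst p) div input (fst p) (b p vs))) =
        of_int (common_scale (fst p)) * real_of_rat (r p vs)"
      using assms(3)[OF pvs] by (simp add: of_rat_quotient_of real_of_int_div)
  qed
qed

lemma scaled_distance:
  assumes "computable_point D u" "computable_point D v"
  shows "scaled D (\<lambda>p vs. dist_of (fst p) (u p vs) (v p vs))"
  unfolding distance_def
proof (rule scaled_input_fraction)
  fix p vs assume "(p, vs) \<in> D" "state p"
  then have uv: "u p vs < size_of (fst p)" "v p vs < size_of (fst p)"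
    using assms computable_point_less by blast+
  let ?addr = "\<lambda>c. pair_addr (size_of (fst p)) c (u p vs) (v p vs)"
    and ?fraction = "quotient_of (fl_dist (inst (fst p)) (u p vs) (v p vs))"
  show "input (fst p) (?addr 0) = fst ?fraction \<and> input (fst p) (?addr 1) = snd ?fraction \<and>
      snd ?fraction dvd common_denominator (fst p)"
    using input_distance[OF uv] input_dvd_common_denominator(2)[OF uv] by simp
qed (intro computable_pair_addr computable_pointD assms)+

lemma scaled_residual_cost:
  assumes i: "computable_point D i" and "\<And>p vs. (p, vs) \<in> D \<Longrightarrow> state p \<Longrightarrow> i p vs \<in> facs (fst p)"
  shows "scaled D (\<lambda>p vs. cost_of (fst p) (i p vs))"
proof -
  have "scaled D (\<lambda>p vs. real_of_rat (cost_II (inst (fst p)) (i p vs)))"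
  proof (rule scaled_input_fraction)
    fix p vs assume pvs: "(p, vs) \<in> D" "state p"
    note less = computable_point_less[OF i pvs]
    show "input (fst p) (record_addr 6 (i p vs))
        = fst (quotient_of (cost_II (inst (fst p)) (i p vs))) \<and>
      input (fst p) (record_addr 7 (i p vs)) = snd (quotient_of (cost_II (inst (fst p)) (i p vs))) \<and>
      snd (quotient_of (cost_II (inst (fst p)) (i p vs))) dvd common_denominator (fst p)"
      using input_record(5,6)[OF less] input_dvd_common_denominator(1)[OF less] assms(2)[OF pvs]
      by simp
  qed (intro computable_record_addr computable_pointD i)+
  then have "scaled D (\<lambda>p vs. if i p vs \<in> facs (fst p) \<and> opened (fst p) (i p vs) = 1 then 0
      else real_of_rat (cost_II (inst (fst p)) (i p vs)))"
    by (intro scaled_If decidable_opened[OF i] scaled_zero) (rule scaled_subset, blast, blast)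
  then show ?thesis by (rule scaled_cong) (simp_all add: residual_cost_def assms(2))
qed


section \<open>The cost shares are computable\<close>

abbreviation "closest_of q \<equiv> facility_location.closest (dist_of q)"
abbreviation "ratio_of q \<equiv> facility_location.ratio (dist_of q) (cost_of q)"
abbreviation "open_time_of q \<equiv> facility_location.open_time (dist_of q) (cost_of q)"
abbreviation "share_of q \<equiv> facility_location.share (dist_of q) (facs q) (cost_of q)"
abbreviation "next_share_of q \<equiv> facility_location.next_share (dist_of q) (facs q) (cost_of q)"
abbreviation "estimate_of q \<equiv> facility_location.estimate (dist_of q) (facs q) (cost_of q)"
abbreviation "next_client_of q \<equiv> second_stage.next_client (inst q) (opened q) (capacity q)"

lemma facility_location_state:
  assumes "state p"
  shows "facility_location (facs (fst p) \<union> clients (inst (fst p))) (dist_of (fst p)) (facs (fst p))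
    (cost_of (fst p))"
proof -
  interpret second_stage "inst (fst p)" "opened (fst p)"
    by (rule second_stage_query[OF state_query[OF assms]])
  show ?thesis by unfold_locales
qed

lemma decidable_set_closest:
  assumes S: "decidable_set D S" and i: "computable_point D i" and l: "computable_point D l"
  shows "decidable_set D (\<lambda>p vs. closest_of (fst p) (S p vs) (i p vs) (l p vs))"
proof -
  have "decidable_set D (\<lambda>p vs. {j \<in> S p vs.
      dist_of (fst p) (i p vs) j \<le> dist_of (fst p) (i p vs) (l p vs)})"
    by (intro decidable_set_filter S decidable_scaled_le scaled_distance
        computable_point_shift[OF i] computable_point_shift[OF l] computable_point_index)
  then show ?thesis
    by (rule decidable_set_cong)
      (simp add: facility_location.closest_def[OF facility_location_state])
qed

lemma scaled_ratio:
  assumes S: "decidable_set D S" and i: "computable_point D i" and l: "computable_point D l"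
    and facility: "\<And>p vs. (p, vs) \<in> D \<Longrightarrow> state p \<Longrightarrow> i p vs \<in> facs (fst p)"
    and member: "\<And>p vs. (p, vs) \<in> D \<Longrightarrow> state p \<Longrightarrow> l p vs \<in> S p vs"
  shows "scaled D (\<lambda>p vs. ratio_of (fst p) (S p vs) (i p vs) (l p vs))"
proof -
  let ?T = "\<lambda>p vs. closest_of (fst p) (S p vs) (i p vs) (l p vs)"
  let ?total = "\<lambda>p vs. cost_of (fst p) (i p vs) +
    (\<Sum>j\<in>?T p vs. dist_of (fst p) (i p vs) j)"
  have T: "decidable_set D ?T" by (rule decidable_set_closest[OF S i l])
  have "scaled D (\<lambda>p vs. ?total p vs / of_int (int (card (?T p vs))))"
  proof (rule scaled_divide)
    show "scaled D ?total"
      by (intro scaled_add scaled_sum T scaled_residual_cost i facility scaled_distance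
          computable_point_shift[OF i] computable_point_index)
    show "computable D (\<lambda>p vs. int (card (?T p vs)))" by (rule computable_card[OF T])
    fix p vs assume pvs: "(p, vs) \<in> D" "state p"
    have less: "i p vs < size_of (fst p)" "\<And>j. j \<in> ?T p vs \<Longrightarrow> j < size_of (fst p)"
      using computable_point_less[OF i pvs] decidable_set_bounded[OF T pvs] by auto
    have "0 < card (?T p vs)"
      using facility_location.card_closest_pos[OF facility_location_state[OF pvs(2)]
        decidable_set_finite[OF S pvs] member[OF pvs]] .
    moreover have "card (?T p vs) \<le> size_of (fst p)"
      using card_mono[OF _ decidable_set_bounded[OF T pvs]] by simp
    ultimately have "card (?T p vs) dvd fact (size_of (fst p))" by (intro dvd_fact) auto
    then have "int (card (?T p vs)) dvd fact (size_of (fst p))"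
      by (metis int_dvd_int_iff of_nat_fact)
    with \<open>0 < card (?T p vs)\<close>
    show "0 < int (card (?T p vs)) \<and>
        int (card (?T p vs)) dvd fact (size_of (fst p)) * input (fst p) 3"
      by simp
    show "clears_denominator (fst p) (?total p vs)"
      using less facility[OF pvs]
      by (intro clears_denominator_add clears_denominator_sum
        clears_denominator_residual_cost clears_denominator_distance)
  qed
  then show ?thesis
    by (rule scaled_cong) (simp_all add: facility_location.ratio_def[OF facility_location_state])
qed

lemma scaled_open_time:
  assumes S: "decidable_set D S" and i: "computable_point D i"
    and facility: "\<And>p vs. (p, vs) \<in> D \<Longrightarrow> state p \<Longrightarrow> i p vs \<in> facs (fst p)"
    and nonempty: "\<And>p vs. (p, vs) \<in> D \<Longrightarrow> state p \<Longrightarrow> S p vs \<noteq> {}"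
  shows "scaled D (\<lambda>p vs. open_time_of (fst p) (S p vs) (i p vs))"
proof -
  have "scaled (each D S) (\<lambda>p vs. ratio_of (fst p) (S p (tl vs)) (i p (tl vs)) (index vs))"
    using facility
    by (intro scaled_ratio decidable_set_shift[OF S]
      computable_point_shift[OF i] computable_point_index[OF S])
      (auto simp: each_iff)
  from scaled_Min[OF S this nonempty] show ?thesis
    by (rule scaled_cong)
      (simp_all add: facility_location.open_time_def[OF facility_location_state])
qed

lemma scaled_share:
  assumes S: "decidable_set D S" and j: "computable_point D j"
    and nonempty: "\<And>p vs. (p, vs) \<in> D \<Longrightarrow> state p \<Longrightarrow> S p vs \<noteq> {}"
  shows "scaled D (\<lambda>p vs. share_of (fst p) (S p vs) (j p vs))"
proof -
  let ?F = "\<lambda>p vs. facs (fst p)"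
  have index: "computable_point (each D ?F) (\<lambda>p vs. index vs)"
    by (rule computable_point_index[OF decidable_set_facilities])
  have "scaled (each D ?F) (\<lambda>p vs. max (open_time_of (fst p) (S p (tl vs)) (index vs))
      (dist_of (fst p) (index vs) (j p (tl vs))))"
    using nonempty
    by (intro scaled_max scaled_open_time scaled_distance
      decidable_set_shift[OF S] index computable_point_shift[OF j])
      (auto simp: each_iff)
  from scaled_Min[OF decidable_set_facilities this
    facility_location.F_nonempty[OF facility_location_state]]
  show ?thesis
    by (rule scaled_cong) (simp_all add: facility_location.share_def[OF facility_location_state])
qed

lemma scaled_share_insert:
  assumes "decidable_set D B" "decidable_set D S"
  shows "scaled (each D S) (\<lambda>p vs. share_of (fst p) (insert (index vs) (B p (tl vs))) (index vs))"
  by (intro scaled_share decidable_set_insert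
    decidable_set_shift[OF assms(1)] computable_point_index[OF assms(2)]) simp

lemma scaled_next_share:
  assumes C: "decidable_set D C" and B: "decidable_set D B"
  shows "scaled D (\<lambda>p vs. next_share_of (fst p) (C p vs) (B p vs))"
  using scaled_Max_insert_0[OF decidable_set_diff[OF C B]
    scaled_share_insert[OF B decidable_set_diff[OF C B]]]
  by (rule scaled_cong) (simp_all add: facility_location.next_share_def[OF facility_location_state])

lemma scaled_estimate:
  assumes C: "decidable_set D C" and B: "decidable_set D B"
  shows "scaled D (\<lambda>p vs. estimate_of (fst p) (C p vs) (B p vs))"
proof -
  have "scaled (each D B) (\<lambda>p vs. share_of (fst p) (B p (tl vs)) (index vs))"
    by (intro scaled_share decidable_set_shift[OF B] computable_point_index[OF B])
      (auto simp: each_iff)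
  then have "scaled D (\<lambda>p vs. (\<Sum>j\<in>B p vs. share_of (fst p) (B p vs) j) +
      (\<Sum>j\<in>B p vs. next_share_of (fst p) (C p vs) (B p vs)))"
    by (intro scaled_add scaled_sum[OF B] scaled_shift scaled_next_share C B)
  then show ?thesis
    by (rule scaled_cong) (simp_all add: facility_location.estimate_def[OF facility_location_state])
qed

lemma computable_argmax:
  assumes S: "decidable_set D S" and h: "scaled (each D S) (\<lambda>p vs. h p (tl vs) (index vs))"
  shows "computable D (\<lambda>p vs. int (argmax_below (size_of (fst p)) (S p vs) (h p vs)))"
proof -
  let ?best = "\<lambda>p vs. {v \<in> S p vs. \<forall>u\<in>S p vs. h p vs u \<le> h p vs v}"
  have best: "decidable_set D ?best"
  proof (intro decidable_set_filter S decidable_ball decidable_set_shift decidable_scaled_le)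
    show "scaled (each (each D S) (\<lambda>p vs. S p (tl vs))) (\<lambda>p vs. h p (tl (tl vs)) (index vs))"
      using scaled_shift_second[OF h, of "\<lambda>p vs. int ` S p vs"] by simp
    show "scaled (each (each D S) (\<lambda>p vs. S p (tl vs))) (\<lambda>p vs. h p (tl (tl vs)) (index (tl vs)))"
      by (rule scaled_shift[OF h])
  qed
  have "computable D (\<lambda>p vs. Min (insert (int (size_of (fst p))) (int ` ?best p vs)))"
    by (intro computable_Min_insert best computable_size computable_index)
  then show ?thesis
  proof (rule computable_cong[OF _ order_refl])
    fix p vs assume "(p, vs) \<in> D" "state p"
    then have "finite (?best p vs)" by (rule decidable_set_finite[OF best])
    then show "int (argmax_below (size_of (fst p)) (S p vs) (h p vs)) =
        Min (insert (int (size_of (fst p))) (int ` ?best p vs))"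
      unfolding argmax_below_def by (subst mono_Min_commute[of int]) (auto intro: monoI)
  qed
qed

lemma computable_next_client:
  assumes C: "decidable_set D C" and B: "decidable_set D B"
  shows "computable D (\<lambda>p vs. int (next_client_of (fst p) (C p vs) (B p vs)))"
proof -
  let ?S = "\<lambda>p vs. {j \<in> C p vs - B p vs. \<not> int (capacity (fst p)) \<le> int (card (B p vs))}"
  have capacity: "computable D (\<lambda>p vs. int (capacity (fst p)))" for D
    by (rule computable_input[of _ "\<lambda>p vs. 1"])
      (simp_all only: input_header(2) of_nat_1 computable_const)
  have S: "decidable_set D ?S"
    by (intro decidable_set_filter decidable_set_diff C B decidable_not decidable_le capacity
        computable_card decidable_set_shift[OF B])
  have "computable D (\<lambda>p vs. int (argmax_below (size_of (fst p)) (?S p vs)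
      (\<lambda>j. share_of (fst p) (insert j (B p vs)) j)))"
    by (intro computable_argmax S scaled_share_insert B)
  then show ?thesis
  proof (rule computable_cong[OF _ order_refl])
    fix p vs assume "state p"
    have "?S p vs = {j \<in> C p vs. j \<notin> B p vs \<and> card (B p vs) < capacity (fst p)}" by auto
    then show "int (next_client_of (fst p) (C p vs) (B p vs)) =
        int (argmax_below (size_of (fst p)) (?S p vs) (\<lambda>j. share_of (fst p) (insert j (B p vs)) j))"
      by (simp add: second_stage.next_client_def
        [OF second_stage_query[OF state_query[OF \<open>state p\<close>]]])
  qed
qed


section \<open>The algorithm\<close>

locale level_scheme =
  fixes \<kappa> :: "fl_instance \<Rightarrow> nat set \<Rightarrow> nat set \<Rightarrow> ennreal"
    and L :: "fl_query \<Rightarrow> nat set" and lv :: "fl_query \<Rightarrow> nat \<Rightarrow> real"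
  assumes leveled: "q \<in> fl_queries \<Longrightarrow> leveled_query (inst q) (opened q) (capacity q)
      (real_of_rat (price q)) (current q) \<kappa> (L q) (lv q)"
    and decidable_set_L: "decidable_set D (\<lambda>p vs. L (fst p))"
    and scaled_lv: "computable_point D v \<Longrightarrow> scaled D (\<lambda>p vs. lv (fst p) (v p vs))"
    and lv_clears: "q \<in> fl_queries \<Longrightarrow> u < size_of q \<Longrightarrow> clears_denominator q (lv q u)"
begin

abbreviation "below q r \<equiv> level_set (L q) (lv q) r"

abbreviation "gain_of p \<equiv> second_stage.surplus (inst (fst p))
    (opened (fst p)) (real_of_rat (price (fst p)))
  (L (fst p)) (lv (fst p)) (snd p)"

abbreviation "best_of p \<equiv> second_stage.best_level (inst (fst p)) (opened (fst p))
  (real_of_rat (price (fst p))) (L (fst p)) (lv (fst p)) (snd p)"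

definition answer_of :: "fl_query \<times> (nat \<Rightarrow> nat set) \<Rightarrow> nat set" where
  "answer_of p = second_stage.answer (inst (fst p)) (opened (fst p)) (real_of_rat (price (fst p)))
     (current (fst p)) (L (fst p)) (lv (fst p)) (snd p)"

definition grow_at :: "fl_query \<Rightarrow> nat \<Rightarrow> nat set \<Rightarrow> nat set" where
  "grow_at q r = second_stage.grow (inst q) (opened q) (capacity q) (below q r)"

lemma decidable_set_level_set:
  assumes r: "computable_point D r"
  shows "decidable_set D (\<lambda>p vs. below (fst p) (r p vs))"
  unfolding level_set_def
  by (intro decidable_set_filter decidable_set_L decidable_scaled_le scaled_lv
      computable_point_index computable_point_shift[OF r])

lemma scaled_surplus:
  assumes r: "computable_point D r"
  shows "scaled D (\<lambda>p vs. gain_of p (r p vs))"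
proof -
  let ?cost = "\<lambda>p vs. real_of_rat (price (fst p)) * lv (fst p) (r p vs)"
  have cost: "scaled D ?cost"
    using lv_clears[OF state_query] computable_point_less[OF r]
    by (intro scaled_mult_price scaled_lv r) auto
  have "scaled D (\<lambda>p vs. estimate_of (fst p) (below (fst p) (r p vs)) (snd p (r p vs))
      - (?cost p vs + ?cost p vs))"
    by (intro scaled_diff scaled_add cost scaled_estimate
      decidable_set_level_set decidable_set_chosen r)
  then show ?thesis
    by (rule scaled_cong)
      (simp_all add: second_stage.surplus_def[OF second_stage_query[OF state_query]])
qed

lemma computable_best_level:
  "computable D (\<lambda>p vs. int (best_of p))"
proof -
  let ?S = "\<lambda>p vs. {r \<in> {..<size_of (fst p)}. \<not> gain_of p r \<le> 0}"
  have S: "decidable_set D ?S" for D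
    by (intro decidable_set_filter decidable_set_size decidable_not decidable_scaled_le scaled_zero
        scaled_surplus computable_point_index)
  have "computable D (\<lambda>p vs. int (argmax_below (size_of (fst p)) (?S p vs) (gain_of p)))"
    by (intro computable_argmax S scaled_surplus computable_point_index)
  then show ?thesis
    by (rule computable_cong)
      (simp_all add: second_stage.best_level_def[OF second_stage_query[OF state_query]] not_le)
qed

lemma decidable_answer:
  assumes v: "computable_point D v"
  shows "decidable D (\<lambda>p vs. v p vs \<in> answer_of p)"
proof -
  let ?found = "\<lambda>p. \<not> int (size_of (fst p)) \<le> int (best_of p)"
  have best: "computable_point {(p, vs) \<in> D. ?found p} (\<lambda>p vs. best_of p)"
    by (auto simp: computable_point_def intro: computable_best_level)
  have "computable D (\<lambda>p vs. if ?found p then of_bool (v p vs \<in> snd p (best_of p))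
      else of_bool (v p vs \<in> current (fst p)))"
    by (intro computable_If decidable_not decidable_le computable_size computable_best_level
        decidable_chosen[OF best, unfolded decidable_def] decidable_current[unfolded decidable_def])
      (rule computable_point_subset[OF v], blast)+
  then show ?thesis
    unfolding decidable_def
    by (rule computable_cong)
      (simp_all add: answer_of_def second_stage.answer_def[OF second_stage_query[OF state_query]])
qed

end

lemma chosen_addr_inject:
  assumes "j \<le> n" "v < n" "chosen_addr n r j = chosen_addr n r' v"
  shows "r = r' \<and> j = v"
proof -
  have "(chosen_addr n r u) div Suc n = r" "(chosen_addr n r u) mod Suc n = u" if "u \<le> n" for r u
  proof -
    have "chosen_addr n r u = u + r * Suc n" by (simp add: chosen_addr_def)
    then show "chosen_addr n r u div Suc n = r" "chosen_addr n r u mod Suc n = u"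
      using that by (simp_all only: div_mult_self1 mod_mult_self1 Suc_neq_Zero
        not_False_eq_True le_imp_less_Suc div_less mod_less add_0_right)
  qed
  then show ?thesis using assms by (metis less_imp_le)
qed

lemma represents_insert:
  assumes p: "represents p s" and r: "r < size_of (fst p)" and j: "j \<le> size_of (fst p)"
    and s': "s' 0 = s 0" "s' 2 = (s 2)(chosen_addr (size_of (fst p)) r j := 1)"
  shows "represents (fst p, (snd p)(r := insert j (snd p r) \<inter> {..<size_of (fst p)})) s'"
proof -
  have "s' 2 (chosen_addr (size_of (fst p)) r' v)
      = of_bool (v \<in> ((snd p)(r := insert j (snd p r) \<inter> {..<size_of (fst p)})) r')"
    if "r' < size_of (fst p)" "v < size_of (fst p)" for r' v
    using p that chosen_addr_inject[OF j that(2), of r r']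
    unfolding s' by (auto simp: represents_def)
  then show ?thesis using p s'(1) by (simp add: represents_def)
qed

context level_scheme
begin

lemma grow_step_prog:
  obtains c where "wf_prog c" "writes c \<subseteq> insert 2 {5..}"
    "\<And>p s r. represents p s \<Longrightarrow> s 3 0 = int r \<Longrightarrow> r < size_of (fst p) \<Longrightarrow>
      represents (fst p, (snd p)(r := grow_at (fst p) r (snd p r))) (run c s)"
proof -
  let ?D = "each (UNIV \<times> {[]}) (\<lambda>p _. {..<size_of (fst p)})"
  let ?next = "\<lambda>p r. next_client_of (fst p) (below (fst p) r) (snd p r)"
  have r: "computable_point ?D (\<lambda>p vs. index vs)"
    by (rule computable_point_index[OF decidable_set_size])
  have "computable ?D (\<lambda>p vs. int (chosen_addr (size_of (fst p)) (index vs) (?next p (index vs))))"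
    by (intro computable_chosen_addr computable_next_client
      decidable_set_level_set decidable_set_chosen
        computable_pointD r)
  from computable_assign[OF this computable_const[where k = 1], of 5 "[3]" 2]
  obtain c where c: "wf_prog c" "writes c \<subseteq> insert 2 {5..}"
    "\<And>p s vs b. represents p s \<Longrightarrow> stack [3] s = vs \<Longrightarrow> (p, vs) \<in> ?D \<Longrightarrow> b < 5 \<Longrightarrow>
      run c s b = upd s 2
        (nat (int (chosen_addr (size_of (fst p)) (index vs) (?next p (index vs))))) 1 b"
    by auto
  show thesis
  proof (rule that[OF c(1,2)])
    fix p s r assume s: "represents p s" "s 3 0 = int r" "r < size_of (fst p)"
    interpret second_stage "inst (fst p)" "opened (fst p)"
      by (rule second_stage_query[OF state_query[OF stateI[OF s(1)]]])
    have "run c s b = upd s 2 (chosen_addr (size_of (fst p)) r (?next p r)) 1 b" if "b < 5" for b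
      using c(3)[OF s(1) refl _ that] s(2,3) by (simp add: each_iff)
    moreover have "finite (below (fst p) r)"
      using decidable_set_finite[OF decidable_set_level_set[OF r], of p "[int r]"]
        s(3) stateI[OF s(1)]
      by (simp add: each_iff)
    then have "?next p r \<le> size_of (fst p)" by (rule next_client_le)
    ultimately show "represents (fst p, (snd p)(r := grow_at (fst p) r (snd p r))) (run c s)"
      unfolding grow_at_def grow_def using s by (intro represents_insert) simp_all
  qed
qed

lemma answer_step_prog:
  obtains c where "wf_prog c" "writes c \<subseteq> insert 1 {4..}"
    "\<And>p s v. represents p s \<Longrightarrow> s 3 0 = int v \<Longrightarrow> v < size_of (fst p) \<Longrightarrow>
      run c s 1 = (s 1)(v := of_bool (v \<in> answer_of p))"
proof -
  let ?D = "each (UNIV \<times> {[]}) (\<lambda>p _. {..<size_of (fst p)})"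
  have v: "computable_point ?D (\<lambda>p vs. index vs)"
    by (rule computable_point_index[OF decidable_set_size])
  from computable_assign[OF computable_pointD[OF v]
    decidable_answer[OF v, unfolded decidable_def], of 4 "[3]" 1]
  obtain c where c: "wf_prog c" "writes c \<subseteq> insert 1 {4..}"
    "\<And>p s vs b. represents p s \<Longrightarrow> stack [3] s = vs \<Longrightarrow> (p, vs) \<in> ?D \<Longrightarrow> b < 4 \<Longrightarrow>
      run c s b = upd s 1 (nat (int (index vs))) (of_bool (index vs \<in> answer_of p)) b"
    by auto
  show thesis
  proof (rule that[OF c(1,2)])
    fix p s v assume s: "represents p s" "s 3 0 = int v" "v < size_of (fst p)"
    show "run c s 1 = (s 1)(v := of_bool (v \<in> answer_of p))"
      using c(3)[OF s(1) refl, of 1] s(2,3) by (simp add: each_iff)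
  qed
qed

lemma represents_counter: "represents p s \<Longrightarrow> 2 < a \<Longrightarrow> represents p (upd s a i x)"
  by (rule represents_upd) simp_all

lemma represents_nat_size: "represents p s \<Longrightarrow> nat (s 0 0) = size_of (fst p)"
  by (simp add: represents_size)

lemma grow_level_prog:
  obtains c where "wf_prog c" "writes c \<subseteq> insert 2 {4..}"
    "\<And>p s r. represents p s \<Longrightarrow> s 3 0 = int r \<Longrightarrow> r < size_of (fst p) \<Longrightarrow>
      represents (fst p, (snd p)(r := (grow_at (fst p) r ^^ size_of (fst p)) (snd p r))) (run c s)"
proof -
  obtain c where c: "wf_prog c" "writes c \<subseteq> insert 2 {5..}"
    and step: "\<And>p s r. represents p s \<Longrightarrow> s 3 0 = int r \<Longrightarrow> r < size_of (fst p) \<Longrightarrow>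
      represents (fst p, (snd p)(r := grow_at (fst p) r (snd p r))) (run c s)"
    by (rule grow_step_prog) blast
  show thesis
  proof (rule that[of "LFor 4 c"])
    fix p s r assume s: "represents p s" "s 3 0 = int r" "r < size_of (fst p)"
    define Inv where "Inv t u \<longleftrightarrow>
      represents (fst p, (snd p)(r := (grow_at (fst p) r ^^ t) (snd p r))) u \<and> u 3 0 = int r"
        for t u
    have "Inv (nat (s 0 0)) (run (LFor 4 c) s)"
    proof (rule run_LFor_invariant)
      show "Inv 0 (upd s 4 0 0)" using s by (simp add: Inv_def represents_counter)
      fix t u assume "Inv t u"
      then have "represents (fst p, (snd p)(r := (grow_at (fst p) r ^^ Suc t) (snd p r))) (run c u)"
        "u 3 0 = int r"
        using step[of "(fst p, (snd p)(r := (grow_at (fst p) r ^^ t) (snd p r)))" u r] s(3)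
        by (simp_all add: Inv_def grow_at_def)
      moreover have "run c u 3 = u 3" using c(2) by (intro run_unwritten) auto
      ultimately show "Inv (Suc t) (upd (run c u) 4 0 (int (Suc t)))"
        by (simp add: Inv_def represents_counter)
    qed (use c(2) in auto)
    then show "represents (fst p, (snd p)(r := (grow_at (fst p) r ^^ size_of (fst p)) (snd p r)))
        (run (LFor 4 c) s)"
      by (simp only: Inv_def represents_nat_size[OF s(1)])
  qed (use c in auto)
qed

definition greedy_sets :: "fl_query \<Rightarrow> nat \<Rightarrow> nat \<Rightarrow> nat set" where
  "greedy_sets q m r = (if r < m then
     second_stage.greedy_set (inst q) (opened q) (capacity q) (below q r) else {})"

lemma greedy_sets_Suc:
  assumes "q \<in> fl_queries"
  shows "(greedy_sets q m)(m := (grow_at q m ^^ size_of q) (greedy_sets q m m))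
      = greedy_sets q (Suc m)"
  by (auto simp: fun_eq_iff greedy_sets_def less_Suc_eq grow_at_def
      second_stage.greedy_set_def[OF second_stage_query[OF assms]])

lemma grow_prog:
  obtains c where "wf_prog c" "1 \<notin> writes c"
    "\<And>q s. represents (q, \<lambda>_. {}) s \<Longrightarrow> represents (q, greedy_sets q (size_of q)) (run c s)"
proof -
  obtain c where c: "wf_prog c" "writes c \<subseteq> insert 2 {4..}"
    and level: "\<And>p s r. represents p s \<Longrightarrow> s 3 0 = int r \<Longrightarrow> r < size_of (fst p) \<Longrightarrow>
      represents (fst p, (snd p)(r := (grow_at (fst p) r ^^ size_of (fst p)) (snd p r))) (run c s)"
    by (rule grow_level_prog) blast
  show thesis
  proof (rule that[of "LFor 3 c"])
    fix q s assume s: "represents (q, \<lambda>_. {}) s"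
    have n: "nat (s 0 0) = size_of q" using represents_nat_size[OF s] by simp
    have "represents (q, greedy_sets q (nat (s 0 0))) (run (LFor 3 c) s)"
    proof (rule run_LFor_invariant[where Inv = "\<lambda>i. represents (q, greedy_sets q i)"])
      show "represents (q, greedy_sets q 0) (upd s 3 0 0)"
        using s by (simp add: greedy_sets_def[abs_def] represents_counter)
      fix i u assume i: "i < nat (s 0 0)" "u 3 0 = int i" "represents (q, greedy_sets q i) u"
      have "q \<in> fl_queries" using s by (simp add: represents_def)
      with level[OF i(3,2)] i(1) n have "represents (q, greedy_sets q (Suc i)) (run c u)"
        by (simp add: greedy_sets_Suc)
      then show "represents (q, greedy_sets q (Suc i)) (upd (run c u) 3 0 (int (Suc i)))"
        by (simp add: represents_counter)
    qed (use c(2) in auto)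
    then show "represents (q, greedy_sets q (size_of q)) (run (LFor 3 c) s)" by (simp only: n)
  qed (use c in auto)
qed

lemma answer_prog:
  obtains c where "wf_prog c"
    "\<And>p s. represents p s \<Longrightarrow> s 1 = (\<lambda>_. 0) \<Longrightarrow>
        output_set (run c s) = answer_of p \<inter> {..<size_of (fst p)}"
proof -
  obtain c where c: "wf_prog c" "writes c \<subseteq> insert 1 {4..}"
    and step: "\<And>p s v. represents p s \<Longrightarrow> s 3 0 = int v \<Longrightarrow> v < size_of (fst p) \<Longrightarrow>
      run c s 1 = (s 1)(v := of_bool (v \<in> answer_of p))"
    by (rule answer_step_prog) blast
  have frame: "run c s 0 = s 0" "run c s 2 = s 2" for s
    using c(2) by (auto intro!: run_unwritten)
  show thesis
  proof (rule that[of "LFor 3 c"])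
    fix p s assume s: "represents p s" "s 1 = (\<lambda>_. 0)"
    define Inv where "Inv i u \<longleftrightarrow> represents p u \<and> u 1 = (\<lambda>v. of_bool (v < i \<and> v \<in> answer_of p))"
      for i and u :: store
    have n: "nat (s 0 0) = size_of (fst p)" using s by (simp add: represents_def input_header)
    have "Inv (nat (s 0 0)) (run (LFor 3 c) s)"
    proof (rule run_LFor_invariant)
      show "Inv 0 (upd s 3 0 0)" using s by (simp add: Inv_def represents_counter)
      fix i u assume i: "i < nat (s 0 0)" "u 3 0 = int i" "Inv i u"
      then have "run c u 1 = (\<lambda>v. of_bool (v < Suc i \<and> v \<in> answer_of p))"
        using step[of p u i] n by (auto simp: Inv_def less_Suc_eq)
      moreover have "represents p (run c u)" using i(3) by (simp add: Inv_def represents_def frame)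
      ultimately show "Inv (Suc i) (upd (run c u) 3 0 (int (Suc i)))"
        by (simp add: Inv_def represents_counter)
    qed (use c(2) in auto)
    then show "output_set (run (LFor 3 c) s) = answer_of p \<inter> {..<size_of (fst p)}"
      by (auto simp: Inv_def n output_set_def)
  qed (use c in auto)
qed

lemma answer_of_greedy_sets:
  assumes q: "q \<in> fl_queries"
  shows "approx_scenario \<kappa> 6 1 (inst q) (capacity q) (opened q) (real_of_rat (price q)) (current q)
    (answer_of (q, greedy_sets q (size_of q)))"
proof -
  interpret leveled_query "inst q" "opened q" "capacity q"
    "real_of_rat (price q)" "current q" \<kappa> "L q" "lv q"
    by (rule leveled[OF q])
  have "answer_of (q, greedy_sets q (size_of q)) =
      answer (real_of_rat (price q)) (current q) (L q) (lv q)
          (\<lambda>r. greedy_set (capacity q) (below q r))"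
    unfolding answer_of_def fst_conv snd_conv by (rule answer_cong) (simp add: greedy_sets_def)
  then show ?thesis using answer_approx by simp
qed

lemma answer_of_greedy_sets_bounded:
  assumes "q \<in> fl_queries"
  shows "answer_of (q, greedy_sets q (size_of q)) \<subseteq> {..<size_of q}"
  using answer_of_greedy_sets[OF assms] client_less_size[OF assms]
  by (auto simp: approx_scenario_def k_bounded_scenarios_def)

theorem has_polytime_approximation: "has_polytime_approximation \<kappa> 6 1"
  unfolding has_polytime_approximation_def
proof -
  obtain grow where grow: "wf_prog grow" "1 \<notin> writes grow"
    "\<And>q s. represents (q, \<lambda>_. {}) s \<Longrightarrow> represents (q, greedy_sets q (size_of q)) (run grow s)"
    by (rule grow_prog) blast
  obtain answer where answer: "wf_prog answer" "\<And>p s. represents p s \<Longrightarrow> s 1 = (\<lambda>_. 0) \<Longrightarrow>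
      output_set (run answer s) = answer_of p \<inter> {..<size_of (fst p)}"
    by (rule answer_prog) blast
  show "polytime_solvable fl_queries encode_query
      (\<lambda>(I, k, x, y, A) B. approx_scenario \<kappa> 6 1 I k x (real_of_rat y) A B)"
  proof (rule polytime_solvable_loop_prog)
    show "wf_prog (LSeq grow answer)" using grow(1) answer(1) by simp
    fix q assume q: "q \<in> fl_queries"
    let ?s = "input_store (encode_query q)"
    show "?s 0 0 \<in> {0..int (length (encode_query q))}"
      using input_header(1)[of q] size_le_length_encode_query[of q] by (simp add: input_def)
    have "?s b i = 0" if "b \<noteq> 0" for b i using that by (simp add: input_store_def)
    then have "represents (q, \<lambda>_. {}) ?s" "run grow ?s 1 = (\<lambda>_. 0)"
      using q grow(2) by (auto simp: represents_def input_def run_unwritten)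
    then have "output_set (run (LSeq grow answer) ?s) = answer_of (q, greedy_sets q (size_of q))"
      using answer(2)[OF grow(3)] answer_of_greedy_sets_bounded[OF q] by (simp add: Int_absorb2)
    then show "(\<lambda>(I, k, x, y, A) B. approx_scenario \<kappa> 6 1 I k x (real_of_rat y) A B) q
        (output_set (run (LSeq grow answer) ?s))"
      using answer_of_greedy_sets[OF q] by (cases q) simp
  qed
qed

end


section \<open>Both scenario metrics\<close>

lemma price_nonneg: "q \<in> fl_queries \<Longrightarrow> 0 \<le> real_of_rat (price q)"
  by (cases q) (simp add: fl_queries_def)

lemma decidable_current_empty: "decidable D (\<lambda>p vs. current (fst p) = {})"
  using decidable_le[OF computable_card[OF decidable_set_current] computable_const[where k = 0]]
  by (rule decidable_cong) (use decidable_set_finite[OF decidable_set_current] in auto)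

lemma decidable_price_pos: "decidable D (\<lambda>p vs. 0 < real_of_rat (price (fst p)))"
proof -
  have "scaled D (\<lambda>p vs. real_of_rat (price (fst p)) * 1)"
    using clears_denominator_of_bool[of _ True] by (intro scaled_mult_price scaled_one) simp
  from decidable_not[OF decidable_scaled_le[OF this scaled_zero]] show ?thesis by (simp add: not_le)
qed

lemma decidable_set_clients: "decidable_set D (\<lambda>p vs. clients (inst (fst p)))"
  by (rule decidable_set_record[OF input_record(2) client_less_size])

lemma level_scheme_discrete:
  "level_scheme kappa_discrete (\<lambda>q. clients (inst q)) (\<lambda>q. discrete_level (current q))"
proof (rule level_scheme.intro)
  show "leveled_query (inst q) (opened q) (capacity q)
      (real_of_rat (price q)) (current q) kappa_discrete
      (clients (inst q)) (discrete_level (current q))" if "q \<in> fl_queries" for q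
    by (intro second_stage.leveled_query_discrete
      second_stage_query price_nonneg current_scenario that)
  show "decidable_set D (\<lambda>p vs. clients (inst (fst p)))" for D by (rule decidable_set_clients)
  show "scaled D (\<lambda>p vs. discrete_level (current (fst p)) (v p vs))"
    if "computable_point D v" for D v
    unfolding discrete_level_def by (intro scaled_of_bool decidable_not decidable_current that)
  show "clears_denominator q (discrete_level (current q) u)" if "u < size_of q" for q u
    unfolding discrete_level_def by (rule clears_denominator_of_bool)
qed

lemma level_scheme_asym:
  "level_scheme kappa_asym (\<lambda>q. asym_clients (inst q) (real_of_rat (price q)) (current q))
    (\<lambda>q. asym_level (inst q) (current q))"
proof (rule level_scheme.intro)
  show "leveled_query (inst q) (opened q) (capacity q)
      (real_of_rat (price q)) (current q) kappa_asym
      (asym_clients (inst q) (real_of_rat (price q)) (current q)) (asym_level (inst q) (current q))"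
    if "q \<in> fl_queries" for q
    by (intro second_stage.leveled_query_asym second_stage_query price_nonneg current_scenario that)
  show "decidable_set D
      (\<lambda>p vs. asym_clients (inst (fst p)) (real_of_rat (price (fst p))) (current (fst p)))" for D
  proof -
    have "decidable_set D (\<lambda>p vs. {v \<in> clients (inst (fst p)).
        \<not> (current (fst p) = {} \<and> 0 < real_of_rat (price (fst p)))})"
      by (intro decidable_set_filter decidable_set_clients decidable_not decidable_conj
          decidable_current_empty decidable_price_pos)
    then show ?thesis by (rule decidable_set_cong) (auto simp: asym_clients_def)
  qed
  show "scaled D (\<lambda>p vs. asym_level (inst (fst p)) (current (fst p)) (v p vs))"
    if v: "computable_point D v" for D v
    unfolding asym_level_def
  proof (intro scaled_If scaled_zero decidable_current_empty
    scaled_Min decidable_set_current scaled_distance)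
    show "computable_point (each {(p, vs) \<in> D. current (fst p) \<noteq> {}} (\<lambda>p vs. current (fst p)))
        (\<lambda>p vs. v p (tl vs))"
      by (rule computable_point_shift[OF computable_point_subset[OF v]]) auto
  qed (auto intro: computable_point_index decidable_set_current)
  show "clears_denominator q (asym_level (inst q) (current q) u)"
    if q: "q \<in> fl_queries" "u < size_of q" for q u
  proof (cases "current q = {}")
    case True
    then show ?thesis using clears_denominator_of_bool[of q False] by (simp add: asym_level_def)
  next
    case False
    have "finite (current q)" using current_less_size[OF q(1)] finite_nat_set_iff_bounded by blast
    then have "Min (dist_of q u ` current q) \<in> dist_of q u ` current q"
      using False by (intro Min_in) auto
    then obtain w where w: "w \<in> current q" "Min (dist_of q u ` current q) = dist_of q u w" by auto
    then show ?thesis using False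
      clears_denominator_distance[OF q(2) current_less_size[OF q(1) w(1)]]
      by (simp add: asym_level_def)
  qed
qed

theorem theorem3p20:
  shows "has_polytime_approximation kappa_discrete 6 1 \<and> has_polytime_approximation kappa_asym 6 1"
  using level_scheme.has_polytime_approximation level_scheme_discrete level_scheme_asym by blast

end
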